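(* Let $\Omega\subset\mathbb{R}^N$ be a bounded smooth domain and $r,s\in(0,1)$. For every $p\ge2$ with $p\min\{r,s\}\ge N$ let $\alpha_p,\beta_p\in(0,p)$ satisfy $\alpha_p+\beta_p=p$ and $\min\{\alpha_p,\beta_p\}\ge1$, and assume that $$\lim_{p\to\infty}\frac{\alpha_p}{p}=\Gamma\quad\text{with } 0<\Gamma<1 .$$ Let $\lambda_{1,p}$ be the first eigenvalue of the system with exponents $\alpha_p,\beta_p$, and let $(u_p,v_p)$ be an eigenpair corresponding to $\lambda_{1,p}$ with $u_p,v_p>0$ in $\Omega$ and $\int_\Omega |u_p|^{\alpha_p}|v_p|^{\beta_p}\,dx=1$. Then $$\lim_{p\to\infty}[\lambda_{1,p}]^{1/p}=\Lambda_{1,\infty},\qquad \Lambda_{1,\infty}:=\inf\left\{\frac{\max\{[u]_{r,\infty},[v]_{s,\infty}\}}{\||u|^\Gamma|v|^{1-\Gamma}\|_{L^\infty(\Omega)}}\colon (u,v)\in\widetilde W^{r,\infty}(\Omega)\times\widetilde W^{s,\infty}(\Omega),\ uv\not\equiv0\right\}.$$ Moreover, $$\Lambda_{1,\infty}=\left[\frac{1}{R(\Omega)}\right]^{(1-\Gamma)s+\Gamma r},\qquad R(\Omega):=\max_{x\in\Omega}\operatorname{dist}(x,\partial\Omega).$$ Lastly, there are a sequence $p_j\to\infty$ and a pair $(u_\infty,v_\infty)$ such that $(u_{p_j},v_{p_j})\to(u_\infty,v_\infty)$ uniformly in $\overline\Omega$, where $(u_\infty,v_\infty)$ is a minimizer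 of $\Lambda_{1,\infty}$ and (extended by zero outside $\Omega$) is a viscosity solution of $$\begin{cases}\min\left\{\mathcal{L}_{r,\infty}u(x);\ \mathcal{L}^+_{r,\infty}u(x)-\Lambda_{1,\infty}u^\Gamma(x)v^{1-\Gamma}(x)\right\}=0&\text{in }\Omega,\\ \min\left\{\mathcal{L}_{s,\infty}v(x);\ \mathcal{L}^+_{s,\infty}v(x)-\Lambda_{1,\infty}u^\Gamma(x)v^{1-\Gamma}(x)\right\}=0&\text{in }\Omega,\\ u=v=0&\text{in }\mathbb{R}^N\setminus\Omega.\end{cases}$$
   Context: **Finite $p$.** For $t\in(0,1)$ and $p>1$, $W^{t,p}(\Omega)=\{w\in L^p(\Omega)\colon \int_{\Omega\times\Omega}\frac{|w(x)-w(y)|^p}{|x-y|^{N+tp}}\,dx\,dy<\infty\}$, and $\widetilde W^{t,p}(\Omega)$ is the space of all $w\in W^{t,p}(\Omega)$ whose extension by zero outside $\Omega$ belongs to $W^{t,p}(\mathbb{R}^N)$; its elements are identified with their extensions by zero. Put $[w]_{t,p}^p=\int_{\mathbb{R}^{2N}}\frac{|w(x)-w(y)|^p}{|x-y|^{N+tp}}\,dx\,dy$. With $\alpha=\alpha_p$, $\beta=\beta_p$, $$\lambda_{1,p}=\inf\left\{\frac{[u]_{r,p}^p+[v]_{s,p}^p}{\int_\Omega |u|^\alpha|v|^\beta\,dx}\colon (u,v)\in\widetilde W^{r,p}(\Omega)\times\widetilde W^{s,p}(\Omega),\ uv\not\equiv 0\right\}.$$ An eigenpair corresponding to $\lambda\in\mathbb{R}$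 is a pair $(u,v)\in\widetilde W^{r,p}(\Omega)\times\widetilde W^{s,p}(\Omega)$ with $uv\not\equiv0$ such that for all $(w,z)\in\widetilde W^{r,p}(\Omega)\times\widetilde W^{s,p}(\Omega)$, $$\int_{\mathbb{R}^{2N}}\frac{|u(x)-u(y)|^{p-2}(u(x)-u(y))(w(x)-w(y))}{|x-y|^{N+rp}}\,dx\,dy=\lambda\frac{\alpha}{p}\int_\Omega|u|^{\alpha-2}u|v|^\beta w\,dx,$$ $$\int_{\mathbb{R}^{2N}}\frac{|v(x)-v(y)|^{p-2}(v(x)-v(y))(z(x)-z(y))}{|x-y|^{N+sp}}\,dx\,dy=\lambda\frac{\beta}{p}\int_\Omega|u|^{\alpha}|v|^{\beta-2}v z\,dx.$$ **Limit problem.** For $t\in(0,1)$, $[w]_{t,\infty}=\sup_{x,y\in\overline\Omega,\,x\ne y}\frac{|w(y)-w(x)|}{|x-y|^t}$ and $\widetilde W^{t,\infty}(\Omega)=\{w\in C_0(\overline\Omega)\colon [w]_{t,\infty}<\infty\}$, where $C_0(\overline\Omega)$ is the space of continuous functions on $\overline\Omega$ vanishing on $\partial\Omega$. A minimizer of $\Lambda_{1,\infty}$ is an admissible pair attaining the infimum. For a function $w$ on $\mathbb{R}^N$ set $$\mathcal{L}^+_{t,\infty}w(x)=\sup_{y\in\mathbb{R}^N,\,y\neq x}\frac{w(x)-w(y)}{|x-y|^t},\quad \mathcal{L}^-_{t,\infty}w(x)=\inf_{y\in\mathbb{R}^N,\,y\neq x}\frac{w(x)-w(y)}{|x-y|^t},\quad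 \mathcal{L}_{t,\infty}w=\mathcal{L}^+_{t,\infty}w+\mathcal{L}^-_{t,\infty}w .$$ **Viscosity solutions of the limit system.** Let $u,v\in C(\mathbb{R}^N)$ with $u,v\ge0$ in $\Omega$ and $u=v=0$ in $\mathbb{R}^N\setminus\Omega$. Let $C^2_0(\mathbb{R}^N)$ be the compactly supported $C^2$ functions. The pair $(u,v)$ is a viscosity subsolution at $x_0\in\Omega$ if for all $\varphi,\psi\in C_0^2(\mathbb{R}^N)$ with $u(x_0)=\varphi(x_0)$, $v(x_0)=\psi(x_0)$, $u\le\varphi$ and $v\le\psi$ in $\mathbb{R}^N$ one has $$\min\{\mathcal{L}_{r,\infty}\varphi(x_0);\mathcal{L}^+_{r,\infty}\varphi(x_0)-\Lambda_{1,\infty}u^\Gamma(x_0)v^{1-\Gamma}(x_0)\}\le0,$$ $$\min\{\mathcal{L}_{s,\infty}\psi(x_0);\mathcal{L}^+_{s,\infty}\psi(x_0)-\Lambda_{1,\infty}u^\Gamma(x_0)v^{1-\Gamma}(x_0)\}\le0.$$ It is a viscosity supersolution at $x_0$ if for all $\varphi,\psi\in C_0^2(\mathbb{R}^N)$ with $u(x_0)=\varphi(x_0)$, $v(x_0)=\psi(x_0)$, $u\ge\varphi$ and $v\ge\psi$ in $\mathbb{R}^N$ both of these minima are $\ge0$. It is a viscosity solution if it is both a viscosity sub- and supersolution at every $x_0\in\Omega$. *)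

theory Defs
  imports "HOL-Analysis.Analysis" "HOL-Probability.Essential_Supremum"
begin

text \<open>
  The ambient space \<open>\<real>\<^sup>N\<close> is a type \<open>'a\<close> of class \<^class>\<open>euclidean_space\<close>, with \<open>N = DIM('a)\<close>.
  Throughout, \<open>\<bar>a\<bar>\<^sup>q\<close> is written with \<open>powr\<close>. Since \<open>0 powr q = 0\<close>, the expression
  \<open>\<bar>a\<bar> powr (q - 2) * a\<close> is \<open>0\<close> at \<open>a = 0\<close>, also for \<open>q \<le> 2\<close>, and the difference quotients
  below vanish on the diagonal.
\<close>

section \<open>Smooth functions and smooth domains\<close>

primrec Ck :: "nat \<Rightarrow> ('a::euclidean_space \<Rightarrow> real) \<Rightarrow> bool" where
  "Ck 0 f \<longleftrightarrow> continuous_on UNIV f"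
| "Ck (Suc k) f \<longleftrightarrow> (\<forall>x. f differentiable (at x)) \<and>
     (\<forall>b\<in>Basis. Ck k (\<lambda>x. frechet_derivative f (at x) b))"

definition smooth :: "('a::euclidean_space \<Rightarrow> real) \<Rightarrow> bool" where
  "smooth f \<longleftrightarrow> (\<forall>k. Ck k f)"

text \<open>
  The boundary is locally the graph of a smooth function, with the set lying on one side of it.
  The direction of the graph is the unit vector \<open>e\<close>. A function on the hyperplane orthogonal
  to \<open>e\<close> is represented by a function \<open>\<gamma>\<close> on the whole space that does not depend on the
  component along \<open>e\<close>.
\<close>

definition smooth_boundary :: "'a::euclidean_space set \<Rightarrow> bool" where
  "smooth_boundary \<Omega> \<longleftrightarrow>
     (\<forall>x0\<in>frontier \<Omega>. \<exists>\<rho>>0. \<exists>e \<gamma>. norm e = 1 \<and> smooth \<gamma> \<and>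
        (\<forall>x t. \<gamma> (x + t *\<^sub>R e) = \<gamma> x) \<and>
        \<Omega> \<inter> ball x0 \<rho> = {x \<in> ball x0 \<rho>. \<gamma> x < x \<bullet> e})"

definition bounded_smooth_domain :: "'a::euclidean_space set \<Rightarrow> bool" where
  "bounded_smooth_domain \<Omega> \<longleftrightarrow>
     open \<Omega> \<and> connected \<Omega> \<and> \<Omega> \<noteq> {} \<and> bounded \<Omega> \<and> smooth_boundary \<Omega>"

definition inradius :: "'a::euclidean_space set \<Rightarrow> real" where
  "inradius \<Omega> = (SUP x\<in>\<Omega>. infdist x (frontier \<Omega>))"

text \<open>The supremum is a maximum.\<close>

lemma inradius_attained:
  fixes \<Omega> :: "'a::euclidean_space set"
  assumes "open \<Omega>" "bounded \<Omega>" "\<Omega> \<noteq> {}"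
  shows "\<exists>x\<in>\<Omega>. infdist x (frontier \<Omega>) = inradius \<Omega> \<and> (\<forall>y\<in>\<Omega>. infdist y (frontier \<Omega>) \<le> inradius \<Omega>)"
proof -
  define d where "d = (\<lambda>x. infdist x (frontier \<Omega>))"
  have "compact (closure \<Omega>)"
    using assms(2) by (simp add: compact_closure)
  moreover have "closure \<Omega> \<noteq> {}"
    using assms(3) by simp
  moreover have "continuous_on (closure \<Omega>) d"
    unfolding d_def by (intro continuous_on_infdist continuous_on_id)
  ultimately obtain x where x: "x \<in> closure \<Omega>" "\<forall>y\<in>closure \<Omega>. d y \<le> d x"
    using continuous_attains_sup[of "closure \<Omega>" d] by metis
  have sub: "\<And>y. y \<in> \<Omega> \<Longrightarrow> y \<in> closure \<Omega>"
    by (rule subsetD[OF closure_subset])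
  obtain z where z: "z \<in> \<Omega>" "\<And>y. y \<in> \<Omega> \<Longrightarrow> d y \<le> d z"
  proof (cases "x \<in> \<Omega>")
    case True
    show thesis by (rule that[OF True]) (simp add: x(2) sub)
  next
    case False
    then have "x \<in> frontier \<Omega>"
      using x(1) assms(1) by (simp add: frontier_def interior_open)
    then have "d x = 0" by (simp add: d_def)
    obtain z where z: "z \<in> \<Omega>" using assms(3) by auto
    have "d y \<le> d z" if "y \<in> \<Omega>" for y
    proof -
      have "d y \<le> 0" using x(2) sub[OF that] \<open>d x = 0\<close> by auto
      also have "0 \<le> d z" by (simp add: d_def infdist_nonneg)
      finally show ?thesis .
    qed
    then show thesis using that z by metis
  qed
  have "Sup (d ` \<Omega>) = d z"
    by (rule cSup_eq_maximum) (use z in auto)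
  then have eq: "inradius \<Omega> = d z"
    by (simp only: inradius_def d_def)
  show ?thesis
  proof (intro bexI conjI ballI)
    show "infdist z (frontier \<Omega>) = inradius \<Omega>" by (simp only: eq d_def)
    show "infdist y (frontier \<Omega>) \<le> inradius \<Omega>" if "y \<in> \<Omega>" for y
      using z(2)[OF that] unfolding eq by (simp only: d_def)
  qed (fact z(1))
qed

section \<open>Finite exponents\<close>

text \<open>
  Elements of the function spaces are represented by Lebesgue measurable functions; conditions on
  classes of functions, such as \<open>uv \<noteq> 0\<close>, are understood almost everywhere.
\<close>

definition frac_quotient :: "real \<Rightarrow> real \<Rightarrow> ('a::euclidean_space \<Rightarrow> real) \<Rightarrow> 'a \<times> 'a \<Rightarrow> real" where
  "frac_quotient t p w = (\<lambda>(x, y).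
     \<bar>w x - w y\<bar> powr p / norm (x - y) powr (real DIM('a) + t * p))"

definition W_frac :: "real \<Rightarrow> real \<Rightarrow> 'a::euclidean_space set \<Rightarrow> ('a \<Rightarrow> real) set" where
  "W_frac t p S = {w. w \<in> borel_measurable (lebesgue_on S) \<and>
     integrable (lebesgue_on S) (\<lambda>x. \<bar>w x\<bar> powr p) \<and>
     integrable (lebesgue_on (S \<times> S)) (frac_quotient t p w)}"

text \<open>Elements are identified with their extensions by zero.\<close>

definition W_tilde :: "real \<Rightarrow> real \<Rightarrow> 'a::euclidean_space set \<Rightarrow> ('a \<Rightarrow> real) set" where
  "W_tilde t p \<Omega> = {w. (\<forall>x. x \<notin> \<Omega> \<longrightarrow> w x = 0) \<and> w \<in> W_frac t p \<Omega> \<and> w \<in> W_frac t p UNIV}"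

text \<open>The \<open>p\<close>-th power of the seminorm.\<close>

definition seminorm_pow :: "real \<Rightarrow> real \<Rightarrow> ('a::euclidean_space \<Rightarrow> real) \<Rightarrow> real" where
  "seminorm_pow t p w = integral\<^sup>L lebesgue (frac_quotient t p w)"

definition admissible ::
  "'a::euclidean_space set \<Rightarrow> real \<Rightarrow> real \<Rightarrow> real \<Rightarrow> ('a \<Rightarrow> real) \<Rightarrow> ('a \<Rightarrow> real) \<Rightarrow> bool" where
  "admissible \<Omega> r s p u v \<longleftrightarrow> u \<in> W_tilde r p \<Omega> \<and> v \<in> W_tilde s p \<Omega> \<and>
     \<not> (AE x in lebesgue_on \<Omega>. u x * v x = 0)"

definition coupling ::
  "'a::euclidean_space set \<Rightarrow> real \<Rightarrow> real \<Rightarrow> ('a \<Rightarrow> real) \<Rightarrow> ('a \<Rightarrow> real) \<Rightarrow> real" where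
  "coupling \<Omega> \<alpha> \<beta> u v = (\<integral>x. \<bar>u x\<bar> powr \<alpha> * \<bar>v x\<bar> powr \<beta> \<partial>lebesgue_on \<Omega>)"

definition lambda1 :: "'a::euclidean_space set \<Rightarrow> real \<Rightarrow> real \<Rightarrow> real \<Rightarrow> real \<Rightarrow> real \<Rightarrow> real" where
  "lambda1 \<Omega> r s p \<alpha> \<beta> =
     Inf {(seminorm_pow r p u + seminorm_pow s p v) / coupling \<Omega> \<alpha> \<beta> u v | u v.
            admissible \<Omega> r s p u v}"

definition frac_form ::
  "real \<Rightarrow> real \<Rightarrow> ('a::euclidean_space \<Rightarrow> real) \<Rightarrow> ('a \<Rightarrow> real) \<Rightarrow> real" where
  "frac_form t p u w = (\<integral>(x, y).
     \<bar>u x - u y\<bar> powr (p - 2) * (u x - u y) * (w x - w y)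
       / norm (x - y) powr (real DIM('a) + t * p) \<partial>lebesgue)"

definition eigenpair ::
  "'a::euclidean_space set \<Rightarrow> real \<Rightarrow> real \<Rightarrow> real \<Rightarrow> real \<Rightarrow> real \<Rightarrow> real
     \<Rightarrow> ('a \<Rightarrow> real) \<Rightarrow> ('a \<Rightarrow> real) \<Rightarrow> bool" where
  "eigenpair \<Omega> r s p \<alpha> \<beta> \<mu> u v \<longleftrightarrow> admissible \<Omega> r s p u v \<and>
     (\<forall>w\<in>W_tilde r p \<Omega>. \<forall>z\<in>W_tilde s p \<Omega>.
        frac_form r p u w =
          \<mu> * (\<alpha> / p) * (\<integral>x. \<bar>u x\<bar> powr (\<alpha> - 2) * u x * \<bar>v x\<bar> powr \<beta> * w x \<partial>lebesgue_on \<Omega>) \<and>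
        frac_form s p v z =
          \<mu> * (\<beta> / p) * (\<integral>x. \<bar>u x\<bar> powr \<alpha> * \<bar>v x\<bar> powr (\<beta> - 2) * v x * z x \<partial>lebesgue_on \<Omega>))"

definition continuous_representative :: "('a::euclidean_space \<Rightarrow> real) \<Rightarrow> ('a \<Rightarrow> real) \<Rightarrow> bool" where
  "continuous_representative w w' \<longleftrightarrow>
     continuous_on UNIV w' \<and> (AE x in lebesgue. w' x = w x)"

section \<open>The limit minimization problem\<close>

text \<open>Only the values on \<open>closure \<Omega>\<close> matter for the notions of this section.\<close>

definition holder_quotients ::
  "real \<Rightarrow> 'a::euclidean_space set \<Rightarrow> ('a \<Rightarrow> real) \<Rightarrow> real set" where
  "holder_quotients t \<Omega> w =
     {\<bar>w y - w x\<bar> / norm (x - y) powr t | x y. x \<in> closure \<Omega> \<and> y \<in> closure \<Omega> \<and> x \<noteq> y}"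

definition holder_seminorm :: "real \<Rightarrow> 'a::euclidean_space set \<Rightarrow> ('a \<Rightarrow> real) \<Rightarrow> real" where
  "holder_seminorm t \<Omega> w = Sup (holder_quotients t \<Omega> w)"

definition C0_closure :: "'a::euclidean_space set \<Rightarrow> ('a \<Rightarrow> real) set" where
  "C0_closure \<Omega> = {w. continuous_on (closure \<Omega>) w \<and> (\<forall>x\<in>frontier \<Omega>. w x = 0)}"

text \<open>Finiteness of the seminorm is boundedness of the set of quotients.\<close>

definition W_tilde_inf :: "real \<Rightarrow> 'a::euclidean_space set \<Rightarrow> ('a \<Rightarrow> real) set" where
  "W_tilde_inf t \<Omega> = {w \<in> C0_closure \<Omega>. bdd_above (holder_quotients t \<Omega> w)}"

definition admissible_inf ::
  "'a::euclidean_space set \<Rightarrow> real \<Rightarrow> real \<Rightarrow> ('a \<Rightarrow> real) \<Rightarrow> ('a \<Rightarrow> real) \<Rightarrow> bool" where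
  "admissible_inf \<Omega> r s u v \<longleftrightarrow>
     u \<in> W_tilde_inf r \<Omega> \<and> v \<in> W_tilde_inf s \<Omega> \<and> (\<exists>x\<in>\<Omega>. u x * v x \<noteq> 0)"

definition Linf_norm :: "'a::euclidean_space set \<Rightarrow> ('a \<Rightarrow> real) \<Rightarrow> real" where
  "Linf_norm \<Omega> f = real_of_ereal (esssup (lebesgue_on \<Omega>) (\<lambda>x. ereal \<bar>f x\<bar>))"

definition quotient_inf ::
  "'a::euclidean_space set \<Rightarrow> real \<Rightarrow> real \<Rightarrow> real \<Rightarrow> ('a \<Rightarrow> real) \<Rightarrow> ('a \<Rightarrow> real) \<Rightarrow> real" where
  "quotient_inf \<Omega> r s \<Gamma> u v =
     max (holder_seminorm r \<Omega> u) (holder_seminorm s \<Omega> v)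
       / Linf_norm \<Omega> (\<lambda>x. \<bar>u x\<bar> powr \<Gamma> * \<bar>v x\<bar> powr (1 - \<Gamma>))"

definition Lambda_inf :: "'a::euclidean_space set \<Rightarrow> real \<Rightarrow> real \<Rightarrow> real \<Rightarrow> real" where
  "Lambda_inf \<Omega> r s \<Gamma> = Inf {quotient_inf \<Omega> r s \<Gamma> u v | u v. admissible_inf \<Omega> r s u v}"

definition minimizer_inf ::
  "'a::euclidean_space set \<Rightarrow> real \<Rightarrow> real \<Rightarrow> real \<Rightarrow> ('a \<Rightarrow> real) \<Rightarrow> ('a \<Rightarrow> real) \<Rightarrow> bool" where
  "minimizer_inf \<Omega> r s \<Gamma> u v \<longleftrightarrow>
     admissible_inf \<Omega> r s u v \<and> quotient_inf \<Omega> r s \<Gamma> u v = Lambda_inf \<Omega> r s \<Gamma>"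

definition zero_extension :: "'a::euclidean_space set \<Rightarrow> ('a \<Rightarrow> real) \<Rightarrow> 'a \<Rightarrow> real" where
  "zero_extension \<Omega> w = (\<lambda>x. if x \<in> \<Omega> then w x else 0)"

section \<open>The limit operators and viscosity solutions\<close>

text \<open>
  The operators are applied below only to compactly supported \<open>C\<^sup>2\<close> functions and \<open>t \<in> (0,1)\<close>, for
  which the sets of quotients are bounded, so that real suprema and infima are adequate.
\<close>

definition L_plus :: "real \<Rightarrow> ('a::euclidean_space \<Rightarrow> real) \<Rightarrow> 'a \<Rightarrow> real" where
  "L_plus t w x = (SUP y\<in>-{x}. (w x - w y) / norm (x - y) powr t)"

definition L_minus :: "real \<Rightarrow> ('a::euclidean_space \<Rightarrow> real) \<Rightarrow> 'a \<Rightarrow> real" where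
  "L_minus t w x = (INF y\<in>-{x}. (w x - w y) / norm (x - y) powr t)"

definition L_inf :: "real \<Rightarrow> ('a::euclidean_space \<Rightarrow> real) \<Rightarrow> 'a \<Rightarrow> real" where
  "L_inf t w x = L_plus t w x + L_minus t w x"

definition C2_compact_support :: "('a::euclidean_space \<Rightarrow> real) set" where
  "C2_compact_support = {\<phi>. Ck 2 \<phi> \<and> compact (closure {x. \<phi> x \<noteq> 0})}"

text \<open>In the system, \<open>m\<close> is the value of \<open>\<Lambda> * u powr \<Gamma> * v powr (1 - \<Gamma>)\<close> at the point \<open>x\<close>.\<close>

definition min_operator :: "real \<Rightarrow> ('a::euclidean_space \<Rightarrow> real) \<Rightarrow> real \<Rightarrow> 'a \<Rightarrow> real" where
  "min_operator t \<phi> m x = min (L_inf t \<phi> x) (L_plus t \<phi> x - m)"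

definition viscosity_subsolution_at ::
  "real \<Rightarrow> real \<Rightarrow> real \<Rightarrow> real \<Rightarrow> ('a::euclidean_space \<Rightarrow> real) \<Rightarrow> ('a \<Rightarrow> real) \<Rightarrow> 'a \<Rightarrow> bool" where
  "viscosity_subsolution_at r s \<Gamma> \<Lambda> u v x0 \<longleftrightarrow>
     (\<forall>\<phi>\<in>C2_compact_support. \<forall>\<psi>\<in>C2_compact_support.
        u x0 = \<phi> x0 \<and> v x0 = \<psi> x0 \<and> (\<forall>x. u x \<le> \<phi> x) \<and> (\<forall>x. v x \<le> \<psi> x) \<longrightarrow>
        min_operator r \<phi> (\<Lambda> * u x0 powr \<Gamma> * v x0 powr (1 - \<Gamma>)) x0 \<le> 0 \<and>
        min_operator s \<psi> (\<Lambda> * u x0 powr \<Gamma> * v x0 powr (1 - \<Gamma>)) x0 \<le> 0)"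

definition viscosity_supersolution_at ::
  "real \<Rightarrow> real \<Rightarrow> real \<Rightarrow> real \<Rightarrow> ('a::euclidean_space \<Rightarrow> real) \<Rightarrow> ('a \<Rightarrow> real) \<Rightarrow> 'a \<Rightarrow> bool" where
  "viscosity_supersolution_at r s \<Gamma> \<Lambda> u v x0 \<longleftrightarrow>
     (\<forall>\<phi>\<in>C2_compact_support. \<forall>\<psi>\<in>C2_compact_support.
        u x0 = \<phi> x0 \<and> v x0 = \<psi> x0 \<and> (\<forall>x. u x \<ge> \<phi> x) \<and> (\<forall>x. v x \<ge> \<psi> x) \<longrightarrow>
        min_operator r \<phi> (\<Lambda> * u x0 powr \<Gamma> * v x0 powr (1 - \<Gamma>)) x0 \<ge> 0 \<and>
        min_operator s \<psi> (\<Lambda> * u x0 powr \<Gamma> * v x0 powr (1 - \<Gamma>)) x0 \<ge> 0)"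

definition viscosity_solution ::
  "'a::euclidean_space set \<Rightarrow> real \<Rightarrow> real \<Rightarrow> real \<Rightarrow> real \<Rightarrow> ('a \<Rightarrow> real) \<Rightarrow> ('a \<Rightarrow> real) \<Rightarrow> bool" where
  "viscosity_solution \<Omega> r s \<Gamma> \<Lambda> u v \<longleftrightarrow>
     continuous_on UNIV u \<and> continuous_on UNIV v \<and>
     (\<forall>x\<in>\<Omega>. u x \<ge> 0 \<and> v x \<ge> 0) \<and> (\<forall>x. x \<notin> \<Omega> \<longrightarrow> u x = 0 \<and> v x = 0) \<and>
     (\<forall>x0\<in>\<Omega>. viscosity_subsolution_at r s \<Gamma> \<Lambda> u v x0 \<and>
              viscosity_supersolution_at r s \<Gamma> \<Lambda> u v x0)"

end

theory Submission
  imports Defs "HOL-Complex_Analysis.Great_Picard" "HOL-Real_Asymp.Real_Asymp"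
begin

text \<open>
  Put \<open>\<kappa> = (1 - \<Gamma>) s + \<Gamma> r\<close> and let \<open>R\<close> be the inradius. Every admissible pair satisfies
  \<open>|u| \<le> [u] d\<^sup>r\<close> and \<open>|v| \<le> [v] d\<^sup>s\<close> with \<open>d\<close> the distance to the boundary, hence has limit quotient at
  least \<open>R powr -\<kappa>\<close>. Cones centred at an incentre and truncated near the tip are Lipschitz with
  Hoelder quotients at most \<open>1\<close>, so their \<open>p\<close>-seminorms stay bounded as \<open>p\<close> grows and they give
  \<open>limsup \<lambda>\<^sub>p powr (1/p) \<le> R powr -\<kappa>\<close>. Testing the equations with the eigenfunctions bounds their
  seminorms, a fractional Morrey estimate and the Arzela-Ascoli theorem give uniform limits, and the
  limit pair has quotient at most \<open>liminf \<lambda>\<^sub>p powr (1/p)\<close>; so all these quantities agree.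

  The viscosity inequalities come directly from the weak formulation. If \<open>\<psi>\<close> touches the limit
  strictly from below at \<open>x0\<close> and \<open>w\<close> is the positive part of \<open>\<psi> - u\<^sub>p\<close> (with \<open>\<psi>\<close> slightly raised), then
  monotonicity allows us to replace \<open>u\<^sub>p\<close> by \<open>\<psi>\<close> in the form tested with \<open>w\<close>. Since \<open>\<psi>\<close> is Lipschitz
  and \<open>p\<close> is large, the nonlocal operator of \<open>\<psi>\<close> is an absolutely convergent integral, and the equation
  holds as an inequality at some point near \<open>x0\<close>. Both sides are comparable to \<open>p\<close>-th powers, whose
  bases give the limit operators.
\<close>

section \<open>Integrable kernels\<close>

text \<open>The definitions speak of classes of functions, the conclusion of points. The bridge is
  the passage to continuous representatives, and these must vanish on the boundary itself, which may
  be a null set. The smooth boundary supplies this by making every boundary point a limit of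
  exterior points. Only p-th roots survive in the limit, so constants have to enter as p-th powers
  times factors independent of p. Hence the Morrey constant multiplies \<open>K\<close> and is the
  same for all large p, and the viscosity part splits a power p into S^(p - p0) and one fixed
  integrable kernel of exponent \<open>p0\<close>. The obstacle in the last part is the principal
  value usually hidden in the operator. For a Lipschitz test function of bounded oscillation it
  disappears once (1 - t) p >= N + 1, since the kernel is then integrable at the diagonal. Positive
  and negative differences contribute at the rates S^p and \<sigma>^p, and comparing the growth of
  such powers replaces a passage to the limit in the operator. A change of sign reduces subsolutions
  to the same estimate.\<close>

lemma integrable_lborel_reflect:
  fixes h :: "'a::euclidean_space \<Rightarrow> real"
  assumes "integrable lborel h"
  shows "integrable lborel (\<lambda>y. h (x - y))" and "(\<integral>y. h (x - y) \<partial>lborel) = (\<integral>z. h z \<partial>lborel)"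
proof -
  have [measurable]: "h \<in> borel_measurable borel" using assms by auto
  have eq: "(lborel::'a measure) = distr lborel borel (\<lambda>y. x - y)"
    using lborel_affine[of "-1" x] by (simp add: density_1)
  show "integrable lborel (\<lambda>y. h (x - y))"
    using assms by (subst (asm) eq) (simp add: integrable_distr_eq)
  show "(\<integral>y. h (x - y) \<partial>lborel) = (\<integral>z. h z \<partial>lborel)"
    by (subst (2) eq) (simp add: integral_distr)
qed

text \<open>Domination by dyadic balls: the ball of radius 2^(n+1) has volume of order 2^(nN) and
  carries the weight 2^(-n(N+e)), which leaves a geometric series of ratio 2^(-e).\<close>

lemma integrable_decay:
  assumes "e > 0"
  shows "integrable lborel (\<lambda>z::'a::euclidean_space. max 1 (norm z) powr - (real DIM('a) + e))"
proof (rule integrableI_nonneg)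
  define D where "D = real DIM('a) + e"
  have D: "D > 0" using assms by (simp add: D_def)
  define V where "V = unit_ball_vol (real DIM('a))"
  have V: "V \<ge> 0" unfolding V_def by simp
  define F where "F = (\<lambda>n (z::'a). ennreal (2 powr (- real n * D)) * indicator (ball 0 (2 ^ Suc n)) z)"
  have [measurable]: "F n \<in> borel_measurable lborel" for n
    unfolding F_def by (intro borel_measurable_times_ennreal borel_measurable_const borel_measurable_indicator) simp
  have le: "ennreal (max 1 (norm z) powr - D) \<le> (\<Sum>n. F n z)" for z :: 'a
  proof -
    define m where "m = max 1 (norm z)"
    have m: "m \<ge> 1" by (simp add: m_def)
    \<comment> \<open>The dyadic scale of \<open>z\<close>: 2^n <= m < 2^(n+1), so the summand with
      this index alone bounds the value at \<open>z\<close>.\<close>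
    define n where "n = nat \<lfloor>log 2 m\<rfloor>"
    have l0: "log 2 m \<ge> 0" using m by simp
    have n1: "real n \<le> log 2 m" and n2: "log 2 m < real n + 1"
      using l0 unfolding n_def by linarith+
    have a: "2 powr real n \<le> m"
      using n1 m by (simp add: le_log_iff)
    have b: "m < 2 powr (real n + 1)"
      using n2 m by (simp add: log_less_iff)
    have "2 powr (real n + 1) = 2 ^ Suc n"
      by (subst powr_realpow[symmetric]) (auto simp: algebra_simps)
    with b have zb: "z \<in> ball 0 (2 ^ Suc n)" unfolding m_def by simp
    have "m powr - D \<le> (2 powr real n) powr - D"
      using a D by (intro powr_mono2') auto
    also have "\<dots> = 2 powr (- real n * D)" by (simp add: powr_powr)
    finally have "ennreal (m powr - D) \<le> F n z" using zb unfolding F_def by (simp add: ennreal_leI)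
    also have "\<dots> \<le> (\<Sum>n. F n z)"
      using sum_le_suminf[of "\<lambda>n. F n z" "{n}"] by (auto)
    finally show ?thesis by (simp add: m_def)
  qed
  have "(\<integral>\<^sup>+(z::'a). ennreal (max 1 (norm z) powr - D) \<partial>lborel) \<le> (\<integral>\<^sup>+z. (\<Sum>n. F n (z::'a)) \<partial>lborel)"
    by (intro nn_integral_mono le)
  also have "\<dots> = (\<Sum>n. \<integral>\<^sup>+z. F n z \<partial>lborel)"
    by (intro nn_integral_suminf) measurable
  also have "(\<lambda>n. \<integral>\<^sup>+z. F n z \<partial>lborel) = (\<lambda>n. ennreal (V * 2 ^ DIM('a) * (2 powr - e) ^ n))"
  proof
    fix n
    have "(\<integral>\<^sup>+z. F n z \<partial>lborel) = ennreal (2 powr (- real n * D)) * emeasure lborel (ball (0::'a) (2 ^ Suc n))"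
      unfolding F_def by (subst nn_integral_cmult_indicator) auto
    also have "\<dots> = ennreal (2 powr (- real n * D) * (V * (2 ^ Suc n) ^ DIM('a)))"
      unfolding V_def using V by (subst emeasure_ball) (auto simp: ennreal_mult V_def)
    also have "2 powr (- real n * D) * (V * (2 ^ Suc n) ^ DIM('a)) = V * 2 ^ DIM('a) * (2 powr - e) ^ n"
    proof -
      have "(2 ^ Suc n) ^ DIM('a) = (2::real) ^ DIM('a) * 2 powr (real n * DIM('a))"
        by (simp add: power_mult_distrib powr_realpow[symmetric] powr_powr mult.commute flip: power_mult of_nat_mult)
      moreover have "2 powr (- real n * D) = 2 powr (- real n * DIM('a)) * (2 powr - e) ^ n"
        by (simp add: D_def powr_realpow[symmetric] powr_powr powr_add[symmetric] algebra_simps)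
      ultimately show ?thesis by (simp add: powr_minus field_simps)
    qed
    finally show "(\<integral>\<^sup>+z. F n z \<partial>lborel) = ennreal (V * 2 ^ DIM('a) * (2 powr - e) ^ n)" .
  qed
  also have "(\<Sum>n. ennreal (V * 2 ^ DIM('a) * (2 powr - e) ^ n)) = ennreal (\<Sum>n. V * 2 ^ DIM('a) * (2 powr - e) ^ n)"
  proof (rule suminf_ennreal2)
    show "summable (\<lambda>n. V * 2 ^ DIM('a) * (2 powr - e) ^ n)"
      using assms by (intro summable_mult summable_geometric) (simp add: powr_less_one)
  qed (use V in auto)
  also have "\<dots> < \<infinity>" by simp
  finally show "(\<integral>\<^sup>+z. ennreal (max 1 (norm (z::'a)) powr - (real DIM('a) + e)) \<partial>lborel) < \<infinity>"
    unfolding D_def .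
qed auto

text \<open>Bounds |w x - w y|^q / |x - y|^(N+e) as a function of x - y when w has Lipschitz
  constant \<open>L\<close> and oscillation \<open>M\<close>. The first entry of the minimum serves
  short distances, the second long ones.\<close>

definition trunc_kernel :: "real \<Rightarrow> real \<Rightarrow> real \<Rightarrow> real \<Rightarrow> 'a::euclidean_space \<Rightarrow> real" where
  "trunc_kernel L M q e z = min (L * norm z) M powr q / norm z powr (real DIM('a) + e)"

lemma borel_measurable_trunc_kernel [measurable]: "trunc_kernel L M q e \<in> borel_measurable borel"
  unfolding trunc_kernel_def by measurable

lemma trunc_kernel_nonneg [simp]: "trunc_kernel L M q e z \<ge> 0"
  unfolding trunc_kernel_def by simp

text \<open>Since q >= N + e, the Lipschitz branch cancels the singularity at 0; beyond distance 1
  the oscillation branch leaves the integrable tail |z|^-(N+e).\<close>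

lemma integrable_trunc_kernel:
  assumes "e > 0" "q \<ge> real DIM('a) + e" "L \<ge> 0" "M \<ge> 0"
  shows "integrable lborel (trunc_kernel L M q e :: 'a::euclidean_space \<Rightarrow> real)"
proof (rule Bochner_Integration.integrable_bound)
  let ?D = "real DIM('a) + e"
  show "integrable lborel (\<lambda>z::'a. (L powr q + M powr q) * max 1 (norm z) powr - ?D)"
    by (intro integrable_mult_right integrable_decay assms)
  have "trunc_kernel L M q e z \<le> (L powr q + M powr q) * max 1 (norm z) powr - ?D" for z :: 'a
  proof (cases "norm z \<le> 1")
    case True
    have "min (L * norm z) M powr q \<le> (L * norm z) powr q"
      using assms by (intro powr_mono2) (auto intro: mult_nonneg_nonneg)
    also have "\<dots> = L powr q * norm z powr q" using assms by (simp add: powr_mult)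
    also have "\<dots> \<le> L powr q * norm z powr ?D"
      using True assms by (intro mult_left_mono powr_mono') auto
    finally have "trunc_kernel L M q e z \<le> L powr q"
      unfolding trunc_kernel_def by (cases "z = 0") (auto simp: divide_simps)
    also have "\<dots> \<le> L powr q + M powr q" by simp
    finally show ?thesis using True by (simp add: max_def)
  next
    case False
    have "min (L * norm z) M powr q \<le> M powr q"
      using assms by (intro powr_mono2) (auto intro: mult_nonneg_nonneg)
    also have "\<dots> \<le> L powr q + M powr q" by simp
    finally have "trunc_kernel L M q e z \<le> (L powr q + M powr q) / norm z powr ?D"
      unfolding trunc_kernel_def by (intro divide_right_mono) auto
    moreover have "max 1 (norm z) = norm z" using False by simp
    ultimately show ?thesis by (simp only: powr_minus divide_inverse)
  qed
  then show "AE z in lborel. norm (trunc_kernel L M q e z) \<le> norm ((L powr q + M powr q) * max 1 (norm (z::'a)) powr - ?D)"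
    by (intro AE_I2) (metis abs_ge_self abs_of_nonneg order_trans real_norm_def trunc_kernel_nonneg)
qed auto

text \<open>A function of x - y has no decay along the diagonal of the product space. Confining one
  variable to a bounded set repairs this: by translation invariance the other variable integrates to
  a constant.\<close>

lemma integrable_pair_indicator_diff:
  fixes h :: "'a::euclidean_space \<Rightarrow> real"
  assumes h: "integrable lborel h" and B: "B \<in> sets borel" "bounded B"
  shows "integrable lborel (\<lambda>(x, y). indicator B x * h (x - y))"
    and "integrable lborel (\<lambda>(x, y). indicator B y * h (x - y))"
proof -
  have [measurable]: "h \<in> borel_measurable borel" "B \<in> sets borel" using assms by auto
  have fin: "emeasure lborel B < \<infinity>" using B(2) by (rule emeasure_bounded_finite)
  have "integrable (lborel \<Otimes>\<^sub>M lborel) (\<lambda>(x::'a, y). indicator B x * k (x - y))"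
    if k: "integrable lborel k" for k :: "'a \<Rightarrow> real"
  proof (rule lborel_pair.Fubini_integrable)
    have [measurable]: "k \<in> borel_measurable borel" using k by auto
    show "(\<lambda>(x::'a, y). indicator B x * k (x - y)) \<in> borel_measurable (lborel \<Otimes>\<^sub>M lborel)"
      by measurable
    have "(\<integral>y. norm (indicator B x * k (x - y)) \<partial>lborel) = indicator B x * (\<integral>z. \<bar>k z\<bar> \<partial>lborel)" for x
      using integrable_lborel_reflect(2)[of "\<lambda>z. \<bar>k z\<bar>" x] k by (simp add: abs_mult)
    then show "integrable lborel (\<lambda>x. \<integral>y. norm (case (x, y) of (x, y) \<Rightarrow> indicator B x * k (x - y)) \<partial>lborel)"
      using fin by (simp)
    show "AE x in lborel. integrable lborel (\<lambda>y. case (x, y) of (x, y) \<Rightarrow> indicator B x * k (x - y))"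
      using integrable_lborel_reflect(1)[OF k] by simp
  qed
  note * = this
  show "integrable lborel (\<lambda>(x, y). indicator B x * h (x - y))"
    using *[OF h] by (simp add: lborel_prod)
  \<comment> \<open>Swapping the variables turns x - y into y - x, so the first part is applied to
    the reflected kernel.\<close>
  have "integrable lborel (\<lambda>z. h (0 - z))" by (rule integrable_lborel_reflect[OF h])
  then have "integrable lborel (\<lambda>z. h (- z))" by simp
  from lborel_pair.integrable_product_swap[OF *[OF this]]
  show "integrable lborel (\<lambda>(x, y). indicator B y * h (x - y))"
    by (simp add: lborel_prod)
qed

section \<open>Nonlocal forms and continuous representatives\<close>

text \<open>The odd nonlinearity sgn(d) |d|^(p-1) of the fractional p-Laplacian, in the form in
  which it occurs in \<open>frac_form\<close>.\<close>

definition signed_powr :: "real \<Rightarrow> real \<Rightarrow> real" where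
  "signed_powr p d = \<bar>d\<bar> powr (p - 2) * d"

lemma signed_powr_eq: "signed_powr p d = sgn d * \<bar>d\<bar> powr (p - 1)"
proof (cases "d = 0")
  case False
  then have "\<bar>d\<bar> powr (p - 1) = \<bar>d\<bar> powr (p - 2) * \<bar>d\<bar>"
    using powr_mult_base[of "\<bar>d\<bar>" "p - 2"] by (simp add: mult.commute)
  then show ?thesis by (simp add: signed_powr_def sgn_if)
qed (simp add: signed_powr_def)

lemma abs_signed_powr: "\<bar>signed_powr p d\<bar> = \<bar>d\<bar> powr (p - 1)"
  by (cases "d = 0") (simp_all add: signed_powr_eq abs_mult abs_sgn_eq)

lemma signed_powr_minus: "signed_powr p (- d) = - signed_powr p d"
  by (simp add: signed_powr_def)

lemma signed_powr_pos: "d \<ge> 0 \<Longrightarrow> signed_powr p d = d powr (p - 1)"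
  by (simp add: signed_powr_eq sgn_if)

lemma signed_powr_neg: "d \<le> 0 \<Longrightarrow> signed_powr p d = - ((- d) powr (p - 1))"
  by (simp add: signed_powr_eq sgn_if)

text \<open>This monotonicity is what allows a test function to replace the solution in
  \<open>weak_comparison\<close>.\<close>

lemma signed_powr_mono:
  assumes "p > 1" "a \<le> b"
  shows "signed_powr p a \<le> signed_powr p b"
proof -
  consider "0 \<le> a" | "a \<le> 0" "0 \<le> b" | "b \<le> 0" by linarith
  then show ?thesis
  proof cases
    case 1
    then show ?thesis using assms by (simp add: signed_powr_pos powr_mono2)
  next
    case 2
    have "- ((- a) powr (p - 1)) \<le> 0" "0 \<le> b powr (p - 1)" by auto
    then show ?thesis using 2 by (simp only: signed_powr_pos signed_powr_neg) 
  next
    case 3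
    then show ?thesis using assms by (simp add: signed_powr_neg powr_mono2)
  qed
qed

lemma signed_powr_mult_self: "p > 0 \<Longrightarrow> signed_powr p d * d = \<bar>d\<bar> powr p"
proof (cases "d = 0")
  case False
  then have "\<bar>d\<bar> powr p = \<bar>d\<bar> powr (p - 2) * \<bar>d\<bar> powr 2"
    by (metis powr_add diff_add_cancel)
  then show ?thesis using False by (simp add: signed_powr_def power2_eq_square)
qed (simp add: signed_powr_def)

text \<open>A crude Young inequality obtained by replacing both factors by their maximum. It serves
  integrability, where the constant is irrelevant.\<close>

lemma powr_mult_le_powr_add:
  fixes a b :: real
  assumes "a \<ge> 0" "b \<ge> 0" "\<alpha> \<ge> 0" "\<beta> \<ge> 0" "\<alpha> + \<beta> = p" 
  shows "a powr \<alpha> * b powr \<beta> \<le> a powr p + b powr p"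
proof -
  have "a powr \<alpha> * b powr \<beta> \<le> max a b powr \<alpha> * max a b powr \<beta>"
    using assms by (intro mult_mono powr_mono2) auto
  also have "\<dots> = max a b powr p" using assms by (simp flip: powr_add)
  also have "\<dots> \<le> a powr p + b powr p" by (simp add: max_def)
  finally show ?thesis .
qed

lemma add_powr_le:
  fixes a b :: real
  assumes "a \<ge> 0" "b \<ge> 0" "p \<ge> 0"
  shows "(a + b) powr p \<le> 2 powr p * (a powr p + b powr p)"
proof -
  have "(a + b) powr p \<le> (2 * max a b) powr p"
    using assms by (intro powr_mono2) auto
  also have "\<dots> = 2 powr p * max a b powr p" using assms by (simp add: powr_mult)
  also have "\<dots> \<le> 2 powr p * (a powr p + b powr p)"
    by (intro mult_left_mono) (auto simp: max_def)
  finally show ?thesis .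
qed

lemma borel_measurable_signed_powr [measurable]: "signed_powr p \<in> borel_measurable borel"
  unfolding signed_powr_def by measurable

lemma borel_measurable_frac_quotient:
  fixes w :: "'a::euclidean_space \<Rightarrow> real"
  assumes [measurable]: "w \<in> borel_measurable borel"
  shows "frac_quotient t p w \<in> borel_measurable borel"
proof -
  have "frac_quotient t p w \<in> borel_measurable (borel \<Otimes>\<^sub>M borel)"
    unfolding frac_quotient_def by measurable
  then show ?thesis by (simp add: borel_prod)
qed

definition form_density ::
  "real \<Rightarrow> real \<Rightarrow> ('a::euclidean_space \<Rightarrow> real) \<Rightarrow> ('a \<Rightarrow> real) \<Rightarrow> 'a \<times> 'a \<Rightarrow> real" where
  "form_density t p u w = (\<lambda>(x, y).
     signed_powr p (u x - u y) * (w x - w y) / norm (x - y) powr (real DIM('a) + t * p))"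

lemma frac_form_eq: "frac_form t p u w = integral\<^sup>L lebesgue (form_density t p u w)"
  by (simp add: frac_form_def form_density_def signed_powr_def)

lemma borel_measurable_form_density:
  fixes w :: "'a::euclidean_space \<Rightarrow> real"
  assumes [measurable]: "u \<in> borel_measurable borel" "w \<in> borel_measurable borel"
  shows "form_density t p u w \<in> borel_measurable borel"
proof -
  have "form_density t p u w \<in> borel_measurable (borel \<Otimes>\<^sub>M borel)"
    unfolding form_density_def by measurable
  then show ?thesis by (simp add: borel_prod)
qed

lemma frac_quotient_nonneg: "frac_quotient t p w z \<ge> 0"
  by (simp add: frac_quotient_def split: prod.split)

lemma abs_form_density_le:
  assumes "p \<ge> 1"
  shows "\<bar>form_density t p u w z\<bar> \<le> frac_quotient t p u z + frac_quotient t p w z"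
proof -
  obtain x y where z: "z = (x, y)" by fastforce
  have "\<bar>form_density t p u w z\<bar> = \<bar>u x - u y\<bar> powr (p - 1) * \<bar>w x - w y\<bar> powr 1 / norm (x - y) powr (real DIM('a) + t * p)"
    by (simp add: z form_density_def abs_mult abs_signed_powr)
  also have "\<dots> \<le> (\<bar>u x - u y\<bar> powr p + \<bar>w x - w y\<bar> powr p) / norm (x - y) powr (real DIM('a) + t * p)"
    using assms by (intro divide_right_mono powr_mult_le_powr_add) auto
  also have "\<dots> = frac_quotient t p u z + frac_quotient t p w z"
    by (simp add: z frac_quotient_def add_divide_distrib)
  finally show ?thesis .
qed

lemma frac_form_self:
  assumes "p > 0"
  shows "frac_form t p u u = seminorm_pow t p u"
proof -
  have "form_density t p u u = frac_quotient t p u"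
    using assms by (auto simp: form_density_def frac_quotient_def signed_powr_mult_self)
  then show ?thesis by (simp add: frac_form_eq seminorm_pow_def)
qed

lemma integrable_form_density:
  assumes "p \<ge> 1" "u \<in> borel_measurable borel" "w \<in> borel_measurable borel"
    and "integrable lborel (frac_quotient t p u)" "integrable lborel (frac_quotient t p w)"
  shows "integrable lborel (form_density t p u w)"
proof (rule Bochner_Integration.integrable_bound)
  show "integrable lborel (\<lambda>z. frac_quotient t p u z + frac_quotient t p w z)"
    using assms by simp
  show "AE z in lborel. norm (form_density t p u w z) \<le> norm (frac_quotient t p u z + frac_quotient t p w z)"
    using abs_form_density_le[OF assms(1), of t u w] frac_quotient_nonneg[of t p]
    by (intro AE_I2) (smt (verit) real_norm_def)
qed (use borel_measurable_form_density assms in auto)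

section \<open>Changing functions on null sets\<close>

lemma AE_pair_eq:
  fixes u U :: "'a::euclidean_space \<Rightarrow> real"
  assumes "AE x in lebesgue. U x = u x"
  shows "AE z in lebesgue. U (fst z) = u (fst z) \<and> U (snd z) = u (snd z)"
proof -
  \<comment> \<open>The product structure belongs to \<open>lborel\<close>. So the exceptional set
    is taken Borel, spread out to two null cylinders in the product, and only the result is carried
    to the completion.\<close>
  have "AE x in lborel. U x = u x" using assms by (simp add: AE_completion_iff)
  then obtain N where N: "N \<in> null_sets lborel" "{x. U x \<noteq> u x} \<subseteq> N"
    by (auto simp: eventually_ae_filter)
  then have [measurable]: "N \<in> sets borel" and N0: "emeasure lborel N = 0" by auto
  have "emeasure (lborel \<Otimes>\<^sub>M lborel) (N \<times> (UNIV :: 'a set)) = 0"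
    using N0 by (subst lborel.emeasure_pair_measure_Times) auto
  moreover have "emeasure (lborel \<Otimes>\<^sub>M lborel) ((UNIV :: 'a set) \<times> N) = 0"
    using N0 by (subst lborel.emeasure_pair_measure_Times) auto
  ultimately have "N \<times> (UNIV :: 'a set) \<in> null_sets lborel" "(UNIV :: 'a set) \<times> N \<in> null_sets lborel"
    by (auto simp: lborel_prod[symmetric] null_sets_def intro!: pair_measureI)
  then have "AE z in lborel. z \<notin> N \<times> (UNIV :: 'a set)" "AE z in lborel. z \<notin> (UNIV :: 'a set) \<times> N"
    by (auto intro: AE_not_in)
  then have "AE z in (lborel :: ('a \<times> 'a) measure). U (fst z) = u (fst z) \<and> U (snd z) = u (snd z)"
    by eventually_elim (use N in auto)
  then show ?thesis by (rule AE_completion)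
qed

lemma AE_lebesgue_on:
  assumes "S \<in> sets lebesgue" "AE x in lebesgue. P x"
  shows "AE x in lebesgue_on S. P x"
  using assms by (subst AE_restrict_space_iff) auto

text \<open>A continuous function that vanishes off a bounded set is bounded, hence p-integrable;
  the fractional quotient is the only condition left to check.\<close>

lemma W_tilde_continuousI:
  fixes w :: "'a::euclidean_space \<Rightarrow> real"
  assumes "open \<Omega>" "bounded \<Omega>" "p > 0" "continuous_on UNIV w" "\<And>x. x \<notin> \<Omega> \<Longrightarrow> w x = 0"
    and int: "integrable lborel (frac_quotient t p w)"
  shows "w \<in> W_tilde t p \<Omega>"
proof -
  have [measurable]: "w \<in> borel_measurable borel"
    using assms(4) by (rule borel_measurable_continuous_onI)
  have \<Omega>: "\<Omega> \<in> sets lebesgue" "\<Omega> \<times> \<Omega> \<in> sets lebesgue"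
    using assms(1) by (auto intro!: borel_open sets_completionI_sets open_Times)
  have "bounded (w ` closure \<Omega>)"
    using assms(2,4) by (intro compact_imp_bounded compact_continuous_image)
      (auto simp: compact_closure intro: continuous_on_subset)
  then obtain K where K: "\<And>x. x \<in> closure \<Omega> \<Longrightarrow> \<bar>w x\<bar> \<le> K" by (auto simp: bounded_iff)
  have Kp: "integrable lborel (\<lambda>x. \<bar>w x\<bar> powr p)"
  proof (rule Bochner_Integration.integrable_bound)
    show "integrable lborel (\<lambda>x. K powr p * indicator \<Omega> x :: real)"
      using assms emeasure_bounded_finite[of \<Omega>] by (intro integrable_mult_right) auto
    show "AE x in lborel. norm (\<bar>w x\<bar> powr p) \<le> norm (K powr p * indicator \<Omega> x :: real)"
      using K assms(3,5) closure_subset[of \<Omega>] by (intro AE_I2) (auto simp: indicator_def intro!: powr_mono2)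
  qed simp
  then have 1: "integrable lebesgue (\<lambda>x. \<bar>w x\<bar> powr p)" by (simp add: integrable_completion)
  have 2: "integrable lebesgue (frac_quotient t p w)"
    using int borel_measurable_frac_quotient[of w] by (subst integrable_completion) auto
  have "w \<in> borel_measurable lebesgue" by (auto intro: measurable_completion)
  then have "w \<in> W_frac t p \<Omega>" "w \<in> W_frac t p UNIV"
    unfolding W_frac_def using 1 2 \<Omega> integrable_mult_indicator[OF \<Omega>(1) 1] integrable_mult_indicator[OF \<Omega>(2) 2]
    by (auto simp: lebesgue_on_UNIV_eq measurable_restrict_space1 integrable_restrict_space)
  then show ?thesis unfolding W_tilde_def using assms by auto
qed

lemma W_tilde_continuousD:
  fixes w :: "'a::euclidean_space \<Rightarrow> real"
  assumes "w \<in> W_tilde t p \<Omega>" "continuous_on UNIV w"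
  shows "integrable lborel (frac_quotient t p w)"
proof -
  have "w \<in> borel_measurable borel"
    using assms(2) by (rule borel_measurable_continuous_onI)
  then show ?thesis
    using assms borel_measurable_frac_quotient[of w]
    by (auto simp: W_tilde_def W_frac_def lebesgue_on_UNIV_eq integrable_completion)
qed

lemma W_tilde_continuous_representative:
  fixes u U :: "'a::euclidean_space \<Rightarrow> real"
  assumes \<Omega>: "open \<Omega>" "bounded \<Omega>" and "p > 0" and u: "u \<in> W_tilde t p \<Omega>"
    and U: "continuous_representative u U" "\<And>x. x \<notin> \<Omega> \<Longrightarrow> U x = 0"
  shows "U \<in> W_tilde t p \<Omega>"
proof (rule W_tilde_continuousI)
  show cont: "continuous_on UNIV U" using U by (simp add: continuous_representative_def)
  then have [measurable]: "U \<in> borel_measurable borel"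
    by (rule borel_measurable_continuous_onI)
  have ae: "AE z in lebesgue. U (fst z) = u (fst z) \<and> U (snd z) = u (snd z)"
    using U(1) unfolding continuous_representative_def by (blast intro: AE_pair_eq)
  have iu: "integrable lebesgue (frac_quotient t p u)"
    using u by (simp add: W_tilde_def W_frac_def lebesgue_on_UNIV_eq)
  have "integrable lebesgue (frac_quotient t p U)"
  proof (rule integrable_cong_AE_imp[OF iu])
    show "frac_quotient t p U \<in> borel_measurable lebesgue"
      using borel_measurable_frac_quotient[of U t p] by (auto intro: measurable_completion)
    show "AE z in lebesgue. frac_quotient t p u z = frac_quotient t p U z"
      using ae by eventually_elim (auto simp: frac_quotient_def split: prod.split)
  qed
  then show "integrable lborel (frac_quotient t p U)"
    using borel_measurable_frac_quotient[of U t p] by (simp add: integrable_completion)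
qed (use assms in auto)

text \<open>Both sides of the weak equations are integrals and ignore null sets, so eigenpairs may
  be assumed continuous from here on.\<close>

lemma eigenpair_continuous_representative:
  fixes u U :: "'a::euclidean_space \<Rightarrow> real"
  assumes \<Omega>: "open \<Omega>" "bounded \<Omega>" and p: "p \<ge> 1" and ep: "eigenpair \<Omega> r s p \<alpha> \<beta> \<mu> u v"
    and U: "continuous_representative u U" "\<And>x. x \<notin> \<Omega> \<Longrightarrow> U x = 0"
    and V: "continuous_representative v V" "\<And>x. x \<notin> \<Omega> \<Longrightarrow> V x = 0"
  shows "eigenpair \<Omega> r s p \<alpha> \<beta> \<mu> U V" and "coupling \<Omega> \<alpha> \<beta> U V = coupling \<Omega> \<alpha> \<beta> u v"
proof -
  have uW: "u \<in> W_tilde r p \<Omega>" "v \<in> W_tilde s p \<Omega>"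
    using ep by (auto simp: eigenpair_def admissible_def)
  have UW: "U \<in> W_tilde r p \<Omega>" "V \<in> W_tilde s p \<Omega>"
    using W_tilde_continuous_representative[OF \<Omega> _ uW(1) U] W_tilde_continuous_representative[OF \<Omega> _ uW(2) V] p by auto
  have meas: "w \<in> borel_measurable (lebesgue_on \<Omega>)" "w \<in> borel_measurable lebesgue" if "w \<in> W_tilde t p \<Omega>" for w t
    using that by (auto simp: W_tilde_def W_frac_def lebesgue_on_UNIV_eq)
  note [measurable] = meas(1)[OF uW(1)] meas(1)[OF uW(2)] meas(1)[OF UW(1)] meas(1)[OF UW(2)]
  have \<Omega>s: "\<Omega> \<in> sets lebesgue"
    using \<Omega> by (auto intro!: borel_open sets_completionI_sets)
  have ae: "AE x in lebesgue. U x = u x" "AE x in lebesgue. V x = v x"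
    using U V by (auto simp: continuous_representative_def)
  have aeo: "AE x in lebesgue_on \<Omega>. U x = u x" "AE x in lebesgue_on \<Omega>. V x = v x"
    using ae \<Omega>s by (auto intro: AE_lebesgue_on)
  show "coupling \<Omega> \<alpha> \<beta> U V = coupling \<Omega> \<alpha> \<beta> u v"
    unfolding coupling_def
    by (rule integral_cong_AE, measurable, use aeo in eventually_elim, auto)
  have form: "frac_form t p u' w = frac_form t p U' w"
    if u': "u' \<in> W_tilde t p \<Omega>" and U': "U' \<in> W_tilde t p \<Omega>" and w: "w \<in> W_tilde t p \<Omega>"
      and eq: "AE x in lebesgue. U' x = u' x" and cont: "continuous_on UNIV U'" for u' U' w t
  proof -
    \<comment> \<open>The test function is only Lebesgue measurable, and measurability of its
      two-point density is then not immediate. A Borel function equal to it almost everywhere is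
      inserted between the two forms.\<close>
    obtain w' where w'[measurable]: "w' \<in> borel_measurable borel" and aw: "AE x in lborel. w x = w' x"
      using completion_ex_borel_measurable_real[OF meas(2)[OF w]] by auto
    have aw': "AE x in lebesgue. w' x = w x" using aw by (auto simp: AE_completion_iff eq_commute)
    have bU: "U' \<in> borel_measurable borel" using cont by (rule borel_measurable_continuous_onI)
    have A: "AE z in lebesgue. form_density t p U' w' z = form_density t p u' w z"
      using AE_pair_eq[OF eq] AE_pair_eq[OF aw']
      by eventually_elim (auto simp: form_density_def split: prod.split)
    have B: "AE z in lebesgue. form_density t p U' w' z = form_density t p U' w z"
      using AE_pair_eq[OF aw']
      by eventually_elim (auto simp: form_density_def split: prod.split)
    have m: "form_density t p U' w' \<in> borel_measurable lebesgue"
      using borel_measurable_form_density[OF bU w'] by (auto intro: measurable_completion)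
    have "integral\<^sup>L lebesgue (form_density t p U' w') = integral\<^sup>L lebesgue (form_density t p u' w)"
      using A m borel_measurable_AE[OF m A] by (intro integral_cong_AE) auto
    moreover have "integral\<^sup>L lebesgue (form_density t p U' w') = integral\<^sup>L lebesgue (form_density t p U' w)"
      using B m borel_measurable_AE[OF m B] by (intro integral_cong_AE) auto
    ultimately show ?thesis by (simp add: frac_form_eq)
  qed
  have "admissible \<Omega> r s p U V"
    unfolding admissible_def
  proof (intro conjI notI)
    assume "AE x in lebesgue_on \<Omega>. U x * V x = 0"
    with aeo have "AE x in lebesgue_on \<Omega>. u x * v x = 0" by eventually_elim auto
    then show False using ep by (auto simp: eigenpair_def admissible_def)
  qed (use UW in auto)
  moreover have "frac_form r p U w =
          \<mu> * (\<alpha> / p) * (\<integral>x. \<bar>U x\<bar> powr (\<alpha> - 2) * U x * \<bar>V x\<bar> powr \<beta> * w x \<partial>lebesgue_on \<Omega>) \<and>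
        frac_form s p V z =
          \<mu> * (\<beta> / p) * (\<integral>x. \<bar>U x\<bar> powr \<alpha> * \<bar>V x\<bar> powr (\<beta> - 2) * V x * z x \<partial>lebesgue_on \<Omega>)"
    if w: "w \<in> W_tilde r p \<Omega>" and z: "z \<in> W_tilde s p \<Omega>" for w z
  proof -
    note [measurable] = meas(1)[OF w] meas(1)[OF z]
    have "(\<integral>x. \<bar>U x\<bar> powr (\<alpha> - 2) * U x * \<bar>V x\<bar> powr \<beta> * w x \<partial>lebesgue_on \<Omega>)
       = (\<integral>x. \<bar>u x\<bar> powr (\<alpha> - 2) * u x * \<bar>v x\<bar> powr \<beta> * w x \<partial>lebesgue_on \<Omega>)"
      by (rule integral_cong_AE, measurable, use aeo in eventually_elim, auto)
    moreover have "(\<integral>x. \<bar>U x\<bar> powr \<alpha> * \<bar>V x\<bar> powr (\<beta> - 2) * V x * z x \<partial>lebesgue_on \<Omega>)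
       = (\<integral>x. \<bar>u x\<bar> powr \<alpha> * \<bar>v x\<bar> powr (\<beta> - 2) * v x * z x \<partial>lebesgue_on \<Omega>)"
      by (rule integral_cong_AE, measurable, use aeo in eventually_elim, auto)
    moreover have "frac_form r p u w = frac_form r p U w" "frac_form s p v z = frac_form s p V z"
      using form[OF uW(1) UW(1) w ae(1)] form[OF uW(2) UW(2) z ae(2)] U(1) V(1)
      by (auto simp: continuous_representative_def)
    ultimately show ?thesis using ep w z by (auto simp: eigenpair_def)
  qed
  ultimately show "eigenpair \<Omega> r s p \<alpha> \<beta> \<mu> U V" by (auto simp: eigenpair_def)
qed

text \<open>Each equation is tested with its own unknown: the left side becomes the seminorm power,
  and the integral on the right becomes the coupling, which is normalized to 1.\<close>

lemma eigenpair_seminorm_pow: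
  assumes "eigenpair \<Omega> r s p \<alpha> \<beta> \<mu> u v" "coupling \<Omega> \<alpha> \<beta> u v = 1" "p > 0" "\<alpha> > 0" "\<beta> > 0"
  shows "seminorm_pow r p u = \<mu> * (\<alpha> / p)" and "seminorm_pow s p v = \<mu> * (\<beta> / p)"
proof -
  have *: "\<bar>a\<bar> powr (q - 2) * a * a = \<bar>a\<bar> powr q" if "q > 0" for a q :: real
    using signed_powr_mult_self[OF that, of a] by (simp add: signed_powr_def)
  have "(\<lambda>x. \<bar>u x\<bar> powr (\<alpha> - 2) * u x * \<bar>v x\<bar> powr \<beta> * u x) = (\<lambda>x. \<bar>u x\<bar> powr \<alpha> * \<bar>v x\<bar> powr \<beta>)"
    using *[OF assms(4)] by (metis (no_types, lifting) mult.assoc mult.commute)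
  moreover have "(\<lambda>x. \<bar>u x\<bar> powr \<alpha> * \<bar>v x\<bar> powr (\<beta> - 2) * v x * v x) = (\<lambda>x. \<bar>u x\<bar> powr \<alpha> * \<bar>v x\<bar> powr \<beta>)"
    using *[OF assms(5)] by (metis (no_types, lifting) mult.assoc)
  moreover have "u \<in> W_tilde r p \<Omega>" "v \<in> W_tilde s p \<Omega>"
    using assms by (auto simp: eigenpair_def admissible_def)
  moreover from this have "frac_form r p u u =
      \<mu> * (\<alpha> / p) * (\<integral>x. \<bar>u x\<bar> powr (\<alpha> - 2) * u x * \<bar>v x\<bar> powr \<beta> * u x \<partial>lebesgue_on \<Omega>)"
    "frac_form s p v v =
      \<mu> * (\<beta> / p) * (\<integral>x. \<bar>u x\<bar> powr \<alpha> * \<bar>v x\<bar> powr (\<beta> - 2) * v x * v x \<partial>lebesgue_on \<Omega>)"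
    using assms(1) unfolding eigenpair_def by blast+
  ultimately show "seminorm_pow r p u = \<mu> * (\<alpha> / p)" and "seminorm_pow s p v = \<mu> * (\<beta> / p)"
    using assms by (simp_all add: frac_form_self coupling_def)
qed

section \<open>A fractional Morrey estimate\<close>

text \<open>Takes the place of the Hoelder and Jensen inequalities: after integration a suitable
  \<tau> makes both terms equal, at the cost of a factor 2.\<close>

lemma le_add_powr:
  fixes a \<tau> :: real
  assumes "a \<ge> 0" "\<tau> > 0" "p \<ge> 1"
  shows "a \<le> \<tau> + \<tau> powr (1 - p) * a powr p"
proof (cases "a \<le> \<tau>")
  case False
  then have "a = a powr (1 - p) * a powr p" using assms by (simp flip: powr_add)
  also have "\<dots> \<le> \<tau> powr (1 - p) * a powr p"
    using False assms by (intro mult_right_mono powr_mono2') auto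
  finally show ?thesis using assms by simp
qed (use assms in \<open>simp add: add_increasing2\<close>)

lemma integrable_integral_pair_mult:
  fixes f g :: "'a::euclidean_space \<Rightarrow> real"
  assumes f: "integrable lborel f" and g: "integrable lborel g"
  shows "integrable lborel (\<lambda>(x, y). f x * g y)"
    and "(\<integral>(x, y). f x * g y \<partial>lborel) = integral\<^sup>L lborel f * integral\<^sup>L lborel g"
proof -
  have [measurable]: "f \<in> borel_measurable borel" "g \<in> borel_measurable borel" using assms by auto
  have *: "integrable (lborel \<Otimes>\<^sub>M lborel) (\<lambda>(x, y). f x * g y)"
  proof (rule lborel_pair.Fubini_integrable)
    have "integrable lborel (\<lambda>x. \<bar>f x\<bar> * (\<integral>y. \<bar>g y\<bar> \<partial>lborel))" using f by auto
    then show "integrable lborel (\<lambda>x. \<integral>y. norm (case (x, y) of (x, y) \<Rightarrow> f x * g y) \<partial>lborel)"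
      using g by (simp add: abs_mult)
    show "AE x in lborel. integrable lborel (\<lambda>y. case (x, y) of (x, y) \<Rightarrow> f x * g y)"
      using g by simp
  qed measurable
  then show "integrable lborel (\<lambda>(x, y). f x * g y)" by (simp add: lborel_prod)
  show "(\<integral>(x, y). f x * g y \<partial>lborel) = integral\<^sup>L lborel f * integral\<^sup>L lborel g"
    using lborel_pair.integral_fst'[OF *] by (simp add: lborel_prod)
qed

definition set_average :: "('a::euclidean_space \<Rightarrow> real) \<Rightarrow> 'a set \<Rightarrow> real" where
  "set_average w E = (\<integral>x. indicator E x * w x \<partial>lborel) / measure lborel E"

lemma integrable_indicator_mult_powr:
  fixes w :: "'a::euclidean_space \<Rightarrow> real"
  assumes "w \<in> borel_measurable borel" "integrable lborel (\<lambda>x. \<bar>w x\<bar> powr p)" "p \<ge> 1"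
    and E: "E \<in> sets borel" "bounded E"
  shows "integrable lborel (\<lambda>x. indicator E x * w x)"
proof (rule Bochner_Integration.integrable_bound)
  show "integrable lborel (\<lambda>x. indicator E x + \<bar>w x\<bar> powr p)"
    using assms emeasure_bounded_finite[OF E(2)] by (intro Bochner_Integration.integrable_add) auto
  show "AE x in lborel. norm (indicator E x * w x) \<le> norm (indicator E x + \<bar>w x\<bar> powr p)"
    using le_add_powr[of "\<bar>w _\<bar>" 1 p] assms(3) by (intro AE_I2) (auto simp: indicator_def)
qed (use assms in auto)

lemma abs_diff_powr_le_frac_quotient:
  assumes "norm (x - y) \<le> d" "t \<ge> 0" "p \<ge> 0"
  shows "\<bar>w x - w y\<bar> powr p \<le> d powr (real DIM('a) + t * p) * frac_quotient t p w (x::'a::euclidean_space, y)"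
proof (cases "x = y")
  case False
  have "\<bar>w x - w y\<bar> powr p = norm (x - y) powr (real DIM('a) + t * p) * frac_quotient t p w (x, y)"
    using False by (simp add: frac_quotient_def)
  also have "\<dots> \<le> d powr (real DIM('a) + t * p) * frac_quotient t p w (x, y)"
    using assms by (intro mult_right_mono powr_mono2) (auto simp: frac_quotient_nonneg)
  finally show ?thesis .
qed (simp add: frac_quotient_def)

text \<open>The hypothesis \<open>le\<close> forces the mean of |w y - w z|^p over \<open>E\<close>
  x \<open>F\<close> to be at most \<tau>^p. The difference of the averages is the mean of w y - w
  z, which \<open>le_add_powr\<close> then bounds.\<close>

lemma set_average_diff_le:
  fixes w :: "'a::euclidean_space \<Rightarrow> real"
  assumes w[measurable]: "w \<in> borel_measurable borel" and wp: "integrable lborel (\<lambda>x. \<bar>w x\<bar> powr p)" and p: "p \<ge> 1" "t \<ge> 0"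
    and fq: "integrable lborel (frac_quotient t p w)"
    and E[measurable]: "E \<in> sets borel" and F[measurable]: "F \<in> sets borel" and bd: "bounded E" "bounded F"
    and pos: "measure lborel E > 0" "measure lborel F > 0"
    and d: "\<And>y z. y \<in> E \<Longrightarrow> z \<in> F \<Longrightarrow> norm (y - z) \<le> d"
    and \<tau>: "\<tau> > 0" and le: "d powr (real DIM('a) + t * p) * integral\<^sup>L lborel (frac_quotient t p w)
      \<le> \<tau> powr p * (measure lborel E * measure lborel F)"
  shows "\<bar>set_average w E - set_average w F\<bar> \<le> 2 * \<tau>"
proof -
  let ?e = "measure lborel E" and ?f = "measure lborel F"
  define iE where "iE = (\<lambda>x. indicator E x :: real)"
  define iF where "iF = (\<lambda>x. indicator F x :: real)"
  let ?D = "d powr (real DIM('a) + t * p)"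
  have fin: "emeasure lborel E < \<infinity>" "emeasure lborel F < \<infinity>" using bd emeasure_bounded_finite by blast+
  have iEi: "integrable lborel iE" "integral\<^sup>L lborel iE = ?e" and iFi: "integrable lborel iF" "integral\<^sup>L lborel iF = ?f"
    unfolding iE_def iF_def using fin by auto
  have wE: "integrable lborel (\<lambda>x. iE x * w x)" and wF: "integrable lborel (\<lambda>x. iF x * w x)"
    unfolding iE_def iF_def using integrable_indicator_mult_powr[OF w wp p(1)] bd by auto
  note 1 = integrable_integral_pair_mult[OF wE iFi(1)] and 2 = integrable_integral_pair_mult[OF iEi(1) wF]
    and 3 = integrable_integral_pair_mult[OF iEi(1) iFi(1)]
  define G where "G = (\<lambda>(y, z). iE y * iF z * (w y - w z))"
  have Geq: "G = (\<lambda>p. (case p of (y, z) \<Rightarrow> iE y * w y * iF z) - (case p of (y, z) \<Rightarrow> iE y * (iF z * w z)))"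
    by (auto simp: G_def algebra_simps)
  have Gi: "integrable lborel G" unfolding Geq by (intro Bochner_Integration.integrable_diff 1 2)
  have "integral\<^sup>L lborel G = ?f * (\<integral>x. iE x * w x \<partial>lborel) - ?e * (\<integral>x. iF x * w x \<partial>lborel)"
    unfolding Geq by (subst Bochner_Integration.integral_diff[OF 1(1) 2(1)]) (simp only: 1(2) 2(2) iEi iFi, simp only: mult.commute[of _ ?f])
  also have "\<dots> = (?e * ?f) * (set_average w E - set_average w F)"
    using pos by (simp add: set_average_def iE_def iF_def field_simps)
  finally have eq: "(?e * ?f) * (set_average w E - set_average w F) = integral\<^sup>L lborel G" ..
  have "(?e * ?f) * \<bar>set_average w E - set_average w F\<bar> = \<bar>integral\<^sup>L lborel G\<bar>"
    using pos by (simp add: abs_mult flip: eq)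
  also have "\<dots> \<le> (\<integral>q. \<bar>G q\<bar> \<partial>lborel)" by (rule integral_abs_bound)
  also have "\<dots> \<le> (\<integral>q. \<tau> * (case q of (y, z) \<Rightarrow> iE y * iF z) + \<tau> powr (1 - p) * ?D * frac_quotient t p w q \<partial>lborel)"
  proof (rule integral_mono)
    show "\<bar>G q\<bar> \<le> \<tau> * (case q of (y, z) \<Rightarrow> iE y * iF z) + \<tau> powr (1 - p) * ?D * frac_quotient t p w q" for q
    proof -
      obtain y z where q: "q = (y, z)" by fastforce
      have nn: "0 \<le> \<tau> powr (1 - p) * ?D * frac_quotient t p w q"
        by (simp add: frac_quotient_nonneg)
      show ?thesis
      proof (cases "y \<in> E \<and> z \<in> F")
        case True
        have "\<bar>w y - w z\<bar> \<le> \<tau> + \<tau> powr (1 - p) * \<bar>w y - w z\<bar> powr p"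
          by (rule le_add_powr) (use \<tau> p in auto)
        also have "\<dots> \<le> \<tau> + \<tau> powr (1 - p) * (?D * frac_quotient t p w q)"
          unfolding q using True p d
          by (intro add_left_mono mult_left_mono abs_diff_powr_le_frac_quotient) auto
        finally show ?thesis using True by (simp add: G_def q iE_def iF_def mult.assoc)
      next
        case False
        then have "G q = 0" "(case q of (y, z) \<Rightarrow> iE y * iF z) = 0"
          by (auto simp: G_def q iE_def iF_def)
        then show ?thesis using nn by simp
      qed
    qed
    show "integrable lborel (\<lambda>q. \<bar>G q\<bar>)" using Gi by simp
    show "integrable lborel (\<lambda>q. \<tau> * (case q of (y, z) \<Rightarrow> iE y * iF z) + \<tau> powr (1 - p) * ?D * frac_quotient t p w q)"
      using 3 fq by (intro Bochner_Integration.integrable_add integrable_mult_right) auto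
  qed
  also have "\<dots> = \<tau> * (?e * ?f) + \<tau> powr (1 - p) * (?D * integral\<^sup>L lborel (frac_quotient t p w))"
    using 3 fq iEi iFi by (subst Bochner_Integration.integral_add) (auto simp: mult.assoc)
  \<comment> \<open>The hypothesis \<open>le\<close> turns the second term into a copy of the first,
    because \<tau>^(1-p) \<tau>^p = \<tau>.\<close>
  also have "\<dots> \<le> \<tau> * (?e * ?f) + \<tau> powr (1 - p) * (\<tau> powr p * (?e * ?f))"
    using le by (intro add_left_mono mult_left_mono) auto
  also have "\<dots> = \<tau> * (?e * ?f) + (\<tau> powr (1 - p) * \<tau> powr p) * (?e * ?f)" by simp
  also have "\<tau> powr (1 - p) * \<tau> powr p = \<tau>" using \<tau> by (simp flip: powr_add)
  also have "\<tau> * (?e * ?f) + \<tau> * (?e * ?f) = (?e * ?f) * (2 * \<tau>)" by simp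
  finally show ?thesis using pos by simp
qed

text \<open>By Fubini the quotient is integrable in y for almost every x. For such x the factor
  r^(N+tp) that removes the kernel beats the volume r^N of the ball by r^(tp), so the averages
  converge without a differentiation theorem.\<close>

lemma set_average_tendsto_AE:
  fixes w :: "'a::euclidean_space \<Rightarrow> real"
  assumes w[measurable]: "w \<in> borel_measurable borel" and wp: "integrable lborel (\<lambda>x. \<bar>w x\<bar> powr p)" and p: "p \<ge> 1" "t > 0"
    and fq: "integrable lborel (frac_quotient t p w)"
    and \<rho>: "\<And>n. \<rho> n > 0" "\<rho> \<longlonglongrightarrow> 0"
  shows "AE x in lborel. (\<lambda>n. set_average w (ball x (\<rho> n))) \<longlonglongrightarrow> w x"
proof -
  have "AE x in lborel. integrable lborel (\<lambda>y. frac_quotient t p w (x, y))"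
    using fq by (intro lborel_pair.AE_integrable_fst') (simp add: lborel_prod)
  then show ?thesis
  proof eventually_elim
    case (elim x)
    define k where "k = (\<integral>y. frac_quotient t p w (x, y) \<partial>lborel)"
    define V where "V = unit_ball_vol (real DIM('a))"
    have V: "V > 0" by (simp add: V_def)
    have bound: "\<bar>set_average w (ball x r) - w x\<bar> \<le> \<tau> + \<tau> powr (1 - p) * k / V * r powr (t * p)"
      if r: "r > 0" and \<tau>: "\<tau> > 0" for r \<tau>
    proof -
      define B where "B = ball x r"
      define iB where "iB = (\<lambda>y. indicator B y :: real)"
      have m: "measure lborel B = V * r powr real DIM('a)"
        using r by (simp add: B_def V_def content_ball powr_realpow)
      then have mpos: "measure lborel B > 0" using V r by simp
      have fin: "emeasure lborel B < \<infinity>" unfolding B_def using bounded_ball emeasure_bounded_finite by blast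
      have iBi: "integrable lborel iB" "integral\<^sup>L lborel iB = measure lborel B"
        using fin unfolding iB_def B_def by auto
      have wB: "integrable lborel (\<lambda>y. iB y * w y)"
        unfolding iB_def by (rule integrable_indicator_mult_powr[OF w wp p(1)]) (auto simp: B_def)
      let ?D = "r powr (real DIM('a) + t * p)"
      have di: "integrable lborel (\<lambda>y. iB y * w y - iB y * w x)"
        using wB iBi by (intro Bochner_Integration.integrable_diff) auto
      have "measure lborel B * \<bar>set_average w B - w x\<bar> = \<bar>(\<integral>y. iB y * w y \<partial>lborel) - (\<integral>y. iB y * w x \<partial>lborel)\<bar>"
        using mpos iBi by (simp add: set_average_def iB_def abs_mult_pos' field_simps flip: abs_mult_pos)
      also have "\<dots> = \<bar>\<integral>y. iB y * w y - iB y * w x \<partial>lborel\<bar>"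
        using wB iBi by (subst Bochner_Integration.integral_diff) auto
      also have "\<dots> \<le> (\<integral>y. \<bar>iB y * w y - iB y * w x\<bar> \<partial>lborel)" by (rule integral_abs_bound)
      also have "\<dots> \<le> (\<integral>y. \<tau> * iB y + \<tau> powr (1 - p) * ?D * frac_quotient t p w (x, y) \<partial>lborel)"
      proof (rule integral_mono)
        show "\<bar>iB y * w y - iB y * w x\<bar> \<le> \<tau> * iB y + \<tau> powr (1 - p) * ?D * frac_quotient t p w (x, y)" for y
        proof (cases "y \<in> B")
          case True
          have "\<bar>w x - w y\<bar> \<le> \<tau> + \<tau> powr (1 - p) * \<bar>w x - w y\<bar> powr p"
            by (rule le_add_powr) (use \<tau> p in auto)
          also have "\<dots> \<le> \<tau> + \<tau> powr (1 - p) * (?D * frac_quotient t p w (x, y))"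
            using True p by (intro add_left_mono mult_left_mono abs_diff_powr_le_frac_quotient) (auto simp: B_def dist_norm)
          finally show ?thesis using True by (simp add: iB_def mult.assoc abs_minus_commute)
        qed (simp add: iB_def frac_quotient_nonneg)
        show "integrable lborel (\<lambda>y. \<bar>iB y * w y - iB y * w x\<bar>)" using di by simp
        show "integrable lborel (\<lambda>y. \<tau> * iB y + \<tau> powr (1 - p) * ?D * frac_quotient t p w (x, y))"
          using iBi elim by (intro Bochner_Integration.integrable_add integrable_mult_right) auto
      qed
      also have "\<dots> = \<tau> * measure lborel B + \<tau> powr (1 - p) * ?D * k"
        using iBi elim by (subst Bochner_Integration.integral_add) (auto simp: k_def)
      finally have "\<bar>set_average w B - w x\<bar> \<le> (\<tau> * measure lborel B + \<tau> powr (1 - p) * ?D * k) / measure lborel B"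
        using mpos by (simp add: pos_le_divide_eq mult.commute)
      also have "\<dots> = \<tau> + \<tau> powr (1 - p) * k / V * r powr (t * p)"
        unfolding m using V r by (simp add: powr_add field_simps)
      finally show ?thesis unfolding B_def .
    qed
    show "(\<lambda>n. set_average w (ball x (\<rho> n))) \<longlonglongrightarrow> w x"
    proof (rule LIMSEQ_I)
      fix e :: real assume e: "e > 0"
      have "(\<lambda>n. \<rho> n powr (t * p)) \<longlonglongrightarrow> 0"
        using \<rho> p by (intro tendsto_zero_powrI[where b="t * p"]) (auto intro!: always_eventually less_imp_le)
      then have "(\<lambda>n. e / 2 + (e / 2) powr (1 - p) * k / V * \<rho> n powr (t * p)) \<longlonglongrightarrow> e / 2 + (e / 2) powr (1 - p) * k / V * 0"
        by (intro tendsto_intros)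
      then have "\<forall>\<^sub>F n in sequentially. e / 2 + (e / 2) powr (1 - p) * k / V * \<rho> n powr (t * p) < e"
        by (rule order_tendstoD) (use e in auto)
      then have "\<forall>\<^sub>F n in sequentially. norm (set_average w (ball x (\<rho> n)) - w x) < e"
        by eventually_elim (use bound[OF \<rho>(1), of "e / 2"] e in \<open>force intro: le_less_trans\<close>)
      then show "\<exists>no. \<forall>n\<ge>no. norm (set_average w (ball x (\<rho> n)) - w x) < e"
        by (simp add: eventually_sequentially)
    qed
  qed
qed

text \<open>Averages over balls of radius 2^-n are compared at neighbouring points and at
  consecutive scales; their limit is the representative. The modulus is linear in \<open>K\<close>
  with \<open>C\<close> independent of p, since it is used for all large exponents at once.\<close>

lemma fractional_morrey:
  assumes t: "0 < t" "t \<le> 1"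
  shows "\<exists>C>0. \<forall>p K w. t * p \<ge> 2 * real DIM('a) \<longrightarrow> K > 0 \<longrightarrow> w \<in> borel_measurable borel \<longrightarrow>
     integrable lborel (\<lambda>x::'a::euclidean_space. \<bar>w x\<bar> powr p) \<longrightarrow> integrable lborel (frac_quotient t p w) \<longrightarrow>
     integral\<^sup>L lborel (frac_quotient t p w) \<le> K powr p \<longrightarrow>
     (\<exists>w'. (AE x in lborel. w' x = w x) \<and>
        (\<forall>n x y. norm (x - y) \<le> (1 / 2) ^ n \<longrightarrow> \<bar>w' x - w' y\<bar> \<le> C * K * (2 powr (- t / 2)) ^ n))"
proof -
  define N where "N = real DIM('a)"
  define V where "V = unit_ball_vol N"
  have N: "N \<ge> 1" by (simp add: N_def Suc_leI)
  have V: "V > 0" by (simp add: V_def N_def)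
  \<comment> \<open>The factors of \<open>c\<close> absorb what arises in \<open>key\<close>: 9^p
    bounds 3^(N+tp), which comes from the distance 3 \<rho>; 2^p bounds 2^N, which comes from
    halving a radius; and the maximum, raised to the power p, bounds 1 / V^2.\<close>
  define c where "c = 18 * max 1 (1 / V\<^sup>2)"
  have c: "c > 0" by (simp add: c_def)
  \<comment> \<open>Half of the exponent t is given up: t p >= 2 N yields t p - N >= t p / 2,
    uniformly in p.\<close>
  define \<theta> where "\<theta> = (2::real) powr (- t / 2)"
  have \<theta>: "0 < \<theta>" "\<theta> < 1" using t by (auto simp: \<theta>_def powr_less_one)
  \<comment> \<open>One comparison at a fixed scale costs 2 c, and each of the two tails from that
    scale to the limit costs 2 c / (1 - \<theta>).\<close>
  define C where "C = 2 * c * (1 + 2 / (1 - \<theta>))"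
  have C: "C > 0" using c \<theta> by (auto simp: C_def intro!: mult_pos_pos add_pos_pos divide_pos_pos)
  have "\<exists>w'. (AE x in lborel. w' x = w x) \<and>
        (\<forall>n x y. norm (x - y) \<le> (1 / 2) ^ n \<longrightarrow> \<bar>w' x - w' y\<bar> \<le> C * K * \<theta> ^ n)"
    if tp: "t * p \<ge> 2 * N" and K: "K > 0" and w: "w \<in> borel_measurable borel"
     and wp: "integrable lborel (\<lambda>x::'a. \<bar>w x\<bar> powr p)" and fq: "integrable lborel (frac_quotient t p w)"
     and le: "integral\<^sup>L lborel (frac_quotient t p w) \<le> K powr p" for p K w
  proof -
    have "t * p > 0" using tp N by linarith
    then have p0: "p > 0" using t by (simp add: zero_less_mult_iff)
    then have tpp: "t * p \<le> p" using t by (intro mult_left_le_one_le) auto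
    then have p: "p \<ge> 2 * N" "p \<ge> 1" using tp N by linarith+
    define M where "M = 2 * (c * K)"
    have M: "M > 0" using c K by (simp add: M_def)
    define A where "A = (\<lambda>n x. set_average w (ball x ((1 / 2) ^ n)))"
    \<comment> \<open>With m = n this compares two points at one scale; with m = Suc n and x = y it
      compares consecutive scales at one point.\<close>
    have key: "\<bar>A n x - A m y\<bar> \<le> M * \<theta> ^ n" if xy: "norm (x - y) \<le> (1 / 2) ^ n" and m: "m = n \<or> m = Suc n" for n m x y
    proof -
      define \<rho> where "\<rho> = (1 / 2 :: real) ^ n"
      define \<rho>' where "\<rho>' = (1 / 2 :: real) ^ m"
      have \<rho>: "0 < \<rho>" "\<rho> \<le> 1" "0 < \<rho>'" "\<rho>' \<le> \<rho>" "\<rho> / 2 \<le> \<rho>'"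
        using m by (auto simp: \<rho>_def \<rho>'_def power_le_one)
      define \<tau> where "\<tau> = c * K * \<theta> ^ n"
      have \<tau>: "\<tau> > 0" using c K \<theta> by (simp add: \<tau>_def)
      have th: "\<theta> ^ n = \<rho> powr (t / 2)"
        by (simp add: \<theta>_def \<rho>_def powr_realpow[symmetric] powr_powr powr_divide powr_minus_divide mult.commute)
      have vol: "measure lborel (ball x \<rho>) = V * \<rho> powr N" "measure lborel (ball y \<rho>') = V * \<rho>' powr N"
        using \<rho> by (auto simp: V_def N_def content_ball powr_realpow)
      have half: "t / 2 * p \<le> t * p - N" using tp by linarith
      have "\<bar>set_average w (ball x \<rho>) - set_average w (ball y \<rho>')\<bar> \<le> 2 * \<tau>"
      proof (rule set_average_diff_le[OF w wp _ _ fq])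
        show "norm (a - b) \<le> 3 * \<rho>" if "a \<in> ball x \<rho>" "b \<in> ball y \<rho>'" for a b
        proof -
          have "norm (a - b) = norm ((a - x) + (x - y) + (y - b))" by simp
          also have "\<dots> \<le> norm (a - x) + norm (x - y) + norm (y - b)"
            by (intro norm_triangle_le add_mono order_refl)
          finally show ?thesis using that xy \<rho> by (simp add: dist_norm \<rho>_def norm_minus_commute)
        qed
        have "(3 * \<rho>) powr (N + t * p) * integral\<^sup>L lborel (frac_quotient t p w) \<le> (3 * \<rho>) powr (N + t * p) * K powr p"
          using le by (intro mult_left_mono) auto
        also have "\<dots> = 3 powr (N + t * p) * (\<rho> powr (N + t * p) * K powr p)"
          using \<rho> by (simp add: powr_mult)
        also have "\<dots> \<le> (c powr p * V\<^sup>2 * 2 powr - N) * (\<rho> powr (N + t * p) * K powr p)"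
        proof (rule mult_right_mono)
          have "3 powr (N + t * p) \<le> (3::real) powr (2 * p)"
            using p tp N tpp by (intro powr_mono) auto
          also have "\<dots> = 9 powr p" by (simp add: powr_powr[symmetric])
          finally have a: "3 powr (N + t * p) \<le> (9::real) powr p" .
          have b: "2 powr N \<le> (2::real) powr p" using p N by (intro powr_mono) auto
          have "1 / V\<^sup>2 \<le> max 1 (1 / V\<^sup>2) powr 1" by simp
          also have "\<dots> \<le> max 1 (1 / V\<^sup>2) powr p" using p by (intro powr_mono) auto
          finally have d: "1 \<le> max 1 (1 / V\<^sup>2) powr p * V\<^sup>2" using V by (simp add: divide_le_eq)
          have "3 powr (N + t * p) * 2 powr N \<le> 9 powr p * 2 powr p"
            using a b by (intro mult_mono) auto
          also have "\<dots> = 18 powr p" by (simp flip: powr_mult)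
          also have "\<dots> \<le> 18 powr p * (max 1 (1 / V\<^sup>2) powr p * V\<^sup>2)"
            using d by (metis mult.right_neutral mult_left_mono powr_ge_zero)
          also have "\<dots> = c powr p * V\<^sup>2" by (simp add: c_def powr_mult)
          finally show "3 powr (N + t * p) \<le> c powr p * V\<^sup>2 * 2 powr - N"
            by (simp add: powr_minus_divide pos_le_divide_eq)
        qed simp
        also have "\<dots> = c powr p * K powr p * \<rho> powr (t * p - N) * (V\<^sup>2 * 2 powr - N * \<rho> powr (2 * N))"
        proof -
          have "\<rho> powr (N + t * p) = \<rho> powr (t * p - N) * \<rho> powr (2 * N)" by (simp flip: powr_add)
          then show ?thesis by simp
        qed
        also have "\<dots> \<le> c powr p * K powr p * \<rho> powr (t / 2 * p) * (V\<^sup>2 * \<rho> powr N * \<rho>' powr N)"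
        proof (rule mult_mono)
          have "\<rho> powr (t * p - N) \<le> \<rho> powr (t / 2 * p)"
            using half \<rho> by (intro powr_mono') auto
          then show "c powr p * K powr p * \<rho> powr (t * p - N) \<le> c powr p * K powr p * \<rho> powr (t / 2 * p)"
            by (intro mult_left_mono) auto
          have "2 powr - N * \<rho> powr N = (\<rho> / 2) powr N"
            using \<rho> by (simp add: powr_divide powr_minus_divide)
          also have "\<dots> \<le> \<rho>' powr N" using \<rho> N by (intro powr_mono2) auto
          finally have "\<rho> powr N * (2 powr - N * \<rho> powr N) \<le> \<rho> powr N * \<rho>' powr N"
            by (intro mult_left_mono) auto
          moreover have "\<rho> powr (2 * N) = \<rho> powr N * \<rho> powr N" by (simp flip: powr_add)
          ultimately have "V\<^sup>2 * (2 powr - N * \<rho> powr (2 * N)) \<le> V\<^sup>2 * (\<rho> powr N * \<rho>' powr N)"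
            by (intro mult_left_mono) (auto simp: mult_ac)
          then show "V\<^sup>2 * 2 powr - N * \<rho> powr (2 * N) \<le> V\<^sup>2 * \<rho> powr N * \<rho>' powr N"
            by (simp add: mult.assoc)
        qed auto
        also have "\<dots> = \<tau> powr p * (measure lborel (ball x \<rho>) * measure lborel (ball y \<rho>'))"
          unfolding vol \<tau>_def th using c K \<rho> by (simp add: powr_mult powr_powr power2_eq_square)
        finally show "(3 * \<rho>) powr (real DIM('a) + t * p) * integral\<^sup>L lborel (frac_quotient t p w)
          \<le> \<tau> powr p * (measure lborel (ball x \<rho>) * measure lborel (ball y \<rho>'))"
          by (simp add: N_def)
      qed (use p t \<tau> \<rho> V vol in auto)
      then show ?thesis by (simp add: A_def \<rho>_def \<rho>'_def \<tau>_def M_def)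
    qed
    \<comment> \<open>The partial geometric sum is kept in closed form so that the induction
      closes.\<close>
    have step: "\<bar>A (n + k) x - A n x\<bar> \<le> M * \<theta> ^ n * (1 - \<theta> ^ k) / (1 - \<theta>)" for n k x
    proof (induction k)
      case (Suc k)
      have "\<bar>A (n + Suc k) x - A n x\<bar> \<le> \<bar>A (n + k) x - A (Suc (n + k)) x\<bar> + \<bar>A (n + k) x - A n x\<bar>" by simp
      also have "\<dots> \<le> M * \<theta> ^ (n + k) + M * \<theta> ^ n * (1 - \<theta> ^ k) / (1 - \<theta>)"
        using key[of x x "n + k" "Suc (n + k)"] Suc by (intro add_mono) auto
      also have "\<dots> = M * \<theta> ^ n * (1 - \<theta> ^ Suc k) / (1 - \<theta>)"
        using \<theta> by (simp add: field_simps power_add)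
      finally show ?case .
    qed simp
    have step': "\<bar>A m x - A n x\<bar> \<le> M / (1 - \<theta>) * \<theta> ^ n" if "n \<le> m" for n m x
    proof -
      have "\<bar>A m x - A n x\<bar> \<le> M * \<theta> ^ n * (1 - \<theta> ^ (m - n)) / (1 - \<theta>)"
        using step[of n "m - n" x] that by simp
      also have "\<dots> \<le> M * \<theta> ^ n * 1 / (1 - \<theta>)"
        using M \<theta> by (intro divide_right_mono mult_left_mono) auto
      finally show ?thesis by simp
    qed
    have th0: "(\<lambda>n. M / (1 - \<theta>) * \<theta> ^ n) \<longlonglongrightarrow> 0"
      using \<theta> by (intro tendsto_mult_right_zero LIMSEQ_realpow_zero) auto
    have "Cauchy (\<lambda>n. A n x)" for x
    proof (rule CauchyI')
      fix e :: real assume "e > 0"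
      then obtain n0 where n0: "M / (1 - \<theta>) * \<theta> ^ n0 < e"
        using order_tendstoD(2)[OF th0] by (auto simp: eventually_sequentially)
      have "dist (A m x) (A n x) < e" if "m \<ge> n0" "n > m" for m n
      proof -
        have "\<theta> ^ m \<le> \<theta> ^ n0" using that \<theta> by (intro power_decreasing) auto
        then have "M / (1 - \<theta>) * \<theta> ^ m \<le> M / (1 - \<theta>) * \<theta> ^ n0"
          using M \<theta> by (intro mult_left_mono) auto
        then show ?thesis using step'[of m n x] that n0 by (simp add: abs_minus_commute dist_real_def)
      qed
      then show "\<exists>M. \<forall>m\<ge>M. \<forall>n>m. dist (A m x) (A n x) < e" by blast
    qed
    then have "\<exists>w'. \<forall>x. (\<lambda>n. A n x) \<longlonglongrightarrow> w' x"
      by (meson Cauchy_convergent_iff convergent_def)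
    then obtain w' where w': "\<And>x. (\<lambda>n. A n x) \<longlonglongrightarrow> w' x" by blast
    have lim: "\<bar>w' x - A n x\<bar> \<le> M / (1 - \<theta>) * \<theta> ^ n" for x n
    proof (rule tendsto_upperbound)
      show "(\<lambda>m. \<bar>A m x - A n x\<bar>) \<longlonglongrightarrow> \<bar>w' x - A n x\<bar>"
        by (intro tendsto_intros w')
      show "\<forall>\<^sub>F m in sequentially. \<bar>A m x - A n x\<bar> \<le> M / (1 - \<theta>) * \<theta> ^ n"
        using eventually_ge_at_top[of n] by eventually_elim (rule step')
    qed simp
    show ?thesis
    proof (intro exI[of _ w'] conjI allI impI)
      have "AE x in lborel. (\<lambda>n. A n x) \<longlonglongrightarrow> w x"
        unfolding A_def using p t by (intro set_average_tendsto_AE[OF w wp _ _ fq] LIMSEQ_realpow_zero) auto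
      then show "AE x in lborel. w' x = w x"
        by eventually_elim (use w' LIMSEQ_unique in blast)
    next
      fix n and x y :: 'a assume "norm (x - y) \<le> (1 / 2) ^ n"
      then have "\<bar>A n x - A n y\<bar> \<le> M * \<theta> ^ n" using key by blast
      moreover have "C * K * \<theta> ^ n = M * \<theta> ^ n + M / (1 - \<theta>) * \<theta> ^ n + M / (1 - \<theta>) * \<theta> ^ n"
        by (simp add: C_def M_def field_simps)
      ultimately show "\<bar>w' x - w' y\<bar> \<le> C * K * \<theta> ^ n"
        using lim[of x n] lim[of y n] by linarith
    qed
  qed
  then show ?thesis using C unfolding \<theta>_def N_def by blast
qed

section \<open>Truncated cones as test functions\<close>

lemma integral_lebesgue_on_eq_lborel:
  fixes f :: "'a::euclidean_space \<Rightarrow> real"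
  assumes "open \<Omega>" "f \<in> borel_measurable borel"
  shows "(\<integral>x. f x \<partial>lebesgue_on \<Omega>) = (\<integral>x. indicator \<Omega> x * f x \<partial>lborel)"
proof -
  have "\<Omega> \<in> sets lebesgue" using assms(1) by (auto intro!: borel_open sets_completionI_sets)
  then have "(\<integral>x. f x \<partial>lebesgue_on \<Omega>) = (\<integral>x. indicator \<Omega> x * f x \<partial>lebesgue)"
    by (simp add: integral_restrict_space)
  also have "\<dots> = (\<integral>x. indicator \<Omega> x * f x \<partial>lborel)"
    using assms by (subst integral_completion) auto
  finally show ?thesis .
qed

lemma integrable_indicator_bounded:
  fixes f :: "'a::euclidean_space \<Rightarrow> real"
  assumes "B \<in> sets borel" "bounded B" "f \<in> borel_measurable borel" "\<And>x. x \<in> B \<Longrightarrow> \<bar>f x\<bar> \<le> K"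
  shows "integrable lborel (\<lambda>x. indicator B x * f x)"
proof (rule Bochner_Integration.integrable_bound)
  show "integrable lborel (\<lambda>x. K * indicator B x :: real)"
    using assms(1) emeasure_bounded_finite[OF assms(2)] by (intro integrable_mult_right) auto
  show "AE x in lborel. norm (indicator B x * f x) \<le> norm (K * indicator B x :: real)"
    using assms(4) by (intro AE_I2) (force simp: indicator_def)
qed (use assms in auto)

text \<open>Differences of a function supported in \<open>B\<close> vanish unless one point lies in
  \<open>B\<close>. The sum of the two indicators is 0, 1 or 2, so its p-th power costs at most the
  factor 2^p.\<close>

lemma local_kernel_bound:
  fixes x y :: "'a::euclidean_space"
  assumes "p \<ge> 0" "L \<ge> 0" "M \<ge> 0"
  shows "((indicator B x + indicator B y) * min (L * norm (x - y)) M) powr p / norm (x - y) powr (real DIM('a) + t * p) \<le> 2 powr p *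
     (indicator B x * trunc_kernel L M p (t * p) (x - y) + indicator B y * trunc_kernel L M p (t * p) (x - y))"
proof -
  have "((indicator B x + indicator B y) * min (L * norm (x - y)) M) powr p = (indicator B x + indicator B y) powr p * min (L * norm (x - y)) M powr p"
    by (rule powr_mult)
  also have "\<dots> \<le> (2 powr p * (indicator B x + indicator B y)) * min (L * norm (x - y)) M powr p"
    using ge_one_powr_ge_zero[of 2 p] assms by (intro mult_right_mono) (auto simp: indicator_def)
  finally have "((indicator B x + indicator B y) * min (L * norm (x - y)) M) powr p / norm (x - y) powr (real DIM('a) + t * p)
     \<le> (2 powr p * (indicator B x + indicator B y)) * min (L * norm (x - y)) M powr p / norm (x - y) powr (real DIM('a) + t * p)"
    by (rule divide_right_mono) auto
  then show ?thesis by (simp add: trunc_kernel_def algebra_simps add_divide_distrib)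
qed

lemma frac_quotient_local_bound:
  fixes w :: "'a::euclidean_space \<Rightarrow> real"
  assumes le: "\<bar>w x - w y\<bar> \<le> (indicator B x + indicator B y) * min (L * norm (x - y)) M"
    and "p \<ge> 0" "L \<ge> 0" "M \<ge> 0"
  shows "frac_quotient t p w (x, y) \<le> 2 powr p *
     (indicator B x * trunc_kernel L M p (t * p) (x - y) + indicator B y * trunc_kernel L M p (t * p) (x - y))"
proof -
  have "\<bar>w x - w y\<bar> powr p \<le> ((indicator B x + indicator B y) * min (L * norm (x - y)) M) powr p"
    using assms by (intro powr_mono2) auto
  then have "frac_quotient t p w (x, y)
      \<le> ((indicator B x + indicator B y) * min (L * norm (x - y)) M) powr p / norm (x - y) powr (real DIM('a) + t * p)"
    unfolding frac_quotient_def prod.case by (rule divide_right_mono) simp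
  then show ?thesis using local_kernel_bound[of p L M B x y t] assms(2-4) by linarith
qed

lemma integrable_frac_quotient_local:
  fixes w :: "'a::euclidean_space \<Rightarrow> real"
  assumes "w \<in> borel_measurable borel" and B: "B \<in> sets borel" "bounded B"
    and le: "\<And>x y. \<bar>w x - w y\<bar> \<le> (indicator B x + indicator B y) * min (L * norm (x - y)) M"
    and LM: "L \<ge> 0" "M \<ge> 0" and t: "t > 0" and p: "p \<ge> real DIM('a) + t * p" "p > 0"
  shows "integrable lborel (frac_quotient t p w)"
proof (rule Bochner_Integration.integrable_bound)
  have k: "integrable lborel (trunc_kernel L M p (t * p) :: 'a \<Rightarrow> real)"
    using assms by (intro integrable_trunc_kernel) auto
  show "integrable lborel (\<lambda>q. 2 powr p * ((case q of (x, y) \<Rightarrow> indicator B x * trunc_kernel L M p (t * p) (x - y)) +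
      (case q of (x, y) \<Rightarrow> indicator B y * trunc_kernel L M p (t * p) (x - y))))"
    by (intro integrable_mult_right Bochner_Integration.integrable_add integrable_pair_indicator_diff k B)
  show "AE q in lborel. norm (frac_quotient t p w q) \<le> norm (2 powr p * ((case q of (x, y) \<Rightarrow> indicator B x * trunc_kernel L M p (t * p) (x - y)) +
      (case q of (x, y) \<Rightarrow> indicator B y * trunc_kernel L M p (t * p) (x - y))))"
    using frac_quotient_local_bound[where w = w and B = B and L = L and M = M, OF le _ LM, where p = p and t = t] p
    by (intro AE_I2) (auto simp: frac_quotient_nonneg split: prod.split intro: order_trans[OF _ abs_ge_self])
qed (use borel_measurable_frac_quotient assms in auto)

lemma seminorm_pow_eq_lborel:
  assumes "w \<in> borel_measurable borel"
  shows "seminorm_pow t p w = integral\<^sup>L lborel (frac_quotient t p w)"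
  using borel_measurable_frac_quotient[OF assms, of t p] by (simp add: seminorm_pow_def integral_completion)

text \<open>The density is |x - y|^-N times the p-th power of a Hoelder quotient. A quotient at most
  1 has powers decreasing in p.\<close>

lemma frac_quotient_antimono:
  fixes w :: "'a::euclidean_space \<Rightarrow> real"
  assumes le: "\<bar>w x - w y\<bar> \<le> norm (x - y) powr t" and "p0 \<le> p" "p0 \<ge> 0"
  shows "frac_quotient t p w (x, y) \<le> frac_quotient t p0 w (x, y)"
proof (cases "x = y")
  case False
  let ?d = "\<bar>w x - w y\<bar>" and ?n = "norm (x - y)"
  have "?d powr p = ?d powr p0 * ?d powr (p - p0)" by (simp flip: powr_add)
  also have "\<dots> \<le> ?d powr p0 * (?n powr t) powr (p - p0)"
    using assms by (intro mult_left_mono powr_mono2) auto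
  finally have "?d powr p \<le> ?d powr p0 * ?n powr (t * (p - p0))" by (simp add: powr_powr)
  moreover have "?n powr (real DIM('a) + t * p) = ?n powr (real DIM('a) + t * p0) * ?n powr (t * (p - p0))"
    by (simp add: algebra_simps flip: powr_add)
  ultimately show ?thesis using False by (simp add: frac_quotient_def field_simps)
qed (simp add: frac_quotient_def)

text \<open>After scaling by \<open>a\<close>, with q = b / a, it reads 1 - q^t <= 1 - q <= (1 -
  q)^t on the unit interval.\<close>

lemma powr_diff_le_powr:
  fixes a b :: real
  assumes "0 \<le> b" "b \<le> a" "0 < t" "t \<le> 1"
  shows "a powr t - b powr t \<le> (a - b) powr t"
proof (cases "a = 0")
  case False
  then have a: "a > 0" using assms by linarith
  define q where "q = b / a"
  have q: "0 \<le> q" "q \<le> 1" "b = a * q" using a assms by (auto simp: q_def)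
  have 1: "q \<le> q powr t" and 2: "1 - q \<le> (1 - q) powr t"
    using q assms powr_mono'[of t 1 q] powr_mono'[of t 1 "1 - q"] by auto
  have "a powr t - b powr t = a powr t * (1 - q powr t)"
    using q a by (simp add: powr_mult algebra_simps)
  also have "\<dots> \<le> a powr t * (1 - q) powr t" using 1 2 by (intro mult_left_mono) auto
  also have "\<dots> = (a - b) powr t" using q a by (simp add: powr_mult[symmetric] algebra_simps)
  finally show ?thesis .
qed (use assms in auto)

lemma powr_diff_le_linear:
  fixes a b :: real
  assumes "0 < e" "e \<le> b" "b \<le> a" "0 < t" "t \<le> 1"
  shows "a powr t - b powr t \<le> e powr (t - 1) * (a - b)"
proof -
  have "a powr t = a * a powr (t - 1)" using assms by (simp add: powr_mult_base)
  also have "\<dots> \<le> a * b powr (t - 1)" using assms by (intro mult_left_mono powr_mono2') auto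
  finally have "a powr t - b powr t \<le> a * b powr (t - 1) - b * b powr (t - 1)"
    using assms by (simp add: powr_mult_base)
  also have "\<dots> = b powr (t - 1) * (a - b)" by (simp add: algebra_simps)
  also have "\<dots> \<le> e powr (t - 1) * (a - b)"
    using assms by (intro mult_right_mono powr_mono2') auto
  finally show ?thesis .
qed

lemma real_DIM_ge_1: "real DIM('a::euclidean_space) \<ge> 1"
  by (simp add: Suc_leI)

text \<open>The full cone R^t - |x - x0|^t has Hoelder constant 1 and vanishes on the sphere of
  radius \<open>R\<close>. Flattening it on the ball of radius \<open>e\<close> lowers the top by
  e^t, but makes it Lipschitz with constant e^(t-1) and constant on a set of positive
  measure.\<close>

definition trunc_cone :: "'a::euclidean_space \<Rightarrow> real \<Rightarrow> real \<Rightarrow> real \<Rightarrow> 'a \<Rightarrow> real" where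
  "trunc_cone x0 R e t x = max 0 (R powr t - max (norm (x - x0)) e powr t)"

context
  fixes x0 :: "'a::euclidean_space" and R e t :: real
  assumes t: "0 < t" "t < 1" and e: "0 < e" "e < R"
begin

lemma trunc_cone_outside:
  assumes "x \<notin> ball x0 R"
  shows "trunc_cone x0 R e t x = 0"
proof -
  have "R powr t \<le> max (norm (x - x0)) e powr t"
    using assms t e by (intro powr_mono2) (auto simp: dist_norm norm_minus_commute)
  then show ?thesis by (simp add: trunc_cone_def)
qed

lemma trunc_cone_inside: "x \<in> ball x0 e \<Longrightarrow> trunc_cone x0 R e t x = R powr t - e powr t"
  using t e by (auto simp: trunc_cone_def dist_norm norm_minus_commute max_def powr_mono2)

lemma trunc_cone_pos: "R powr t - e powr t > 0"
  using t e by (simp add: powr_less_mono2)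

lemma trunc_cone_bounds: "0 \<le> trunc_cone x0 R e t x" "trunc_cone x0 R e t x \<le> R powr t"
  by (auto simp: trunc_cone_def)

lemma continuous_trunc_cone: "continuous_on UNIV (trunc_cone x0 R e t)"
  unfolding trunc_cone_def using t e by (intro continuous_intros continuous_on_max) auto

lemma trunc_cone_holder: "\<bar>trunc_cone x0 R e t x - trunc_cone x0 R e t y\<bar> \<le> norm (x - y) powr t"
  and trunc_cone_lipschitz: "\<bar>trunc_cone x0 R e t x - trunc_cone x0 R e t y\<bar> \<le> e powr (t - 1) * norm (x - y)"
proof -
  \<comment> \<open>By symmetry \<open>y\<close> may be taken to be the point nearer to the centre.
    Both bounds then concern only the radii cut off below at \<open>e\<close>, whose difference is
    at most |x - y|.\<close>
  have *: "\<bar>trunc_cone x0 R e t x - trunc_cone x0 R e t y\<bar> \<le> norm (x - y) powr t \<and>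
      \<bar>trunc_cone x0 R e t x - trunc_cone x0 R e t y\<bar> \<le> e powr (t - 1) * norm (x - y)"
    if le: "norm (y - x0) \<le> norm (x - x0)" for x y
  proof -
    define a where "a = max (norm (x - x0)) e"
    define b where "b = max (norm (y - x0)) e"
    have ab: "e \<le> b" "b \<le> a" "0 \<le> b" using le e by (auto simp: a_def b_def)
    have "norm (x - x0) - norm (y - x0) \<le> norm (x - y)"
      using norm_triangle_ineq2[of "x - x0" "y - x0"] by simp
    then have d: "a - b \<le> norm (x - y)" unfolding a_def b_def max_def using norm_ge_zero[of "x - y"] by (smt (verit))
    have "b powr t \<le> a powr t" using ab t by (intro powr_mono2) auto
    then have 1: "\<bar>trunc_cone x0 R e t x - trunc_cone x0 R e t y\<bar> \<le> a powr t - b powr t"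
      unfolding trunc_cone_def a_def[symmetric] b_def[symmetric] by (auto simp: max_def)
    have "a powr t - b powr t \<le> (a - b) powr t" using ab t by (intro powr_diff_le_powr) auto
    also have "\<dots> \<le> norm (x - y) powr t" using ab d t by (intro powr_mono2) auto
    finally have 2: "a powr t - b powr t \<le> norm (x - y) powr t" .
    have "a powr t - b powr t \<le> e powr (t - 1) * (a - b)" using ab t e by (intro powr_diff_le_linear) auto
    also have "\<dots> \<le> e powr (t - 1) * norm (x - y)" using d by (intro mult_left_mono) auto
    finally show ?thesis using 1 2 by linarith
  qed
  show "\<bar>trunc_cone x0 R e t x - trunc_cone x0 R e t y\<bar> \<le> norm (x - y) powr t"
    "\<bar>trunc_cone x0 R e t x - trunc_cone x0 R e t y\<bar> \<le> e powr (t - 1) * norm (x - y)"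
    using *[of y x] *[of x y] by (auto simp: norm_minus_commute abs_minus_commute intro: linorder_le_cases[of "norm (y - x0)" "norm (x - x0)"])
qed

lemma trunc_cone_local:
  "\<bar>trunc_cone x0 R e t x - trunc_cone x0 R e t y\<bar> \<le>
     (indicator (ball x0 R) x + indicator (ball x0 R) y) * min (e powr (t - 1) * norm (x - y)) (R powr t)"
proof (cases "x \<in> ball x0 R \<or> y \<in> ball x0 R")
  case True
  have m: "\<bar>trunc_cone x0 R e t x - trunc_cone x0 R e t y\<bar> \<le> min (e powr (t - 1) * norm (x - y)) (R powr t)"
    using trunc_cone_lipschitz[of x y] trunc_cone_bounds[of x] trunc_cone_bounds[of y] by auto
  have "min (e powr (t - 1) * norm (x - y)) (R powr t) \<le>
     (indicator (ball x0 R) x + indicator (ball x0 R) y) * min (e powr (t - 1) * norm (x - y)) (R powr t)"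
    using True by (auto simp: indicator_def)
  from order_trans[OF m this] show ?thesis .
qed (auto simp: trunc_cone_outside)

lemma integrable_frac_quotient_trunc_cone:
  assumes "p \<ge> real DIM('a) + t * p"
  shows "integrable lborel (frac_quotient t p (trunc_cone x0 R e t))"
proof (rule integrable_frac_quotient_local[OF _ _ _ trunc_cone_local])
  have "(1 - t) * p = p - t * p" by (simp add: algebra_simps)
  then have "(1 - t) * p \<ge> 1" using assms(1) real_DIM_ge_1[where 'a='a] by linarith
  then show "p > 0" using t by (smt (verit) zero_less_mult_iff)
  show "trunc_cone x0 R e t \<in> borel_measurable borel"
    by (rule borel_measurable_continuous_onI[OF continuous_trunc_cone])
qed (use t e assms in auto)

lemma seminorm_pow_trunc_cone_antimono:
  assumes "p0 \<ge> real DIM('a) + t * p0" "p \<ge> real DIM('a) + t * p" "p0 \<le> p" "p0 \<ge> 0"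
  shows "seminorm_pow t p (trunc_cone x0 R e t) \<le> seminorm_pow t p0 (trunc_cone x0 R e t)"
proof -
  have "trunc_cone x0 R e t \<in> borel_measurable borel"
    by (rule borel_measurable_continuous_onI[OF continuous_trunc_cone])
  then show ?thesis
    using assms frac_quotient_antimono[where w = "trunc_cone x0 R e t", OF trunc_cone_holder assms(3,4)]
    by (simp add: seminorm_pow_eq_lborel) (intro integral_mono integrable_frac_quotient_trunc_cone, auto)
qed

lemma trunc_cone_W_tilde:
  assumes "p \<ge> real DIM('a) + t * p" "open \<Omega>" "bounded \<Omega>" "ball x0 R \<subseteq> \<Omega>"
  shows "trunc_cone x0 R e t \<in> W_tilde t p \<Omega>"
proof (rule W_tilde_continuousI)
  have "(1 - t) * p = p - t * p" by (simp add: algebra_simps)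
  then have "(1 - t) * p \<ge> 1" using assms(1) real_DIM_ge_1[where 'a='a] by linarith
  then show "p > 0" using t by (smt (verit) zero_less_mult_iff)
  show "trunc_cone x0 R e t x = 0" if "x \<notin> \<Omega>" for x
    using that assms by (intro trunc_cone_outside) auto
qed (use assms continuous_trunc_cone integrable_frac_quotient_trunc_cone in auto)

end

text \<open>\<open>C\<close> does not depend on p: the seminorm powers are bounded by their values
  at \<open>p0\<close>, and the coupling is bounded below on the ball where both cones are
  flat.\<close>

lemma lambda1_le_trunc_cone:
  fixes \<Omega> :: "'a::euclidean_space set"
  assumes \<Omega>: "open \<Omega>" "bounded \<Omega>" "ball x0 R \<subseteq> \<Omega>" and r: "0 < r" "r < 1" and s: "0 < s" "s < 1"
    and e: "0 < e" "e < R"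
  shows "\<exists>p0 C. C > 0 \<and> (\<forall>p \<alpha> \<beta>. p \<ge> p0 \<longrightarrow> \<alpha> > 0 \<longrightarrow> \<beta> > 0 \<longrightarrow>
     lambda1 \<Omega> r s p \<alpha> \<beta> \<le> C / ((R powr r - e powr r) powr \<alpha> * (R powr s - e powr s) powr \<beta>))"
proof -
  let ?N = "real DIM('a)"
  \<comment> \<open>The threshold where (1 - t) p >= N for t = r and t = s, so that the truncated
    cones have finite seminorms.\<close>
  define p0 where "p0 = max (?N / (1 - r)) (?N / (1 - s))"
  have p0: "p \<ge> ?N + r * p" "p \<ge> ?N + s * p" "p \<ge> 0" if "p \<ge> p0" for p
  proof -
    have "?N / (1 - r) \<le> p" "?N / (1 - s) \<le> p" using that by (auto simp: p0_def)
    then show "p \<ge> ?N + r * p" "p \<ge> ?N + s * p" using r s by (auto simp: field_simps)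
    have "0 \<le> ?N / (1 - r)" using r by simp
    then show "p \<ge> 0" using \<open>?N / (1 - r) \<le> p\<close> by linarith
  qed
  define u where "u = trunc_cone x0 R e r"
  define v where "v = trunc_cone x0 R e s"
  define a where "a = R powr r - e powr r"
  define b where "b = R powr s - e powr s"
  have ab: "a > 0" "b > 0" using trunc_cone_pos[of r e R] trunc_cone_pos[of s e R] r s e by (auto simp: a_def b_def)
  have m: "measure lborel (ball x0 e) > 0" using e by (simp add: content_ball)
  define S where "S = seminorm_pow r p0 u + seminorm_pow s p0 v"
  have S0: "S \<ge> 0" by (auto simp: S_def seminorm_pow_def frac_quotient_nonneg intro!: add_nonneg_nonneg Bochner_Integration.integral_nonneg)
  have bd: "bdd_below {(seminorm_pow r p u + seminorm_pow s p v) / coupling \<Omega> \<alpha> \<beta> u v | u v.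
            admissible \<Omega> r s p u v}" for p \<alpha> \<beta>
    by (intro bdd_belowI[of _ 0])
      (auto simp: seminorm_pow_def coupling_def frac_quotient_nonneg
        intro!: divide_nonneg_nonneg add_nonneg_nonneg Bochner_Integration.integral_nonneg)
  have [measurable]: "u \<in> borel_measurable borel" "v \<in> borel_measurable borel"
    unfolding u_def v_def using continuous_trunc_cone r s e by (auto intro!: borel_measurable_continuous_onI)
  have bounds: "0 \<le> u x" "u x \<le> R powr r" "0 \<le> v x" "v x \<le> R powr s" for x
    unfolding u_def v_def using trunc_cone_bounds[OF r e] trunc_cone_bounds[OF s e] by auto
  \<comment> \<open>The summand 1 keeps the constant positive, as is needed for the limit of its
    p-th root.\<close>
  have "lambda1 \<Omega> r s p \<alpha> \<beta> \<le> (S + 1) / measure lborel (ball x0 e) / (a powr \<alpha> * b powr \<beta>)"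
    if p: "p \<ge> p0" and \<alpha>: "\<alpha> > 0" and \<beta>: "\<beta> > 0" for p \<alpha> \<beta>
  proof -
    have uW: "u \<in> W_tilde r p \<Omega>" "v \<in> W_tilde s p \<Omega>"
      unfolding u_def v_def using p0[OF p] r s e \<Omega> by (auto intro!: trunc_cone_W_tilde)
    have "coupling \<Omega> \<alpha> \<beta> u v = (\<integral>x. indicator \<Omega> x * (\<bar>u x\<bar> powr \<alpha> * \<bar>v x\<bar> powr \<beta>) \<partial>lborel)"
      unfolding coupling_def by (rule integral_lebesgue_on_eq_lborel) (use \<Omega> in auto)
    also have "\<dots> \<ge> (\<integral>x. indicator (ball x0 e) x * (a powr \<alpha> * b powr \<beta>) \<partial>lborel)"
    proof (rule integral_mono)
      show "integrable lborel (\<lambda>x. indicator (ball x0 e) x * (a powr \<alpha> * b powr \<beta>))"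
        by (intro integrable_indicator_bounded[where K = "a powr \<alpha> * b powr \<beta>"]) auto
      have "\<bar>\<bar>u x\<bar> powr \<alpha> * \<bar>v x\<bar> powr \<beta>\<bar> \<le> (R powr r) powr \<alpha> * (R powr s) powr \<beta>" for x
        using bounds[of x] \<alpha> \<beta> by (auto simp: abs_mult intro!: mult_mono powr_mono2)
      then show "integrable lborel (\<lambda>x. indicator \<Omega> x * (\<bar>u x\<bar> powr \<alpha> * \<bar>v x\<bar> powr \<beta>))"
        using \<Omega> by (intro integrable_indicator_bounded[where K = "(R powr r) powr \<alpha> * (R powr s) powr \<beta>"]) auto
      show "indicator (ball x0 e) x * (a powr \<alpha> * b powr \<beta>) \<le> indicator \<Omega> x * (\<bar>u x\<bar> powr \<alpha> * \<bar>v x\<bar> powr \<beta>)" for x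
      proof (cases "x \<in> ball x0 e")
        case True
        then have "x \<in> \<Omega>" using \<Omega>(3) e by auto
        moreover have "u x = a" "v x = b"
          unfolding u_def v_def a_def b_def using True r s e by (auto intro!: trunc_cone_inside)
        ultimately show ?thesis using True ab by simp
      qed simp
    qed
    finally have coup: "measure lborel (ball x0 e) * (a powr \<alpha> * b powr \<beta>) \<le> coupling \<Omega> \<alpha> \<beta> u v"
      using m by simp
    have cpos: "measure lborel (ball x0 e) * (a powr \<alpha> * b powr \<beta>) > 0" using m ab by auto
    have adm: "admissible \<Omega> r s p u v"
      unfolding admissible_def
    proof (intro conjI uW notI)
      assume "AE x in lebesgue_on \<Omega>. u x * v x = 0"
      then have "AE x in lebesgue_on \<Omega>. \<bar>u x\<bar> powr \<alpha> * \<bar>v x\<bar> powr \<beta> = 0" by eventually_elim auto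
      then have "coupling \<Omega> \<alpha> \<beta> u v = 0" unfolding coupling_def by (rule integral_eq_zero_AE)
      then show False using coup cpos by simp
    qed
    have "lambda1 \<Omega> r s p \<alpha> \<beta> \<le> (seminorm_pow r p u + seminorm_pow s p v) / coupling \<Omega> \<alpha> \<beta> u v"
      unfolding lambda1_def using adm by (intro cInf_lower bd) auto
    also have "\<dots> \<le> (S + 1) / (measure lborel (ball x0 e) * (a powr \<alpha> * b powr \<beta>))"
    proof (rule frac_le)
      have "seminorm_pow r p u \<le> seminorm_pow r p0 u" "seminorm_pow s p v \<le> seminorm_pow s p0 v"
        unfolding u_def v_def using p0[OF p] p0[OF order_refl] p r s e by (auto intro!: seminorm_pow_trunc_cone_antimono)
      then show "seminorm_pow r p u + seminorm_pow s p v \<le> S + 1" by (simp add: S_def)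
    qed (use S0 coup cpos in auto)
    finally show ?thesis by simp
  qed
  then show ?thesis unfolding a_def b_def
    using S0 m by (intro exI[of _ p0] exI[of _ "(S + 1) / measure lborel (ball x0 e)"] conjI) auto
qed

section \<open>The domain and the limit quotient\<close>

lemma open_AE_notin_empty:
  fixes S :: "'a::euclidean_space set"
  assumes "open S" "AE x in lebesgue. x \<notin> S"
  shows "S = {}"
proof -
  have S: "S \<in> sets borel" using assms(1) by simp
  then have "emeasure lborel S = 0"
    using assms(2) AE_iff_measurable[of S lborel "\<lambda>x. x \<notin> S"] by (simp add: AE_completion_iff)
  then have "negligible S" using S by (simp add: negligible_iff_emeasure0)
  then show ?thesis using assms(1) open_not_negligible by blast
qed

text \<open>The set where the inequality fails is open by continuity, and a null open set is
  empty.\<close>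

lemma AE_le_imp_le_on_open:
  fixes f :: "'a::euclidean_space \<Rightarrow> real"
  assumes "open S" "continuous_on S f" "AE x in lebesgue_on S. f x \<le> c" "x \<in> S"
  shows "f x \<le> c"
proof -
  have o: "open (S \<inter> f -` {c<..})"
    using continuous_open_preimage[OF assms(2,1), of "{c<..}"] by simp
  have "S \<in> sets lebesgue" using assms(1) by (auto intro!: borel_open sets_completionI_sets)
  then have "AE x in lebesgue. x \<in> S \<longrightarrow> f x \<le> c" using assms(3) by (simp add: AE_restrict_space_iff)
  then have "AE x in lebesgue. x \<notin> S \<inter> f -` {c<..}" by eventually_elim auto
  with open_AE_notin_empty[OF o] assms(4) show ?thesis by force
qed

lemma Linf_norm_le:
  assumes "\<And>x. x \<in> \<Omega> \<Longrightarrow> \<bar>f x\<bar> \<le> K" "K \<ge> 0" "f \<in> borel_measurable (lebesgue_on \<Omega>)"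
  shows "Linf_norm \<Omega> f \<le> K"
proof -
  have "esssup (lebesgue_on \<Omega>) (\<lambda>x. ereal \<bar>f x\<bar>) \<le> ereal K"
    using assms by (intro esssup_I) (auto simp: space_restrict_space intro!: AE_I2)
  \<comment> \<open>If the essential supremum is minus infinity, \<open>real_of_ereal\<close>
    returns 0, which K >= 0 covers.\<close>
  then show ?thesis unfolding Linf_norm_def using assms(2)
    by (cases "esssup (lebesgue_on \<Omega>) (\<lambda>x. ereal \<bar>f x\<bar>)") auto
qed

text \<open>The bound \<open>K\<close> excludes the value plus infinity, which
  \<open>real_of_ereal\<close> would send to 0.\<close>

lemma le_Linf_norm:
  fixes f :: "'a::euclidean_space \<Rightarrow> real"
  assumes "open \<Omega>" "continuous_on \<Omega> f" "\<And>x. x \<in> \<Omega> \<Longrightarrow> \<bar>f x\<bar> \<le> K" "x \<in> \<Omega>"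
  shows "\<bar>f x\<bar> \<le> Linf_norm \<Omega> f"
proof -
  let ?L = "esssup (lebesgue_on \<Omega>) (\<lambda>x. ereal \<bar>f x\<bar>)"
  have \<Omega>: "\<Omega> \<in> sets lebesgue" using assms(1) by (auto intro!: borel_open sets_completionI_sets)
  have "f \<in> borel_measurable (lebesgue_on \<Omega>)"
    by (rule continuous_imp_measurable_on_sets_lebesgue[OF assms(2) \<Omega>])
  then have "?L \<le> ereal K"
    using assms by (intro esssup_I) (auto simp: space_restrict_space intro!: AE_I2)
  moreover have "AE x in lebesgue_on \<Omega>. ereal \<bar>f x\<bar> \<le> ?L" by (rule esssup_AE)
  ultimately have "AE x in lebesgue_on \<Omega>. \<bar>f x\<bar> \<le> real_of_ereal ?L"
    by (cases ?L) auto
  then show ?thesis unfolding Linf_norm_def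
    by (rule AE_le_imp_le_on_open[OF assms(1) _ _ assms(4), rotated]) (intro continuous_intros assms(2))
qed

section \<open>Geometry of the domain and bounds for the limit quotient\<close>

context
  fixes \<Omega> :: "'a::euclidean_space set"
  assumes dom: "bounded_smooth_domain \<Omega>"
begin

lemma domain_basic: "open \<Omega>" "bounded \<Omega>" "\<Omega> \<noteq> {}" "smooth_boundary \<Omega>"
  using dom by (auto simp: bounded_smooth_domain_def)

lemma frontier_nonempty: "frontier \<Omega> \<noteq> {}"
proof
  assume "frontier \<Omega> = {}"
  then have "\<Omega> = {} \<or> \<Omega> = UNIV" by (rule frontier_eq_empty[THEN iffD1])
  then show False using domain_basic by auto
qed

lemma frontier_disjoint: "x \<in> \<Omega> \<Longrightarrow> x \<notin> frontier \<Omega>"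
  using domain_basic(1) by (simp add: frontier_def interior_open)

text \<open>A ball is connected: if it met both \<Omega> and its complement it would meet the
  boundary, at a distance smaller than the distance to the boundary.\<close>

lemma ball_infdist_subset: "x \<in> \<Omega> \<Longrightarrow> ball x (infdist x (frontier \<Omega>)) \<subseteq> \<Omega>"
proof (rule ccontr)
  assume x: "x \<in> \<Omega>" and "\<not> ball x (infdist x (frontier \<Omega>)) \<subseteq> \<Omega>"
  then have ne: "ball x (infdist x (frontier \<Omega>)) - \<Omega> \<noteq> {}" by auto
  have "infdist x (frontier \<Omega>) > 0"
    using frontier_disjoint[OF x] frontier_nonempty by (intro infdist_pos_not_in_closed) auto
  then have "x \<in> ball x (infdist x (frontier \<Omega>)) \<inter> \<Omega>" using x by simp
  then have "ball x (infdist x (frontier \<Omega>)) \<inter> \<Omega> \<noteq> {}" by blast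
  then have "ball x (infdist x (frontier \<Omega>)) \<inter> frontier \<Omega> \<noteq> {}"
    using ne by (intro connected_Int_frontier) (auto)
  then obtain y where "y \<in> frontier \<Omega>" "dist x y < infdist x (frontier \<Omega>)" by auto
  then show False using infdist_le[of y "frontier \<Omega>" x] by simp
qed

lemma inradius_ball:
  obtains x where "x \<in> \<Omega>" "ball x (inradius \<Omega>) \<subseteq> \<Omega>" "inradius \<Omega> > 0"
proof -
  obtain x where x: "x \<in> \<Omega>" "infdist x (frontier \<Omega>) = inradius \<Omega>"
    using inradius_attained[OF domain_basic(1-3)] by auto
  moreover have "infdist x (frontier \<Omega>) > 0"
    using frontier_disjoint[OF x(1)] frontier_nonempty by (intro infdist_pos_not_in_closed) auto
  ultimately show ?thesis using that ball_infdist_subset by metis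
qed

lemma infdist_le_inradius: "x \<in> \<Omega> \<Longrightarrow> infdist x (frontier \<Omega>) \<le> inradius \<Omega>"
  using inradius_attained[OF domain_basic(1-3)] by auto

text \<open>This fails for a punctured ball, whose puncture is far from the exterior. For a smooth
  boundary the open region below the local graph misses \<Omega>, and moving against
  \<open>e\<close> reaches it.\<close>

lemma complement_subset_closure_exterior: "- \<Omega> \<subseteq> closure (- closure \<Omega>)"
proof
  fix x assume x: "x \<in> - \<Omega>"
  show "x \<in> closure (- closure \<Omega>)"
  proof (cases "x \<in> closure \<Omega>")
    case True
    with x have "x \<in> frontier \<Omega>" using domain_basic(1) by (simp add: frontier_def interior_open)
    then obtain \<rho> e \<gamma> where \<rho>: "\<rho> > 0" and e: "norm e = 1" and sm: "smooth \<gamma>"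
      and inv: "\<And>x t. \<gamma> (x + t *\<^sub>R e) = \<gamma> x" and eq: "\<Omega> \<inter> ball x \<rho> = {y \<in> ball x \<rho>. \<gamma> y < y \<bullet> e}"
      using domain_basic(4)[unfolded smooth_boundary_def, rule_format, of x] by blast
    have "Ck 0 \<gamma>" using sm unfolding smooth_def by blast
    then have cont: "continuous_on UNIV \<gamma>" by simp
    define O' where "O' = ball x \<rho> \<inter> {y. y \<bullet> e < \<gamma> y}"
    have "open O'"
      unfolding O'_def by (intro open_Int open_ball open_Collect_less continuous_intros cont)
    moreover have "O' \<inter> \<Omega> = {}" using eq unfolding O'_def by force
    ultimately have O': "O' \<subseteq> - closure \<Omega>" by (metis disjoint_eq_subset_Compl open_Int_closure_eq_empty)
    \<comment> \<open>A boundary point is not in the open set \<Omega>, so it is not above the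
      graph. A shift along \<open>e\<close> keeps \<gamma> and changes only the height.\<close>
    have ge: "x \<bullet> e \<le> \<gamma> x" using eq x \<rho> by force
    show ?thesis unfolding closure_approachable
    proof (intro allI impI)
      fix d :: real assume d: "d > 0"
      define \<tau> where "\<tau> = min d \<rho> / 2"
      have \<tau>: "0 < \<tau>" "\<tau> < d" "\<tau> < \<rho>" using d \<rho> by (auto simp: \<tau>_def min_def)
      define y where "y = x + (- \<tau>) *\<^sub>R e"
      have "dist x y = \<tau>" using \<tau> e by (simp add: y_def dist_norm)
      moreover have "\<gamma> y = \<gamma> x" unfolding y_def by (rule inv)
      moreover have "y \<bullet> e = x \<bullet> e - \<tau>" using e by (simp add: y_def inner_diff_left dot_square_norm)
      ultimately have "y \<in> O'" "dist y x < d" using ge \<tau> by (auto simp: O'_def dist_commute)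
      then show "\<exists>y\<in>- closure \<Omega>. dist y x < d" using O' by blast
    qed
  next
    case False
    then show ?thesis using closure_subset by blast
  qed
qed

text \<open>Equality almost everywhere says nothing directly about the boundary. It gives zero on
  the open exterior, and continuity extends this to the closure of the exterior, hence to the
  complement of \<Omega>.\<close>

lemma continuous_representative_zero_outside:
  assumes U: "continuous_representative u U" and u: "\<And>x. x \<notin> \<Omega> \<Longrightarrow> u x = 0" and x: "x \<notin> \<Omega>"
  shows "U x = 0"
proof -
  have cont: "continuous_on UNIV U" and ae: "AE x in lebesgue. U x = u x"
    using U by (auto simp: continuous_representative_def)
  define S where "S = - closure \<Omega> \<inter> U -` (- {0})"
  have "open S" unfolding S_def using cont
    by (intro continuous_open_preimage) (auto intro: continuous_on_subset)
  moreover have "AE x in lebesgue. x \<notin> S"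
    using ae by eventually_elim (use u closure_subset[of \<Omega>] in \<open>auto simp: S_def\<close>)
  ultimately have "S = {}" by (rule open_AE_notin_empty)
  then have "- closure \<Omega> \<subseteq> U -` {0}" unfolding S_def by auto
  moreover have "closed (U -` {0})" using cont by (intro closed_vimage) (auto simp: continuous_on_eq_continuous_at)
  ultimately have "closure (- closure \<Omega>) \<subseteq> U -` {0}" by (rule closure_minimal)
  then show ?thesis using complement_subset_closure_exterior x by blast
qed

lemma holder_seminorm_bound:
  assumes "bdd_above (holder_quotients t \<Omega> w)" "x \<in> closure \<Omega>" "y \<in> closure \<Omega>"
  shows "\<bar>w y - w x\<bar> \<le> holder_seminorm t \<Omega> w * norm (x - y) powr t"
proof (cases "x = y")
  case False
  then have "\<bar>w y - w x\<bar> / norm (x - y) powr t \<le> holder_seminorm t \<Omega> w"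
    unfolding holder_seminorm_def using assms
    by (intro cSup_upper) (auto simp: holder_quotients_def)
  then show ?thesis using False by (simp add: divide_le_eq)
qed simp

text \<open>Compare with a nearest boundary point, where the function vanishes.\<close>

lemma W_tilde_inf_bound:
  assumes w: "w \<in> W_tilde_inf t \<Omega>" and x: "x \<in> \<Omega>"
  shows "\<bar>w x\<bar> \<le> holder_seminorm t \<Omega> w * infdist x (frontier \<Omega>) powr t"
proof -
  obtain y where y: "y \<in> frontier \<Omega>" "infdist x (frontier \<Omega>) = dist x y"
    using infdist_attains_inf[OF _ frontier_nonempty] by auto
  have "w y = 0" using w y by (simp add: W_tilde_inf_def C0_closure_def)
  moreover have "x \<in> closure \<Omega>" "y \<in> closure \<Omega>"
    using x y closure_subset by (auto simp: frontier_def)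
  ultimately show ?thesis
    using holder_seminorm_bound[of t w x y] w y(2)
    by (simp add: W_tilde_inf_def dist_norm)
qed

text \<open>All three parts rest on one pointwise bound of \<open>F\<close> by M R^\<kappa>. It
  gives the quotient estimate, and it makes the essential supremum finite, so that by continuity it
  bounds \<open>F\<close> at every point.\<close>

lemma inradius_le_quotient_inf:
  assumes \<Gamma>: "0 < \<Gamma>" "\<Gamma> < 1" and rs: "0 < r" "0 < s" and adm: "admissible_inf \<Omega> r s u v"
  shows "(1 / inradius \<Omega>) powr ((1 - \<Gamma>) * s + \<Gamma> * r) \<le> quotient_inf \<Omega> r s \<Gamma> u v"
    and "Linf_norm \<Omega> (\<lambda>x. \<bar>u x\<bar> powr \<Gamma> * \<bar>v x\<bar> powr (1 - \<Gamma>)) > 0"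
    and "x \<in> \<Omega> \<Longrightarrow> \<bar>u x\<bar> powr \<Gamma> * \<bar>v x\<bar> powr (1 - \<Gamma>) \<le> Linf_norm \<Omega> (\<lambda>x. \<bar>u x\<bar> powr \<Gamma> * \<bar>v x\<bar> powr (1 - \<Gamma>))"
proof -
  define F where "F = (\<lambda>x. \<bar>u x\<bar> powr \<Gamma> * \<bar>v x\<bar> powr (1 - \<Gamma>))"
  define \<kappa> where "\<kappa> = (1 - \<Gamma>) * s + \<Gamma> * r"
  define R where "R = inradius \<Omega>"
  define M where "M = max (holder_seminorm r \<Omega> u) (holder_seminorm s \<Omega> v)"
  have R: "R > 0" using inradius_ball unfolding R_def by metis
  have \<kappa>: "\<kappa> > 0" using \<Gamma> rs by (simp add: \<kappa>_def add_pos_pos)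
  have uv: "u \<in> W_tilde_inf r \<Omega>" "v \<in> W_tilde_inf s \<Omega>" using adm by (auto simp: admissible_inf_def)
  obtain x0 where x0: "x0 \<in> \<Omega>" "u x0 \<noteq> 0" "v x0 \<noteq> 0" using adm by (auto simp: admissible_inf_def)
  have dpos: "infdist x (frontier \<Omega>) \<ge> 0" for x by (rule infdist_nonneg)
  have "0 < holder_seminorm r \<Omega> u * infdist x0 (frontier \<Omega>) powr r"
    using W_tilde_inf_bound[OF uv(1) x0(1)] x0 by linarith
  then have M: "M > 0" unfolding M_def by (smt (verit) powr_ge_zero zero_less_mult_iff)
  have F: "F x \<le> M * R powr \<kappa>" if x: "x \<in> \<Omega>" for x
  proof -
    let ?d = "infdist x (frontier \<Omega>)"
    have "\<bar>u x\<bar> \<le> M * ?d powr r"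
      using W_tilde_inf_bound[OF uv(1) x] by (rule order_trans) (intro mult_right_mono, auto simp: M_def)
    moreover have "\<bar>v x\<bar> \<le> M * ?d powr s"
      using W_tilde_inf_bound[OF uv(2) x] by (rule order_trans) (intro mult_right_mono, auto simp: M_def)
    ultimately have "F x \<le> (M * ?d powr r) powr \<Gamma> * (M * ?d powr s) powr (1 - \<Gamma>)"
      unfolding F_def using \<Gamma> by (intro mult_mono powr_mono2) auto
    \<comment> \<open>The weights \<Gamma> and 1 - \<Gamma> add up to 1, so the constants recombine
      to \<open>M\<close>; the distances produce the exponent \<kappa>.\<close>
    also have "\<dots> = (M powr \<Gamma> * M powr (1 - \<Gamma>)) * (?d powr (r * \<Gamma>) * ?d powr (s * (1 - \<Gamma>)))"
      using M by (simp add: powr_mult powr_powr)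
    also have "M powr \<Gamma> * M powr (1 - \<Gamma>) = M" using M by (simp flip: powr_add)
    also have "?d powr (r * \<Gamma>) * ?d powr (s * (1 - \<Gamma>)) = ?d powr \<kappa>"
      by (simp add: \<kappa>_def mult.commute add.commute flip: powr_add)
    also have "M * ?d powr \<kappa> \<le> M * R powr \<kappa>"
      using M \<kappa> infdist_le_inradius[OF x] dpos unfolding R_def by (intro mult_left_mono powr_mono2) auto
    finally show ?thesis .
  qed
  have Fnn: "F x \<ge> 0" for x by (simp add: F_def)
  have "continuous_on (closure \<Omega>) u" "continuous_on (closure \<Omega>) v"
    using uv by (auto simp: W_tilde_inf_def C0_closure_def)
  then have "continuous_on \<Omega> u" "continuous_on \<Omega> v" using closure_subset continuous_on_subset by blast+
  then have cF: "continuous_on \<Omega> F"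
    unfolding F_def using \<Gamma> by (intro continuous_intros continuous_on_powr') auto
  have mF: "F \<in> borel_measurable (lebesgue_on \<Omega>)"
    using domain_basic(1) cF by (intro continuous_imp_measurable_on_sets_lebesgue) (auto intro!: borel_open sets_completionI_sets)
  have Lge: "F x \<le> Linf_norm \<Omega> F" if "x \<in> \<Omega>" for x
    using le_Linf_norm[OF domain_basic(1) cF _ that, of "M * R powr \<kappa>"] F Fnn by simp
  then show "x \<in> \<Omega> \<Longrightarrow> \<bar>u x\<bar> powr \<Gamma> * \<bar>v x\<bar> powr (1 - \<Gamma>) \<le> Linf_norm \<Omega> (\<lambda>x. \<bar>u x\<bar> powr \<Gamma> * \<bar>v x\<bar> powr (1 - \<Gamma>))"
    unfolding F_def .
  have "F x0 > 0" using x0 by (simp add: F_def)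
  then have L: "Linf_norm \<Omega> F > 0" using Lge[OF x0(1)] by linarith
  then show "Linf_norm \<Omega> (\<lambda>x. \<bar>u x\<bar> powr \<Gamma> * \<bar>v x\<bar> powr (1 - \<Gamma>)) > 0" unfolding F_def .
  have Lle: "Linf_norm \<Omega> F \<le> M * R powr \<kappa>"
    using F Fnn M mF by (intro Linf_norm_le) auto
  have "(1 / R) powr \<kappa> = 1 / R powr \<kappa>" using R by (simp add: powr_divide)
  also have "\<dots> \<le> M / Linf_norm \<Omega> F" using Lle L R by (simp add: field_simps)
  finally show "(1 / inradius \<Omega>) powr ((1 - \<Gamma>) * s + \<Gamma> * r) \<le> quotient_inf \<Omega> r s \<Gamma> u v"
    by (simp add: quotient_inf_def F_def M_def R_def \<kappa>_def)
qed

text \<open>The order of the limits matters: \<open>C\<close> depends on the truncation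
  \<open>e\<close>, so \<open>e\<close> is fixed first and p tends to infinity afterwards, when
  C^(1/p) tends to 1.\<close>

lemma eventually_lambda1_root_less:
  assumes r: "0 < r" "r < 1" and s: "0 < s" "s < 1" and \<Gamma>: "0 < \<Gamma>" "\<Gamma> < 1"
    and lim: "((\<lambda>p. \<alpha> p / p) \<longlongrightarrow> \<Gamma>) at_top"
    and ev: "\<forall>\<^sub>F p in at_top. \<alpha> p > 0 \<and> \<beta> p > 0 \<and> \<alpha> p + \<beta> p = p \<and> lambda1 \<Omega> r s p (\<alpha> p) (\<beta> p) \<ge> 0"
    and K: "K > (1 / inradius \<Omega>) powr ((1 - \<Gamma>) * s + \<Gamma> * r)"
  shows "\<forall>\<^sub>F p in at_top. lambda1 \<Omega> r s p (\<alpha> p) (\<beta> p) powr (1 / p) < K"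
proof -
  define R where "R = inradius \<Omega>"
  obtain x0 where x0: "ball x0 R \<subseteq> \<Omega>" and R: "R > 0" using inradius_ball unfolding R_def by metis
  \<comment> \<open>The limit, as p tends to infinity, of the p-th root of the cone bound at
    truncation \<open>e\<close>.\<close>
  define g where "g = (\<lambda>e. 1 / ((R powr r - e powr r) powr \<Gamma> * (R powr s - e powr s) powr (1 - \<Gamma>)))"
  have e0: "((\<lambda>e. e powr t) \<longlongrightarrow> 0) (at_right 0)" if "t > 0" for t :: real
    using that by (intro tendsto_zero_powrI[where b = t] tendsto_const tendsto_ident_at) (auto simp: eventually_at_filter)
  have "(g \<longlongrightarrow> 1 / ((R powr r - 0) powr \<Gamma> * (R powr s - 0) powr (1 - \<Gamma>))) (at_right 0)"
    unfolding g_def using R r s by (intro tendsto_intros e0) auto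
  also have "1 / ((R powr r - 0) powr \<Gamma> * (R powr s - 0) powr (1 - \<Gamma>)) = (1 / R) powr ((1 - \<Gamma>) * s + \<Gamma> * r)"
    using R by (simp add: powr_powr powr_divide mult.commute add.commute flip: powr_add)
  finally have "\<forall>\<^sub>F e in at_right 0. g e < K" using K unfolding R_def by (rule order_tendstoD)
  moreover have "\<forall>\<^sub>F e in at_right 0. e \<in> {0<..<R}" using R by (rule eventually_at_right_real)
  ultimately have "\<forall>\<^sub>F e in at_right 0. g e < K \<and> e \<in> {0<..<R}" by eventually_elim simp
  then obtain e where e: "g e < K" "0 < e" "e < R"
    using eventually_happens'[of "at_right (0::real)"] by auto
  define a where "a = R powr r - e powr r"
  define b where "b = R powr s - e powr s"
  have ab: "a > 0" "b > 0" using trunc_cone_pos[OF r e(2,3)] trunc_cone_pos[OF s e(2,3)] by (auto simp: a_def b_def)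
  obtain p0 C where C: "C > 0" and le: "\<And>p \<alpha> \<beta>. p \<ge> p0 \<Longrightarrow> \<alpha> > 0 \<Longrightarrow> \<beta> > 0 \<Longrightarrow>
     lambda1 \<Omega> r s p \<alpha> \<beta> \<le> C / (a powr \<alpha> * b powr \<beta>)"
    using lambda1_le_trunc_cone[OF domain_basic(1,2) x0 r s e(2,3)] unfolding a_def b_def by blast
  have "((\<lambda>p. C powr (1 / p) / (a powr (\<alpha> p / p) * b powr (1 - \<alpha> p / p))) \<longlongrightarrow> C powr 0 / (a powr \<Gamma> * b powr (1 - \<Gamma>))) at_top"
    using C ab lim by (intro tendsto_intros tendsto_divide_0[OF tendsto_const] filterlim_at_top_imp_at_infinity filterlim_ident) auto
  then have "\<forall>\<^sub>F p in at_top. C powr (1 / p) / (a powr (\<alpha> p / p) * b powr (1 - \<alpha> p / p)) < K"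
    by (rule order_tendstoD) (use e C in \<open>simp add: g_def a_def b_def\<close>)
  then show ?thesis using ev eventually_ge_at_top[of p0] eventually_gt_at_top[of 0]
  proof eventually_elim
    case (elim p)
    have "lambda1 \<Omega> r s p (\<alpha> p) (\<beta> p) powr (1 / p) \<le> (C / (a powr \<alpha> p * b powr \<beta> p)) powr (1 / p)"
      using elim le[of p "\<alpha> p" "\<beta> p"] by (intro powr_mono2) auto
    also have "\<dots> = C powr (1 / p) / (a powr (\<alpha> p / p) * b powr (\<beta> p / p))"
      using C ab by (simp add: powr_divide powr_mult powr_powr)
    also have "\<beta> p / p = 1 - \<alpha> p / p" using elim by (simp add: field_simps)
    finally show ?case using elim by simp
  qed
qed

end

section \<open>Limits of functions with controlled seminorms\<close>

text \<open>Transfers the Morrey estimate from Borel functions to classes by way of a Borel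
  representative. The constant stands before all quantifiers and depends only on t and the
  dimension.\<close>

lemma W_tilde_morrey:
  fixes t :: real
  assumes t: "0 < t" "t \<le> 1"
  shows "\<exists>C>0. \<forall>p K w \<Omega>. t * p \<ge> 2 * real DIM('a) \<longrightarrow> K > 0 \<longrightarrow> w \<in> W_tilde t p \<Omega> \<longrightarrow>
     seminorm_pow t p w \<le> K powr p \<longrightarrow>
     (\<exists>w'. continuous_representative w w' \<and>
        (\<forall>n (x::'a::euclidean_space) y. norm (x - y) \<le> (1 / 2) ^ n \<longrightarrow> \<bar>w' x - w' y\<bar> \<le> C * K * (2 powr (- t / 2)) ^ n))"
proof -
  define \<theta> where "\<theta> = (2::real) powr (- t / 2)"
  have \<theta>: "0 < \<theta>" "\<theta> < 1" using t by (auto simp: \<theta>_def powr_less_one)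
  obtain C where C: "C > 0" and mor: "\<And>p K (w :: 'a \<Rightarrow> real). t * p \<ge> 2 * real DIM('a) \<Longrightarrow> K > 0 \<Longrightarrow> w \<in> borel_measurable borel \<Longrightarrow>
     integrable lborel (\<lambda>x. \<bar>w x\<bar> powr p) \<Longrightarrow> integrable lborel (frac_quotient t p w) \<Longrightarrow>
     integral\<^sup>L lborel (frac_quotient t p w) \<le> K powr p \<Longrightarrow>
     (\<exists>w'. (AE x in lborel. w' x = w x) \<and>
        (\<forall>n x y. norm (x - y) \<le> (1 / 2) ^ n \<longrightarrow> \<bar>w' x - w' y\<bar> \<le> C * K * \<theta> ^ n))"
    using fractional_morrey[OF t, where 'a='a] unfolding \<theta>_def by blast
  have "\<exists>w'. continuous_representative w w' \<and>
        (\<forall>n (x::'a::euclidean_space) y. norm (x - y) \<le> (1 / 2) ^ n \<longrightarrow> \<bar>w' x - w' y\<bar> \<le> C * K * \<theta> ^ n)"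
    if tp: "t * p \<ge> 2 * real DIM('a)" and K: "K > 0" and w: "w \<in> W_tilde t p \<Omega>" and le: "seminorm_pow t p w \<le> K powr p"
    for p K w and \<Omega> :: "'a set"
  proof -
    have w': "w \<in> borel_measurable lebesgue" "integrable lebesgue (\<lambda>x. \<bar>w x\<bar> powr p)" "integrable lebesgue (frac_quotient t p w)"
      using w by (auto simp: W_tilde_def W_frac_def lebesgue_on_UNIV_eq)
    obtain w0 where w0[measurable]: "w0 \<in> borel_measurable borel" and "AE x in lborel. w x = w0 x"
      using completion_ex_borel_measurable_real[OF w'(1)] by auto
    then have ae: "AE x in lebesgue. w0 x = w x" by (auto simp: AE_completion_iff eq_commute)
    have "integrable lebesgue (\<lambda>x. \<bar>w0 x\<bar> powr p)"
      by (rule integrable_cong_AE_imp[OF w'(2)])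
        (auto intro: measurable_completion, use ae in eventually_elim, auto)
    then have 1: "integrable lborel (\<lambda>x. \<bar>w0 x\<bar> powr p)" by (simp add: integrable_completion)
    have m: "frac_quotient t p w0 \<in> borel_measurable borel" by (rule borel_measurable_frac_quotient) fact
    then have m': "frac_quotient t p w0 \<in> borel_measurable lebesgue" by (auto intro: measurable_completion)
    have ae2: "AE z in lebesgue. frac_quotient t p w z = frac_quotient t p w0 z"
      using AE_pair_eq[OF ae] by eventually_elim (auto simp: frac_quotient_def split: prod.split)
    have "integrable lebesgue (frac_quotient t p w0)"
      by (rule integrable_cong_AE_imp[OF w'(3) m' ae2])
    then have 2: "integrable lborel (frac_quotient t p w0)" using m by (simp add: integrable_completion)
    have "integral\<^sup>L lborel (frac_quotient t p w0) = integral\<^sup>L lebesgue (frac_quotient t p w0)"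
      using m by (simp add: integral_completion)
    also have "\<dots> = seminorm_pow t p w"
      unfolding seminorm_pow_def using w'(3) m' ae2 by (intro integral_cong_AE) auto
    finally obtain w' where a: "AE x in lborel. w' x = w0 x" and b: "\<And>n x y. norm (x - y) \<le> (1 / 2) ^ n \<Longrightarrow> \<bar>w' x - w' y\<bar> \<le> C * K * \<theta> ^ n"
      using mor[OF tp K w0 1 2] le by auto
    have "continuous_on UNIV w'"
      unfolding continuous_on_iff
    proof (intro ballI allI impI)
      fix x and e :: real assume e: "e > 0"
      have "(\<lambda>n. C * K * \<theta> ^ n) \<longlonglongrightarrow> 0"
        using \<theta> by (intro tendsto_mult_right_zero LIMSEQ_realpow_zero) auto
      then obtain n where n: "C * K * \<theta> ^ n < e"
        using order_tendstoD(2)[of _ 0 sequentially e] e by (auto simp: eventually_sequentially)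
      show "\<exists>d>0. \<forall>x'\<in>UNIV. dist x' x < d \<longrightarrow> dist (w' x') (w' x) < e"
      proof (intro exI[of _ "(1 / 2) ^ n"] conjI ballI impI)
        fix x' assume "dist x' x < (1 / 2) ^ n"
        then have "\<bar>w' x' - w' x\<bar> \<le> C * K * \<theta> ^ n" by (intro b) (simp add: dist_norm)
        then show "dist (w' x') (w' x) < e" using n by (simp add: dist_real_def)
      qed simp
    qed
    moreover have "AE x in lebesgue. w' x = w x"
      using AE_completion[OF a] ae by eventually_elim simp
    ultimately show ?thesis using b by (auto simp: continuous_representative_def)
  qed
  then show ?thesis using C unfolding \<theta>_def by blast
qed

text \<open>The segment is cut into k pieces of length at most 1. Together with a common zero this
  turns a modulus at unit scale into a uniform bound.\<close>

lemma chain_bound: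
  fixes f :: "'a::real_normed_vector \<Rightarrow> real"
  assumes "\<And>x y. norm (x - y) \<le> 1 \<Longrightarrow> \<bar>f x - f y\<bar> \<le> D" "norm (x - y) \<le> real k"
  shows "\<bar>f x - f y\<bar> \<le> real k * D"
  using assms(2)
proof (induction k arbitrary: x)
  case (Suc k)
  define z where "z = y + (real k / real (Suc k)) *\<^sub>R (x - y)"
  have "norm (z - y) = real k / real (Suc k) * norm (x - y)" by (simp add: z_def)
  also have "\<dots> \<le> real k / real (Suc k) * real (Suc k)" using Suc.prems by (intro mult_left_mono) auto
  finally have "\<bar>f z - f y\<bar> \<le> real k * D" by (intro Suc.IH) simp
  moreover have "x - z = (1 / real (Suc k)) *\<^sub>R (x - y)"
  proof -
    have "x - z = (1 - real k / real (Suc k)) *\<^sub>R (x - y)" by (simp add: z_def algebra_simps)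
    also have "1 - real k / real (Suc k) = 1 / real (Suc k)" by (simp add: field_simps)
    finally show ?thesis .
  qed
  then have "norm (x - z) = norm (x - y) / real (Suc k)" by simp
  then have "norm (x - z) \<le> 1" using Suc.prems by (simp add: divide_le_eq)
  then have "\<bar>f x - f z\<bar> \<le> D" by (rule assms(1))
  ultimately show ?case by (simp add: algebra_simps)
qed auto

text \<open>A violation of the bound at one pair persists, with a constant K' > K, for
  \<open>U j\<close> on a product of two small balls. The seminorm powers then grow at least like
  K'^Q and exceed K^Q for all large j, so a bound for infinitely many j is already
  contradictory.\<close>

lemma holder_of_uniform_limit:
  fixes U :: "nat \<Rightarrow> 'a::euclidean_space \<Rightarrow> real"
  assumes U: "\<And>j. continuous_on UNIV (U j)" and lim: "uniform_limit UNIV U w sequentially"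
    and Q: "filterlim Q at_top sequentially" and t: "t > 0" and K: "K > 0"
    and int: "\<And>j. integrable lborel (frac_quotient t (Q j) (U j))"
    and le: "\<exists>\<^sub>F j in sequentially. seminorm_pow t (Q j) (U j) \<le> K powr Q j"
  shows "\<bar>w x0 - w y0\<bar> \<le> K * norm (x0 - y0) powr t"
proof (rule ccontr)
  assume "\<not> ?thesis"
  then have gt: "\<bar>w x0 - w y0\<bar> > K * norm (x0 - y0) powr t" by simp
  then have ne: "x0 \<noteq> y0" by auto
  have cw: "continuous_on UNIV w"
    using lim U by (intro uniform_limit_theorem) auto
  \<comment> \<open>The midpoint between \<open>K\<close> and the violating quotient leaves room on
    both sides.\<close>
  define K' where "K' = (K + \<bar>w x0 - w y0\<bar> / norm (x0 - y0) powr t) / (1 + 1)"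
  have "K < \<bar>w x0 - w y0\<bar> / norm (x0 - y0) powr t" using gt ne by (simp add: less_divide_eq)
  then have K': "K < K'" "K' < \<bar>w x0 - w y0\<bar> / norm (x0 - y0) powr t"
    unfolding K'_def by (rule less_half_sum, rule gt_half_sum)
  define h where "h = (\<lambda>z. \<bar>w (fst z) - w (snd z)\<bar> - K' * norm (fst z - snd z) powr t)"
  have cfs: "continuous_on UNIV (\<lambda>z. w (fst z))" "continuous_on UNIV (\<lambda>z. w (snd z))"
    by (rule continuous_on_compose2[OF cw continuous_on_fst[OF continuous_on_id]], simp)
      (rule continuous_on_compose2[OF cw continuous_on_snd[OF continuous_on_id]], simp)
  have cn: "continuous_on UNIV (\<lambda>z. norm (fst z - snd z) powr t :: real)"
    using t by (intro continuous_on_powr' continuous_intros) auto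
  have "continuous_on UNIV h"
    unfolding h_def by (intro continuous_on_diff continuous_on_rabs cfs continuous_on_mult continuous_on_const cn)
  define \<eta> where "\<eta> = h (x0, y0) / 2"
  have \<eta>: "\<eta> > 0" using K'(2) ne by (simp add: \<eta>_def h_def less_divide_eq)
  have "open (h -` {\<eta><..})" using \<open>continuous_on UNIV h\<close> by (intro open_vimage) auto
  moreover have "(x0, y0) \<in> h -` {\<eta><..}" using \<eta> by (simp add: \<eta>_def)
  ultimately obtain A B where AB: "open A" "open B" "(x0, y0) \<in> A \<times> B" "A \<times> B \<subseteq> h -` {\<eta><..}"
    by (rule open_prod_elim)
  have "x0 \<in> A" "y0 \<in> B" using AB(3) by auto
  obtain d1 where d1: "d1 > 0" "ball x0 d1 \<subseteq> A" by (rule openE[OF AB(1) \<open>x0 \<in> A\<close>])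
  obtain d2 where d2: "d2 > 0" "ball y0 d2 \<subseteq> B" by (rule openE[OF AB(2) \<open>y0 \<in> B\<close>])
  note d12 = d1 d2
  define d where "d = min (min d1 d2) (norm (x0 - y0) / 2)"
  have d: "d > 0" "ball x0 d \<subseteq> A" "ball y0 d \<subseteq> B" using d12 ne by (auto simp: d_def)
  define D where "D = 2 * norm (x0 - y0)"
  have bd: "norm (x - y) \<le> D \<and> x \<noteq> y" if "x \<in> ball x0 d" "y \<in> ball y0 d" for x y
  proof -
    have "dist x0 x + dist y0 y < norm (x0 - y0)" using that by (auto simp: d_def)
    moreover have "dist x y \<le> dist x0 x + dist x0 y0 + dist y0 y"
      using dist_triangle[of x y x0] dist_triangle[of x0 y y0] by (simp add: dist_commute)
    moreover have "dist x0 y0 \<le> dist x0 x + dist x y + dist y0 y"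
      using dist_triangle[of x0 y0 x] dist_triangle[of x y0 y] by (simp add: dist_commute)
    ultimately show ?thesis by (auto simp: D_def dist_norm)
  qed
  have D: "D > 0" using ne by (simp add: D_def)
  \<comment> \<open>After the Hoelder powers cancel, the density keeps the factor |x - y|^-N, which
    is at least D^-N on the product of the balls.\<close>
  define c where "c = D powr - real DIM('a) * (measure lborel (ball x0 d) * measure lborel (ball y0 d))"
  have c: "c > 0" using D d by (simp add: c_def content_ball)
  have conv: "\<forall>\<^sub>F j in sequentially. \<forall>x\<in>UNIV. dist (U j x) (w x) < \<eta> / 2"
    by (rule lim[unfolded uniform_limit_iff, rule_format, OF half_gt_zero[OF \<eta>]])
  have low: "K' powr Q j * c \<le> seminorm_pow t (Q j) (U j)"
    if close: "\<forall>x\<in>UNIV. dist (U j x) (w x) < \<eta> / 2" and Qj: "Q j > 0" for j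
  proof -
    let ?iA = "\<lambda>x. indicator (ball x0 d) x :: real" and ?iB = "\<lambda>y. indicator (ball y0 d) y :: real"
    have i: "integrable lborel ?iA" "integrable lborel ?iB"
      using emeasure_bounded_finite[OF bounded_ball[of x0 d]] emeasure_bounded_finite[OF bounded_ball[of y0 d]] by auto
    have "K' powr Q j * c = (\<integral>z. K' powr Q j * D powr - real DIM('a) * (case z of (x, y) \<Rightarrow> ?iA x * ?iB y) \<partial>lborel)"
      using integrable_integral_pair_mult[OF i] by (simp add: c_def)
    also have "\<dots> \<le> (\<integral>z. frac_quotient t (Q j) (U j) z \<partial>lborel)"
    proof (rule integral_mono)
      fix z :: "'a \<times> 'a" obtain x y where z: "z = (x, y)" by fastforce
      show "K' powr Q j * D powr - real DIM('a) * (case z of (x, y) \<Rightarrow> ?iA x * ?iB y) \<le> frac_quotient t (Q j) (U j) z"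
      proof (cases "x \<in> ball x0 d \<and> y \<in> ball y0 d")
        case True
        let ?n = "norm (x - y)"
        have n: "?n > 0" "?n \<le> D" using bd True by auto
        have "(x, y) \<in> A \<times> B" using True d by blast
        then have "(x, y) \<in> h -` {\<eta><..}" using AB(4) by blast
        then have "\<bar>w x - w y\<bar> > K' * ?n powr t + \<eta>" by (simp add: h_def)
        moreover have "dist (U j x) (w x) < \<eta> / 2" "dist (U j y) (w y) < \<eta> / 2" using close by auto
        moreover have "\<bar>w x - w y\<bar> \<le> dist (U j x) (w x) + \<bar>U j x - U j y\<bar> + dist (U j y) (w y)"
          unfolding dist_real_def by linarith
        ultimately have "K' * ?n powr t \<le> \<bar>U j x - U j y\<bar>" by linarith
        then have "(K' * ?n powr t) powr Q j \<le> \<bar>U j x - U j y\<bar> powr Q j"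
          using K' K Qj by (intro powr_mono2) auto
        then have "K' powr Q j * ?n powr (t * Q j) \<le> \<bar>U j x - U j y\<bar> powr Q j"
          using K' K by (simp add: powr_mult powr_powr)
        then have "K' powr Q j * ?n powr (t * Q j) / ?n powr (real DIM('a) + t * Q j) \<le> frac_quotient t (Q j) (U j) z"
          unfolding z frac_quotient_def by (auto intro: divide_right_mono)
        also have "K' powr Q j * ?n powr (t * Q j) / ?n powr (real DIM('a) + t * Q j) = K' powr Q j * ?n powr - real DIM('a)"
          using n by (simp add: powr_add powr_minus field_simps)
        also have "K' powr Q j * D powr - real DIM('a) \<le> \<dots>"
          using n by (intro mult_left_mono powr_mono2') auto
        finally show ?thesis using True z by simp
      qed (auto simp: z frac_quotient_nonneg)
    next
      show "integrable lborel (\<lambda>z. K' powr Q j * D powr - real DIM('a) * (case z of (x, y) \<Rightarrow> ?iA x * ?iB y))"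
        by (intro integrable_mult_right integrable_integral_pair_mult i)
    qed (rule int)
    also have "\<dots> = seminorm_pow t (Q j) (U j)"
      using U by (simp add: seminorm_pow_eq_lborel borel_measurable_continuous_onI)
    finally show ?thesis .
  qed
  have "filterlim (\<lambda>p. (K' / K) powr p) at_top at_top" using K' K by real_asymp
  then have "filterlim (\<lambda>j. (K' / K) powr Q j) at_top sequentially" using Q by (rule filterlim_compose)
  then have "\<forall>\<^sub>F j in sequentially. (K' / K) powr Q j > 1 / c" by (simp add: filterlim_at_top_dense)
  moreover have "\<forall>\<^sub>F j in sequentially. Q j > 0" using Q by (simp add: filterlim_at_top_dense)
  ultimately have "\<forall>\<^sub>F j in sequentially. \<not> seminorm_pow t (Q j) (U j) \<le> K powr Q j"
    using conv
  proof eventually_elim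
    case (elim j)
    have "K powr Q j < K powr Q j * ((K' / K) powr Q j * c)"
      using elim c K by (simp add: divide_less_eq)
    also have "\<dots> = K' powr Q j * c" using K K' by (simp add: powr_divide)
    also have "\<dots> \<le> seminorm_pow t (Q j) (U j)" using low elim by blast
    finally show ?case by simp
  qed
  with le show False by (simp add: frequently_def)
qed

section \<open>Compactness of the eigenpairs\<close>

lemma uniform_limit_tendsto_along:
  fixes w :: "'a::metric_space \<Rightarrow> real"
  assumes "uniform_limit UNIV U w sequentially" "continuous_on UNIV w" "x \<longlonglongrightarrow> l"
  shows "(\<lambda>j. U j (x j)) \<longlonglongrightarrow> w l"
proof -
  have "(\<lambda>j. U j (x j) - w (x j)) \<longlonglongrightarrow> 0"
  proof (rule tendstoI)
    fix e :: real assume "e > 0"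
    then have "\<forall>\<^sub>F j in sequentially. \<forall>x\<in>UNIV. dist (U j x) (w x) < e"
      using assms(1) by (rule uniform_limitD[rotated])
    then show "\<forall>\<^sub>F j in sequentially. dist (U j (x j) - w (x j)) 0 < e"
      by eventually_elim (simp add: dist_real_def)
  qed
  moreover have "(\<lambda>j. w (x j)) \<longlonglongrightarrow> w l"
    by (rule continuous_on_tendsto_compose[OF assms(2,3)]) auto
  ultimately have "(\<lambda>j. (U j (x j) - w (x j)) + w (x j)) \<longlonglongrightarrow> 0 + w l" by (rule tendsto_add)
  then show ?thesis by simp
qed

lemma uniform_limit_subseq:
  assumes "uniform_limit S U w sequentially" "strict_mono (k :: nat \<Rightarrow> nat)"
  shows "uniform_limit S (\<lambda>j. U (k j)) w sequentially"
  using assms(1) eventually_subseq[OF assms(2)] unfolding uniform_limit_iff by blast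

locale eigen_family =
  fixes \<Omega> :: "'a::euclidean_space set"
    and r s \<Gamma> :: real
    and \<alpha> \<beta> :: "real \<Rightarrow> real"
    and u v :: "real \<Rightarrow> 'a \<Rightarrow> real"
  assumes dom: "bounded_smooth_domain \<Omega>"
    and r: "0 < r" "r < 1" and s: "0 < s" "s < 1" and \<Gamma>: "0 < \<Gamma>" "\<Gamma> < 1"
    and par: "\<And>p. p \<ge> 2 \<Longrightarrow> p * min r s \<ge> real DIM('a) \<Longrightarrow>
           \<alpha> p \<in> {0<..<p} \<and> \<beta> p \<in> {0<..<p} \<and> \<alpha> p + \<beta> p = p \<and> min (\<alpha> p) (\<beta> p) \<ge> 1"
    and ratio: "((\<lambda>p. \<alpha> p / p) \<longlongrightarrow> \<Gamma>) at_top"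
    and eig: "\<And>p. p \<ge> 2 \<Longrightarrow> p * min r s \<ge> real DIM('a) \<Longrightarrow>
           eigenpair \<Omega> r s p (\<alpha> p) (\<beta> p) (lambda1 \<Omega> r s p (\<alpha> p) (\<beta> p)) (u p) (v p) \<and>
           (AE x in lebesgue_on \<Omega>. u p x > 0 \<and> v p x > 0) \<and>
           coupling \<Omega> (\<alpha> p) (\<beta> p) (u p) (v p) = 1"
begin

definition large_exponent :: "real \<Rightarrow> bool" where
  "large_exponent p \<longleftrightarrow> p \<ge> 2 \<and> p * min r s \<ge> real DIM('a)"

definition lam :: "real \<Rightarrow> real" where
  "lam p = lambda1 \<Omega> r s p (\<alpha> p) (\<beta> p)"

text \<open>Introduced through the closed formula. Its equality with the infimum
  \<open>Lambda_inf\<close> is a result, obtained together with the minimizer.\<close>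

definition Lam :: real where
  "Lam = (1 / inradius \<Omega>) powr ((1 - \<Gamma>) * s + \<Gamma> * r)"

lemma Lam_pos: "Lam > 0"
proof -
  have "inradius \<Omega> > 0" using inradius_ball[OF dom] by metis
  then show ?thesis by (simp add: Lam_def)
qed

lemma large_exponentD:
  assumes "large_exponent p"
  shows "p \<ge> 2" "0 < \<alpha> p" "\<alpha> p < p" "0 < \<beta> p" "\<beta> p < p" "\<alpha> p + \<beta> p = p" "\<alpha> p \<ge> 1" "\<beta> p \<ge> 1"
    "eigenpair \<Omega> r s p (\<alpha> p) (\<beta> p) (lam p) (u p) (v p)"
    "AE x in lebesgue_on \<Omega>. u p x > 0" "AE x in lebesgue_on \<Omega>. v p x > 0"
    "coupling \<Omega> (\<alpha> p) (\<beta> p) (u p) (v p) = 1"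
  using assms par[of p] eig[of p] unfolding large_exponent_def lam_def by auto

lemma eventually_large_exponent: "\<exists>p1. \<forall>p\<ge>p1. large_exponent p \<and> r * p \<ge> 2 * real DIM('a) \<and> s * p \<ge> 2 * real DIM('a)"
proof -
  define m where "m = min r s"
  have m: "m > 0" using r s by (simp add: m_def)
  show ?thesis
  proof (intro exI[of _ "max 2 (2 * real DIM('a) / m)"] allI impI)
    fix p assume p: "p \<ge> max 2 (2 * real DIM('a) / m)"
    then have "2 * real DIM('a) / m \<le> p" by simp
    then have a: "2 * real DIM('a) \<le> m * p" using m by (simp add: divide_le_eq mult.commute)
    moreover have "m * p \<le> r * p" "m * p \<le> s * p" using p by (auto simp: m_def intro!: mult_right_mono)
    moreover have "large_exponent p" unfolding large_exponent_def using a p by (simp flip: m_def add: mult.commute)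
    ultimately show "large_exponent p \<and> r * p \<ge> 2 * real DIM('a) \<and> s * p \<ge> 2 * real DIM('a)" by linarith
  qed
qed

text \<open>Read off from the identity for a normalized eigenpair: a nonnegative seminorm power
  equals the eigenvalue times a positive ratio.\<close>

lemma lam_nonneg:
  assumes "large_exponent p"
  shows "lam p \<ge> 0"
proof -
  have "seminorm_pow r p (u p) = lam p * (\<alpha> p / p)"
    using large_exponentD[OF assms] by (intro eigenpair_seminorm_pow(1)[where v = "v p" and s = s and \<Omega> = \<Omega> and \<beta> = "\<beta> p"]) auto
  moreover have "seminorm_pow r p (u p) \<ge> 0"
    by (auto simp: seminorm_pow_def frac_quotient_nonneg intro!: Bochner_Integration.integral_nonneg)
  moreover have "\<alpha> p / p > 0" using large_exponentD[OF assms] by auto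
  ultimately have "0 \<le> lam p * (\<alpha> p / p)" "\<alpha> p / p > 0" by simp_all
  then show ?thesis unfolding zero_le_mult_iff by linarith
qed

lemma seminorm_le_lam:
  assumes "large_exponent p"
  shows "seminorm_pow r p (u p) \<le> lam p" "seminorm_pow s p (v p) \<le> lam p"
proof -
  note g = large_exponentD[OF assms]
  have 1: "seminorm_pow r p (u p) = lam p * (\<alpha> p / p)"
    using g by (intro eigenpair_seminorm_pow(1)[where v = "v p" and s = s and \<Omega> = \<Omega> and \<beta> = "\<beta> p"]) auto
  have 2: "seminorm_pow s p (v p) = lam p * (\<beta> p / p)"
    using g by (intro eigenpair_seminorm_pow(2)[where u = "u p" and r = r and \<Omega> = \<Omega> and \<alpha> = "\<alpha> p"]) auto
  have h: "\<alpha> p / p \<le> 1" "\<beta> p / p \<le> 1" using g by auto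
  show "seminorm_pow r p (u p) \<le> lam p" "seminorm_pow s p (v p) \<le> lam p"
    unfolding 1 2 by (rule mult_left_le[OF h(1) lam_nonneg[OF assms]], rule mult_left_le[OF h(2) lam_nonneg[OF assms]])
qed

lemma eventually_lam_root_less:
  assumes "K > Lam"
  shows "\<forall>\<^sub>F p in at_top. lam p powr (1 / p) < K"
proof -
  obtain p1 where p1: "\<And>p. p \<ge> p1 \<Longrightarrow> large_exponent p" using eventually_large_exponent by blast
  have "\<forall>\<^sub>F p in at_top. \<alpha> p > 0 \<and> \<beta> p > 0 \<and> \<alpha> p + \<beta> p = p \<and> lambda1 \<Omega> r s p (\<alpha> p) (\<beta> p) \<ge> 0"
    using eventually_ge_at_top[of p1]
    by eventually_elim (use p1 large_exponentD lam_nonneg in \<open>auto simp: lam_def\<close>)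
  then show ?thesis
    unfolding lam_def using assms by (intro eventually_lambda1_root_less[OF dom r s \<Gamma> ratio]) (auto simp: Lam_def)
qed

text \<open>What the continuous versions inherit. The sign, known almost everywhere in \<Omega>,
  becomes a weak inequality at every point of the space.\<close>

lemma continuous_eigenpair:
  assumes p: "large_exponent p" and U: "continuous_representative (u p) U" and V: "continuous_representative (v p) V"
  shows "\<And>x. x \<notin> \<Omega> \<Longrightarrow> U x = 0" "\<And>x. x \<notin> \<Omega> \<Longrightarrow> V x = 0"
    "continuous_on UNIV U" "continuous_on UNIV V"
    "eigenpair \<Omega> r s p (\<alpha> p) (\<beta> p) (lam p) U V" "coupling \<Omega> (\<alpha> p) (\<beta> p) U V = 1"
    "\<And>x. U x \<ge> 0" "\<And>x. V x \<ge> 0" "U \<in> W_tilde r p \<Omega>" "V \<in> W_tilde s p \<Omega>"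
    "seminorm_pow r p U \<le> lam p" "seminorm_pow s p V \<le> lam p"
proof -
  note g = large_exponentD[OF p] and d = domain_basic[OF dom]
  have uv: "u p \<in> W_tilde r p \<Omega>" "v p \<in> W_tilde s p \<Omega>"
    using g(9) by (auto simp: eigenpair_def admissible_def)
  have uv0: "x \<notin> \<Omega> \<Longrightarrow> u p x = 0" "x \<notin> \<Omega> \<Longrightarrow> v p x = 0" for x
    using uv by (auto simp: W_tilde_def)
  show U0: "x \<notin> \<Omega> \<Longrightarrow> U x = 0" and V0: "x \<notin> \<Omega> \<Longrightarrow> V x = 0" for x
    using continuous_representative_zero_outside[OF dom U uv0(1)]
      continuous_representative_zero_outside[OF dom V uv0(2)] by auto
  show cU: "continuous_on UNIV U" and cV: "continuous_on UNIV V"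
    using U V by (auto simp: continuous_representative_def)
  show ep: "eigenpair \<Omega> r s p (\<alpha> p) (\<beta> p) (lam p) U V"
    using g U0 V0 by (intro eigenpair_continuous_representative(1)[OF d(1,2) _ g(9) U _ V]) auto
  have "coupling \<Omega> (\<alpha> p) (\<beta> p) U V = coupling \<Omega> (\<alpha> p) (\<beta> p) (u p) (v p)"
    using g U0 V0 by (intro eigenpair_continuous_representative(2)[OF d(1,2) _ g(9) U _ V]) auto
  then show c1: "coupling \<Omega> (\<alpha> p) (\<beta> p) U V = 1" using g(12) by simp
  show "U \<in> W_tilde r p \<Omega>" "V \<in> W_tilde s p \<Omega>"
    using ep by (auto simp: eigenpair_def admissible_def)
  have \<Omega>: "\<Omega> \<in> sets lebesgue" using d(1) by (auto intro!: borel_open sets_completionI_sets)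
  have "AE x in lebesgue_on \<Omega>. U x = u p x" "AE x in lebesgue_on \<Omega>. V x = v p x"
    using U V \<Omega> by (auto simp: continuous_representative_def intro: AE_lebesgue_on)
  then have ae: "AE x in lebesgue_on \<Omega>. - U x \<le> 0" "AE x in lebesgue_on \<Omega>. - V x \<le> 0"
    using g(10,11) by (eventually_elim, simp)+
  have c: "continuous_on \<Omega> (\<lambda>x. - U x)" "continuous_on \<Omega> (\<lambda>x. - V x)"
    using cU cV by (auto intro!: continuous_on_minus intro: continuous_on_subset)
  show "U x \<ge> 0" "V x \<ge> 0" for x
    using AE_le_imp_le_on_open[OF d(1) c(1) ae(1), of x] AE_le_imp_le_on_open[OF d(1) c(2) ae(2), of x] U0[of x] V0[of x]
    by (cases "x \<in> \<Omega>"; force)+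
  have 1: "seminorm_pow r p U = lam p * (\<alpha> p / p)" and 2: "seminorm_pow s p V = lam p * (\<beta> p / p)"
    using eigenpair_seminorm_pow[OF ep c1] g by auto
  have h: "\<alpha> p / p \<le> 1" "\<beta> p / p \<le> 1" using g by auto
  show "seminorm_pow r p U \<le> lam p" "seminorm_pow s p V \<le> lam p"
    unfolding 1 2 by (rule mult_left_le[OF h(1) lam_nonneg[OF p]], rule mult_left_le[OF h(2) lam_nonneg[OF p]])
qed

text \<open>Beyond some exponent the p-th roots of the eigenvalues stay below Lam + 1. This value
  serves as \<open>K\<close> in the Morrey estimate, so one modulus holds for all large p and both
  components.\<close>

lemma representatives_with_modulus:
  "\<exists>p1 C \<theta>. 0 < \<theta> \<and> \<theta> < 1 \<and> C > 0 \<and> (\<forall>p\<ge>p1. large_exponent p \<and>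
    (\<exists>U V. continuous_representative (u p) U \<and> continuous_representative (v p) V \<and>
      (\<forall>n x y. norm (x - y) \<le> (1 / 2) ^ n \<longrightarrow> \<bar>U x - U y\<bar> \<le> C * \<theta> ^ n \<and> \<bar>V x - V y\<bar> \<le> C * \<theta> ^ n)))"
proof -
  obtain Cr where Cr: "Cr > 0" "\<forall>p K w \<Omega>. r * p \<ge> 2 * real DIM('a) \<longrightarrow> K > 0 \<longrightarrow> w \<in> W_tilde r p \<Omega> \<longrightarrow>
     seminorm_pow r p w \<le> K powr p \<longrightarrow>
     (\<exists>w'. continuous_representative w w' \<and>
        (\<forall>n (x::'a) y. norm (x - y) \<le> (1 / 2) ^ n \<longrightarrow> \<bar>w' x - w' y\<bar> \<le> Cr * K * (2 powr (- r / 2)) ^ n))"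
    using W_tilde_morrey[of r, where 'a = 'a] r by auto
  obtain Cs where Cs: "Cs > 0" "\<forall>p K w \<Omega>. s * p \<ge> 2 * real DIM('a) \<longrightarrow> K > 0 \<longrightarrow> w \<in> W_tilde s p \<Omega> \<longrightarrow>
     seminorm_pow s p w \<le> K powr p \<longrightarrow>
     (\<exists>w'. continuous_representative w w' \<and>
        (\<forall>n (x::'a) y. norm (x - y) \<le> (1 / 2) ^ n \<longrightarrow> \<bar>w' x - w' y\<bar> \<le> Cs * K * (2 powr (- s / 2)) ^ n))"
    using W_tilde_morrey[of s, where 'a = 'a] s by auto
  define K where "K = Lam + 1"
  have K: "K > 0" "K > Lam" using Lam_pos by (auto simp: K_def)
  obtain p1 where p1: "\<And>p. p \<ge> p1 \<Longrightarrow> large_exponent p \<and> r * p \<ge> 2 * real DIM('a) \<and> s * p \<ge> 2 * real DIM('a)"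
    using eventually_large_exponent by blast
  obtain p2 where p2: "\<And>p. p \<ge> p2 \<Longrightarrow> lam p powr (1 / p) < K"
    using eventually_lam_root_less[OF K(2)] by (auto simp: eventually_at_top_linorder)
  define \<theta> where "\<theta> = max (2 powr (- r / 2)) (2 powr (- s / 2) :: real)"
  have \<theta>: "0 < \<theta>" "\<theta> < 1" using r s by (auto simp: \<theta>_def powr_less_one less_max_iff_disj)
  define C where "C = max (Cr * K) (Cs * K)"
  have C: "C > 0" using Cr K by (simp add: C_def less_max_iff_disj)
  have le: "Cr * K * (2 powr (- r / 2)) ^ n \<le> C * \<theta> ^ n" "Cs * K * (2 powr (- s / 2)) ^ n \<le> C * \<theta> ^ n" for n
    using C by (auto simp: C_def \<theta>_def intro!: mult_mono power_mono)
  have "large_exponent p \<and> (\<exists>U V. continuous_representative (u p) U \<and> continuous_representative (v p) V \<and>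
      (\<forall>n x y. norm (x - y) \<le> (1 / 2) ^ n \<longrightarrow> \<bar>U x - U y\<bar> \<le> C * \<theta> ^ n \<and> \<bar>V x - V y\<bar> \<le> C * \<theta> ^ n))"
    if p: "p \<ge> max p1 p2" for p
  proof -
    have g: "large_exponent p" and rs: "r * p \<ge> 2 * real DIM('a)" "s * p \<ge> 2 * real DIM('a)" using p1[of p] p by auto
    have "lam p = (lam p powr (1 / p)) powr p" using lam_nonneg[OF g] large_exponentD(1)[OF g] by (simp add: powr_powr)
    also have "\<dots> \<le> K powr p" using p2[of p] p large_exponentD(1)[OF g] by (intro powr_mono2) auto
    finally have lamK: "lam p \<le> K powr p" .
    have uv: "u p \<in> W_tilde r p \<Omega>" "v p \<in> W_tilde s p \<Omega>"
      using large_exponentD(9)[OF g] by (auto simp: eigenpair_def admissible_def)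
    obtain U where U: "continuous_representative (u p) U"
      and U2: "\<forall>n x y. norm (x - y) \<le> (1 / 2) ^ n \<longrightarrow> \<bar>U x - U y\<bar> \<le> Cr * K * (2 powr (- r / 2)) ^ n"
      using Cr(2)[rule_format, OF rs(1) K(1) uv(1)] seminorm_le_lam(1)[OF g] lamK by auto
    obtain V where V: "continuous_representative (v p) V"
      and V2: "\<forall>n x y. norm (x - y) \<le> (1 / 2) ^ n \<longrightarrow> \<bar>V x - V y\<bar> \<le> Cs * K * (2 powr (- s / 2)) ^ n"
      using Cs(2)[rule_format, OF rs(2) K(1) uv(2)] seminorm_le_lam(2)[OF g] lamK by auto
    have "\<bar>U x - U y\<bar> \<le> C * \<theta> ^ n \<and> \<bar>V x - V y\<bar> \<le> C * \<theta> ^ n" if "norm (x - y) \<le> (1 / 2) ^ n" for n x y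
      using order_trans[OF U2[rule_format, OF that] le(1)] order_trans[OF V2[rule_format, OF that] le(2)] ..
    then show ?thesis using g U V by blast
  qed
  then show ?thesis using \<theta> C by (intro exI[of _ "max p1 p2"] exI[of _ C] exI[of _ \<theta>]) auto
qed

text \<open>Convergence is asked on the whole space, which costs nothing since all representatives
  vanish outside \<Omega>; zero extension then needs no separate treatment.\<close>

definition limit_data where
  "limit_data Q U V ui vi \<longleftrightarrow> filterlim Q at_top sequentially \<and> (\<forall>j::nat. large_exponent (Q j)) \<and>
     (\<forall>j. continuous_representative (u (Q j)) (U j) \<and> continuous_representative (v (Q j)) (V j)) \<and>
     uniform_limit UNIV U ui sequentially \<and> uniform_limit UNIV V vi sequentially"

text \<open>It starts from an arbitrary sequence of exponents, because the lower bound for the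
  eigenvalues applies it to a sequence chosen by contradiction.\<close>

lemma compactness:
  assumes P: "filterlim P at_top sequentially"
  shows "\<exists>k U V ui vi. filterlim k at_top sequentially \<and> limit_data (\<lambda>j. P (k j)) U V ui vi"
proof -
  obtain p1 C \<theta> where \<theta>: "0 < \<theta>" "\<theta> < 1" and C: "C > 0"
    and rep: "\<And>p. p \<ge> p1 \<Longrightarrow> large_exponent p \<and>
    (\<exists>U V. continuous_representative (u p) U \<and> continuous_representative (v p) V \<and>
      (\<forall>n x y. norm (x - y) \<le> (1 / 2) ^ n \<longrightarrow> \<bar>U x - U y\<bar> \<le> C * \<theta> ^ n \<and> \<bar>V x - V y\<bar> \<le> C * \<theta> ^ n))"
    using representatives_with_modulus by blast
  have "\<forall>\<^sub>F n in sequentially. P n \<ge> p1" using P by (simp add: filterlim_at_top)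
  then obtain n0 where n0: "\<And>n. n \<ge> n0 \<Longrightarrow> P n \<ge> p1" by (auto simp: eventually_sequentially)
  define P' where "P' = (\<lambda>n. P (n + n0))"
  have g: "large_exponent (P' n)" and ex: "\<exists>U V. continuous_representative (u (P' n)) U \<and> continuous_representative (v (P' n)) V \<and>
      (\<forall>m x y. norm (x - y) \<le> (1 / 2) ^ m \<longrightarrow> \<bar>U x - U y\<bar> \<le> C * \<theta> ^ m \<and> \<bar>V x - V y\<bar> \<le> C * \<theta> ^ m)" for n
    using rep[OF n0[of "n + n0"]] by (auto simp: P'_def)
  obtain U V where U: "\<And>n. continuous_representative (u (P' n)) (U n)" and V: "\<And>n. continuous_representative (v (P' n)) (V n)"
    and mod: "\<And>n m x y. norm (x - y) \<le> (1 / 2) ^ m \<Longrightarrow> \<bar>U n x - U n y\<bar> \<le> C * \<theta> ^ m \<and> \<bar>V n x - V n y\<bar> \<le> C * \<theta> ^ m"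
    using ex by metis
  have zero: "x \<notin> \<Omega> \<Longrightarrow> U n x = 0" "x \<notin> \<Omega> \<Longrightarrow> V n x = 0" for n x
    using continuous_eigenpair(1,2)[OF g U V] by auto
  have cpt: "compact (closure \<Omega>)" using domain_basic(2)[OF dom] by (simp add: compact_closure)
  \<comment> \<open>At this point every representative vanishes; chains of at most \<open>k0\<close>
    unit steps from it bound all of them on the closure by k0 C.\<close>
  obtain y0 where y0: "y0 \<notin> \<Omega>" using frontier_nonempty[OF dom] frontier_disjoint[OF dom] by blast
  have "bounded (closure \<Omega>)" using cpt by (rule compact_imp_bounded)
  then obtain B where B: "\<And>x. x \<in> closure \<Omega> \<Longrightarrow> norm (x - y0) \<le> B"
    using bounded_any_center[of "closure \<Omega>" y0] by (auto simp: dist_norm norm_minus_commute)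
  define k0 where "k0 = nat \<lceil>B\<rceil>"
  have k0: "norm (x - y0) \<le> real k0" if "x \<in> closure \<Omega>" for x using B[OF that] unfolding k0_def by linarith
  have bU: "\<bar>U n x\<bar> \<le> real k0 * C" "\<bar>V n x\<bar> \<le> real k0 * C" if "x \<in> closure \<Omega>" for n x
    using chain_bound[of "U n" C x y0 k0] chain_bound[of "V n" C x y0 k0] mod[of _ _ 0 n] k0[OF that] zero[OF y0] by auto
  \<comment> \<open>Treating the two components as one map into the plane yields a common
    subsequence from one application of Arzela-Ascoli.\<close>
  define F where "F = (\<lambda>n x. (U n x, V n x))"
  have nF: "norm (F n x - F n y) \<le> \<bar>U n x - U n y\<bar> + \<bar>V n x - V n y\<bar>" for n x y
    using norm_Pair_le[of "U n x - U n y" "V n x - V n y"] by (simp add: F_def)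
  obtain g' k where k: "strict_mono (k :: nat \<Rightarrow> nat)"
    and conv: "\<And>e. 0 < e \<Longrightarrow> \<exists>N. \<forall>n x. n \<ge> N \<and> x \<in> closure \<Omega> \<longrightarrow> norm (F (k n) x - g' x) < e"
  proof (rule Arzela_Ascoli[OF cpt, of F "2 * (real k0 * C)"])
    show "norm (F n x) \<le> 2 * (real k0 * C)" if "x \<in> closure \<Omega>" for n x
      using norm_Pair_le[of "U n x" "V n x"] bU[OF that, of n] by (simp add: F_def)
    show "\<exists>d>0. \<forall>n y. y \<in> closure \<Omega> \<and> norm (x - y) < d \<longrightarrow> norm (F n x - F n y) < e" if "e > 0" for x e
    proof -
      have "(\<lambda>n. 2 * C * \<theta> ^ n) \<longlonglongrightarrow> 0"
        using \<theta> by (intro tendsto_mult_right_zero LIMSEQ_realpow_zero) auto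
      then obtain m where m: "2 * C * \<theta> ^ m < e"
        using order_tendstoD(2)[of _ 0 sequentially e] \<open>e > 0\<close> by (auto simp: eventually_sequentially)
      have "norm (F n x - F n y) < e" if "norm (x - y) < (1 / 2) ^ m" for n y
        using nF[of n x y] mod[of x y m n] m that by linarith
      then show ?thesis by (intro exI[of _ "(1 / 2) ^ m"]) auto
    qed
  qed blast
  define ui where "ui = (\<lambda>x. if x \<in> closure \<Omega> then fst (g' x) else 0)"
  define vi where "vi = (\<lambda>x. if x \<in> closure \<Omega> then snd (g' x) else 0)"
  have close: "\<bar>U (k n) x - ui x\<bar> < e \<and> \<bar>V (k n) x - vi x\<bar> < e"
    if "e > 0" and "\<And>x. x \<in> closure \<Omega> \<Longrightarrow> norm (F (k n) x - g' x) < e" for n x e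
  proof (cases "x \<in> closure \<Omega>")
    case True
    obtain a b where ab: "F (k n) x - g' x = (a, b)" by fastforce
    have "\<bar>fst (F (k n) x - g' x)\<bar> \<le> norm (F (k n) x - g' x)" "\<bar>snd (F (k n) x - g' x)\<bar> \<le> norm (F (k n) x - g' x)"
      using norm_fst_le[of a b] norm_snd_le[of b a] unfolding ab by auto
    then show ?thesis using that(2)[OF True] True by (simp add: F_def ui_def vi_def)
  next
    case False
    then have "x \<notin> \<Omega>" using closure_subset by blast
    then show ?thesis using False zero \<open>e > 0\<close> by (simp add: ui_def vi_def)
  qed
  have "\<exists>N. \<forall>n\<ge>N. \<forall>x. \<bar>U (k n) x - ui x\<bar> < e \<and> \<bar>V (k n) x - vi x\<bar> < e" if e: "e > 0" for e
  proof -
    obtain N where N: "\<forall>n x. n \<ge> N \<and> x \<in> closure \<Omega> \<longrightarrow> norm (F (k n) x - g' x) < e"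
      using conv[OF e] by blast
    show ?thesis by (intro exI[of _ N] allI impI close[OF e]) (use N in blast)
  qed
  then have "uniform_limit UNIV (\<lambda>n. U (k n)) ui sequentially" "uniform_limit UNIV (\<lambda>n. V (k n)) vi sequentially"
    unfolding uniform_limit_iff eventually_sequentially dist_real_def by blast+
  moreover have fk: "filterlim (\<lambda>n. k n + n0) at_top sequentially"
    using filterlim_subseq[OF k] by (rule filterlim_at_top_mono) auto
  moreover have "filterlim (\<lambda>n. P (k n + n0)) at_top sequentially"
    by (rule filterlim_compose[OF P fk])
  ultimately have "limit_data (\<lambda>n. P (k n + n0)) (\<lambda>n. U (k n)) (\<lambda>n. V (k n)) ui vi"
    using g U V unfolding limit_data_def P'_def by simp
  with fk show ?thesis by blast
qed

lemma limit_dataD: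
  assumes "limit_data Q U V ui vi"
  shows "filterlim Q at_top sequentially" "large_exponent (Q j)"
    "continuous_representative (u (Q j)) (U j)" "continuous_representative (v (Q j)) (V j)"
    "uniform_limit UNIV U ui sequentially" "uniform_limit UNIV V vi sequentially"
  using assms by (auto simp: limit_data_def)

lemma limit_data_basic:
  assumes ld: "limit_data Q U V ui vi"
  shows "continuous_on UNIV ui" "continuous_on UNIV vi"
    "\<And>x. x \<notin> \<Omega> \<Longrightarrow> ui x = 0" "\<And>x. x \<notin> \<Omega> \<Longrightarrow> vi x = 0" "\<And>x. ui x \<ge> 0" "\<And>x. vi x \<ge> 0"
proof -
  note l = limit_dataD[OF ld]
  note rf = continuous_eigenpair[OF l(2,3,4)]
  show c: "continuous_on UNIV ui" "continuous_on UNIV vi"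
    using rf(3,4) by (auto intro!: uniform_limit_theorem[OF _ l(5)] uniform_limit_theorem[OF _ l(6)])
  have t: "(\<lambda>j. U j x) \<longlonglongrightarrow> ui x" "(\<lambda>j. V j x) \<longlonglongrightarrow> vi x" for x
    using l(5,6) by (auto intro: tendsto_uniform_limitI)
  show "x \<notin> \<Omega> \<Longrightarrow> ui x = 0" "x \<notin> \<Omega> \<Longrightarrow> vi x = 0" for x
    using t[of x] rf(1,2) by (auto simp: LIMSEQ_const_iff)
  show "ui x \<ge> 0" "vi x \<ge> 0" for x
    using t[of x] rf(7,8) by (auto intro: tendsto_lowerbound[of _ _ sequentially])
qed

lemma limit_data_ratio:
  assumes "limit_data Q U V ui vi"
  shows "(\<lambda>j. \<alpha> (Q j) / Q j) \<longlonglongrightarrow> \<Gamma>" "(\<lambda>j. \<beta> (Q j) / Q j) \<longlonglongrightarrow> 1 - \<Gamma>"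
proof -
  note l = limit_dataD[OF assms]
  show a: "(\<lambda>j. \<alpha> (Q j) / Q j) \<longlonglongrightarrow> \<Gamma>" by (rule filterlim_compose[OF ratio l(1)])
  have "\<beta> (Q j) / Q j = 1 - \<alpha> (Q j) / Q j" for j
    using large_exponentD(1,6)[OF l(2)[of j]] by (simp add: field_simps)
  then show "(\<lambda>j. \<beta> (Q j) / Q j) \<longlonglongrightarrow> 1 - \<Gamma>" using tendsto_diff[OF tendsto_const a] by simp
qed

text \<open>Otherwise the coupling, which is 1, would be at most 1/2.\<close>

lemma coupling_point:
  assumes p: "large_exponent p" and U: "continuous_representative (u p) U" and V: "continuous_representative (v p) V"
  shows "\<exists>x\<in>\<Omega>. U x powr \<alpha> p * V x powr \<beta> p \<ge> 1 / (2 * measure lborel \<Omega>)"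
proof (rule ccontr)
  note rf = continuous_eigenpair[OF p U V] and d = domain_basic[OF dom]
  define c where "c = 1 / (2 * measure lborel \<Omega>)"
  assume "\<not> ?thesis"
  then have le: "U x powr \<alpha> p * V x powr \<beta> p \<le> c" if "x \<in> \<Omega>" for x using that by (force simp: c_def)
  have [measurable]: "U \<in> borel_measurable borel" "V \<in> borel_measurable borel"
    using rf(3,4) by (auto intro: borel_measurable_continuous_onI)
  have \<Omega>m: "\<Omega> \<in> sets borel" using d(1) by simp
  have fin: "emeasure lborel \<Omega> < \<infinity>" using emeasure_bounded_finite[OF d(2)] .
  have c0: "c \<ge> 0" by (simp add: c_def)
  have "1 = (\<integral>x. indicator \<Omega> x * (\<bar>U x\<bar> powr \<alpha> p * \<bar>V x\<bar> powr \<beta> p) \<partial>lborel)"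
    using rf(6) unfolding coupling_def by (subst (asm) integral_lebesgue_on_eq_lborel[OF d(1)]) auto
  also have "\<dots> \<le> (\<integral>x. c * indicator \<Omega> x \<partial>lborel)"
  proof (rule integral_mono')
    show "integrable lborel (\<lambda>x. c * indicator \<Omega> x)"
      using \<Omega>m fin by (intro integrable_mult_right) auto
  qed (use le rf(7,8) c0 in \<open>auto simp: indicator_def\<close>)
  also have "\<dots> = c * measure lborel \<Omega>" using \<Omega>m by simp
  \<comment> \<open>For measure zero, c is 0 by the convention for division, and the bound still
    holds.\<close>
  also have "\<dots> \<le> 1 / 2" by (cases "measure lborel \<Omega> = 0") (auto simp: c_def)
  finally show False by simp
qed

text \<open>The points of \<open>coupling_point\<close> accumulate in the closure, and the p-th root
  of their fixed lower bound \<open>c\<close> tends to 1.\<close>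

lemma limit_data_normalized:
  assumes ld: "limit_data Q U V ui vi"
  shows "\<exists>x\<in>\<Omega>. ui x powr \<Gamma> * vi x powr (1 - \<Gamma>) \<ge> 1"
proof -
  note l = limit_dataD[OF ld] and b = limit_data_basic[OF ld] and d = domain_basic[OF dom]
  note rf = continuous_eigenpair[OF l(2,3,4)]
  define c where "c = 1 / (2 * measure lborel \<Omega>)"
  have "emeasure lborel \<Omega> \<noteq> 0"
  proof
    assume "emeasure lborel \<Omega> = 0"
    then have "negligible \<Omega>" using d(1) by (simp add: negligible_iff_emeasure0)
    then show False using open_not_negligible d by blast
  qed
  then have "measure lborel \<Omega> > 0"
    using emeasure_bounded_finite[OF d(2)] by (simp add: measure_def enn2real_positive_iff zero_less_iff_neq_zero)
  then have c: "c > 0" by (simp add: c_def)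
  have "\<forall>j. \<exists>x\<in>\<Omega>. U j x powr \<alpha> (Q j) * V j x powr \<beta> (Q j) \<ge> c"
    unfolding c_def by (intro allI coupling_point[OF l(2,3,4)])
  then obtain x where x: "\<And>j. x j \<in> \<Omega>" "\<And>j. U j (x j) powr \<alpha> (Q j) * V j (x j) powr \<beta> (Q j) \<ge> c"
    by metis
  have "compact (closure \<Omega>)" using d(2) by (simp add: compact_closure)
  moreover have "\<forall>j. x j \<in> closure \<Omega>" using x(1) closure_subset by blast
  ultimately obtain z k where zk: "z \<in> closure \<Omega>" "strict_mono (k :: nat \<Rightarrow> nat)" "(x \<circ> k) \<longlonglongrightarrow> z"
    unfolding compact_def by blast
  have tu: "(\<lambda>j. U (k j) (x (k j))) \<longlonglongrightarrow> ui z" and tv: "(\<lambda>j. V (k j) (x (k j))) \<longlonglongrightarrow> vi z"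
    using uniform_limit_tendsto_along[OF uniform_limit_subseq[OF l(5) zk(2)] b(1) zk(3)]
      uniform_limit_tendsto_along[OF uniform_limit_subseq[OF l(6) zk(2)] b(2) zk(3)] by (auto simp: o_def)
  have ra: "(\<lambda>j. \<alpha> (Q (k j)) / Q (k j)) \<longlonglongrightarrow> \<Gamma>" and rb: "(\<lambda>j. \<beta> (Q (k j)) / Q (k j)) \<longlonglongrightarrow> 1 - \<Gamma>"
    using LIMSEQ_subseq_LIMSEQ[OF limit_data_ratio(1)[OF ld] zk(2)] LIMSEQ_subseq_LIMSEQ[OF limit_data_ratio(2)[OF ld] zk(2)]
    by (auto simp: o_def)
  have Qk: "filterlim (\<lambda>j. Q (k j)) at_top sequentially"
    using l(1) filterlim_subseq[OF zk(2)] by (rule filterlim_compose)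
  have "(\<lambda>j. c powr (1 / Q (k j))) \<longlonglongrightarrow> c powr 0"
    using c by (intro tendsto_intros tendsto_divide_0[OF tendsto_const] filterlim_at_top_imp_at_infinity Qk) auto
  \<comment> \<open>The limits of the bases may be 0; the limit exponents are positive, so the
    powers still converge.\<close>
  moreover have "(\<lambda>j. U (k j) (x (k j)) powr (\<alpha> (Q (k j)) / Q (k j)) * V (k j) (x (k j)) powr (\<beta> (Q (k j)) / Q (k j)))
      \<longlonglongrightarrow> ui z powr \<Gamma> * vi z powr (1 - \<Gamma>)"
    using \<Gamma> rf(7,8) by (intro tendsto_mult tendsto_powr' tu tv ra rb) auto
  moreover have "c powr (1 / Q (k j)) \<le> U (k j) (x (k j)) powr (\<alpha> (Q (k j)) / Q (k j)) * V (k j) (x (k j)) powr (\<beta> (Q (k j)) / Q (k j))" for j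
  proof -
    have "Q (k j) > 0" using large_exponentD(1)[OF l(2)[of "k j"]] by simp
    then have "c powr (1 / Q (k j)) \<le> (U (k j) (x (k j)) powr \<alpha> (Q (k j)) * V (k j) (x (k j)) powr \<beta> (Q (k j))) powr (1 / Q (k j))"
      using c x(2)[of "k j"] by (intro powr_mono2) auto
    then show ?thesis by (simp add: powr_mult powr_powr)
  qed
  ultimately have ge: "c powr 0 \<le> ui z powr \<Gamma> * vi z powr (1 - \<Gamma>)" by (intro LIMSEQ_le) auto
  moreover have "c powr 0 = 1" using c by simp
  \<comment> \<open>At a boundary point the limit product would be 0 and not at least 1.\<close>
  moreover have "z \<in> \<Omega>"
  proof (rule ccontr)
    assume "z \<notin> \<Omega>"
    then have "ui z = 0" by (rule b(3))
    then show False using ge c by simp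
  qed
  ultimately show ?thesis by auto
qed

lemma limit_data_holder:
  assumes ld: "limit_data Q U V ui vi" and K: "K > 0"
    and le: "\<exists>\<^sub>F j in sequentially. lam (Q j) powr (1 / Q j) \<le> K"
  shows "\<bar>ui x - ui y\<bar> \<le> K * norm (x - y) powr r" "\<bar>vi x - vi y\<bar> \<le> K * norm (x - y) powr s"
proof -
  note l = limit_dataD[OF ld]
  note rf = continuous_eigenpair[OF l(2,3,4)]
  have K': "lam (Q j) \<le> K powr Q j" if "lam (Q j) powr (1 / Q j) \<le> K" for j
  proof -
    have "lam (Q j) = (lam (Q j) powr (1 / Q j)) powr Q j"
      using lam_nonneg[OF l(2)] large_exponentD(1)[OF l(2)[of j]] by (simp add: powr_powr)
    also have "\<dots> \<le> K powr Q j" using that large_exponentD(1)[OF l(2)[of j]] by (intro powr_mono2) auto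
    finally show ?thesis .
  qed
  show "\<bar>ui x - ui y\<bar> \<le> K * norm (x - y) powr r"
  proof (rule holder_of_uniform_limit[OF rf(3) l(5,1) r(1) K])
    show "\<exists>\<^sub>F j in sequentially. seminorm_pow r (Q j) (U j) \<le> K powr Q j"
      using le by (rule frequently_elim1) (use K' rf(11) order_trans in blast)
  qed (rule W_tilde_continuousD[OF rf(9,3)])
  show "\<bar>vi x - vi y\<bar> \<le> K * norm (x - y) powr s"
  proof (rule holder_of_uniform_limit[OF rf(4) l(6,1) s(1) K])
    show "\<exists>\<^sub>F j in sequentially. seminorm_pow s (Q j) (V j) \<le> K powr Q j"
      using le by (rule frequently_elim1) (use K' rf(12) order_trans in blast)
  qed (rule W_tilde_continuousD[OF rf(10,4)])
qed

text \<open>The normalization makes the denominator of the quotient at least 1, so the Hoelder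
  constant alone bounds it.\<close>

lemma quotient_inf_le:
  assumes ld: "limit_data Q U V ui vi" and K: "K > 0"
    and hu: "\<And>x y. \<bar>ui x - ui y\<bar> \<le> K * norm (x - y) powr r"
    and hv: "\<And>x y. \<bar>vi x - vi y\<bar> \<le> K * norm (x - y) powr s"
  shows "admissible_inf \<Omega> r s ui vi" "quotient_inf \<Omega> r s \<Gamma> ui vi \<le> K"
proof -
  note b = limit_data_basic[OF ld]
  obtain x0 where x0: "x0 \<in> \<Omega>" "ui x0 powr \<Gamma> * vi x0 powr (1 - \<Gamma>) \<ge> 1"
    using limit_data_normalized[OF ld] by blast
  obtain y0 where y0: "y0 \<in> frontier \<Omega>" using frontier_nonempty[OF dom] by blast
  have ne: "x0 \<noteq> y0" using x0 y0 frontier_disjoint[OF dom] by blast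
  have cl: "x0 \<in> closure \<Omega>" "y0 \<in> closure \<Omega>" using x0 y0 closure_subset by (auto simp: frontier_def)
  have hq: "bdd_above (holder_quotients t \<Omega> w) \<and> holder_seminorm t \<Omega> w \<le> K"
    if "\<And>x y. \<bar>w x - w y\<bar> \<le> K * norm (x - y) powr t" for t w
  proof -
    have "q \<le> K" if "q \<in> holder_quotients t \<Omega> w" for q
      using that \<open>\<And>x y. \<bar>w x - w y\<bar> \<le> K * norm (x - y) powr t\<close>
      by (auto simp: holder_quotients_def divide_le_eq abs_minus_commute)
    moreover have "holder_quotients t \<Omega> w \<noteq> {}" using ne cl by (auto simp: holder_quotients_def)
    ultimately show ?thesis unfolding holder_seminorm_def by (auto intro!: bdd_aboveI[of _ K] cSup_least)
  qed
  have fr: "x \<in> frontier \<Omega> \<Longrightarrow> ui x = 0 \<and> vi x = 0" for x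
    using frontier_disjoint[OF dom, of x] b(3,4)[of x] by blast
  show adm: "admissible_inf \<Omega> r s ui vi"
    unfolding admissible_inf_def W_tilde_inf_def C0_closure_def
    using hq[OF hu] hq[OF hv] b(1,2) fr x0 by (auto intro: continuous_on_subset intro!: bexI[of _ x0])
  have "1 \<le> ui x0 powr \<Gamma> * vi x0 powr (1 - \<Gamma>)" by (rule x0)
  also have "\<dots> = \<bar>ui x0\<bar> powr \<Gamma> * \<bar>vi x0\<bar> powr (1 - \<Gamma>)" using b(5,6) by simp
  also have "\<dots> \<le> Linf_norm \<Omega> (\<lambda>x. \<bar>ui x\<bar> powr \<Gamma> * \<bar>vi x\<bar> powr (1 - \<Gamma>))"
    by (rule inradius_le_quotient_inf(3)[OF dom \<Gamma> r(1) s(1) adm x0(1)])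
  finally have L: "1 \<le> Linf_norm \<Omega> (\<lambda>x. \<bar>ui x\<bar> powr \<Gamma> * \<bar>vi x\<bar> powr (1 - \<Gamma>))" .
  have "quotient_inf \<Omega> r s \<Gamma> ui vi \<le> K / 1"
    unfolding quotient_inf_def using hq[OF hu] hq[OF hv] L K by (intro frac_le) auto
  then show "quotient_inf \<Omega> r s \<Gamma> ui vi \<le> K" by simp
qed

lemma Lam_le_quotient_inf: "admissible_inf \<Omega> r s a b \<Longrightarrow> Lam \<le> quotient_inf \<Omega> r s \<Gamma> a b"
  unfolding Lam_def by (rule inradius_le_quotient_inf(1)[OF dom \<Gamma> r(1) s(1)])

text \<open>For the lower bound, exponents along which the roots stay at or below some L < Lam would
  produce a limit pair whose quotient is smaller than \<open>Lam\<close>, which the inradius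
  estimate forbids.\<close>

lemma lam_root_tendsto: "((\<lambda>p. lam p powr (1 / p)) \<longlongrightarrow> Lam) at_top"
proof (rule order_tendstoI)
  fix L assume L: "L < Lam"
  \<comment> \<open>\<open>L\<close> may be negative, while the Hoelder estimate asks for a positive
    constant; the maximum is still below \<open>Lam\<close>.\<close>
  define K where "K = max L (Lam / 2)"
  have K: "0 < K" "K < Lam" "L \<le> K" using L Lam_pos by (auto simp: K_def)
  show "\<forall>\<^sub>F p in at_top. L < lam p powr (1 / p)"
  proof (rule ccontr)
    assume "\<not> ?thesis"
    then have "\<forall>n. \<exists>p\<ge>real n. lam p powr (1 / p) \<le> L"
      by (auto simp: eventually_at_top_linorder not_less)
    then obtain P where P: "\<And>n. P n \<ge> real n" "\<And>n. lam (P n) powr (1 / P n) \<le> L" by metis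
    have "filterlim P at_top sequentially"
      by (rule filterlim_at_top_mono[OF filterlim_real_sequentially]) (use P in auto)
    then obtain k U V ui vi where ld: "limit_data (\<lambda>j. P (k j)) U V ui vi" using compactness by blast
    have "\<exists>\<^sub>F j in sequentially. lam (P (k j)) powr (1 / P (k j)) \<le> K"
      using order_trans[OF P(2) K(3)] by (intro eventually_frequently always_eventually) auto
    note h = limit_data_holder[OF ld K(1) this]
    have "Lam \<le> K"
      using Lam_le_quotient_inf[OF quotient_inf_le(1)[OF ld K(1) h]] quotient_inf_le(2)[OF ld K(1) h] by linarith
    then show False using K by simp
  qed
next
  fix L assume "Lam < L" then show "\<forall>\<^sub>F p in at_top. lam p powr (1 / p) < L" by (rule eventually_lam_root_less)
qed

text \<open>The quotient of the limit pair is at most every K > Lam, hence at most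
  \<open>Lam\<close>; since no admissible pair does better, the infimum is attained.\<close>

lemma limit_data_minimizer:
  assumes ld: "limit_data Q U V ui vi"
  shows "minimizer_inf \<Omega> r s \<Gamma> ui vi" and "Lambda_inf \<Omega> r s \<Gamma> = Lam"
proof -
  note l = limit_dataD[OF ld]
  have lim: "(\<lambda>j. lam (Q j) powr (1 / Q j)) \<longlonglongrightarrow> Lam" by (rule filterlim_compose[OF lam_root_tendsto l(1)])
  have hK: "\<bar>ui x - ui y\<bar> \<le> K * norm (x - y) powr r \<and> \<bar>vi x - vi y\<bar> \<le> K * norm (x - y) powr s" if "K > Lam" for K x y
  proof -
    have "\<forall>\<^sub>F j in sequentially. lam (Q j) powr (1 / Q j) \<le> K"
      using order_tendstoD(2)[OF lim that] by eventually_elim simp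
    then have fr: "\<exists>\<^sub>F j in sequentially. lam (Q j) powr (1 / Q j) \<le> K" by (rule eventually_frequently[rotated]) simp
    show ?thesis using limit_data_holder[OF ld _ fr] Lam_pos that by auto
  qed
  have K: "quotient_inf \<Omega> r s \<Gamma> ui vi \<le> K" "admissible_inf \<Omega> r s ui vi" if "K > Lam" for K
    using quotient_inf_le[OF ld, of K] hK[OF that] Lam_pos that by auto
  have adm: "admissible_inf \<Omega> r s ui vi" using K(2)[of "Lam + 1"] by simp
  have "quotient_inf \<Omega> r s \<Gamma> ui vi \<le> Lam" by (rule dense_ge) (rule K(1))
  then have q: "quotient_inf \<Omega> r s \<Gamma> ui vi = Lam" using Lam_le_quotient_inf[OF adm] by simp
  show L: "Lambda_inf \<Omega> r s \<Gamma> = Lam"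
    unfolding Lambda_inf_def
  proof (rule cInf_eq_minimum)
    show "Lam \<in> {quotient_inf \<Omega> r s \<Gamma> a b |a b. admissible_inf \<Omega> r s a b}"
      using q[symmetric] adm by blast
  qed (use Lam_le_quotient_inf in auto)
  show "minimizer_inf \<Omega> r s \<Gamma> ui vi" unfolding minimizer_inf_def using adm q L by simp
qed

end

section \<open>Weak formulation and touching test functions\<close>

text \<open>Half of the usual fractional p-Laplacian, as a plain integral in place of a principal
  value. It is evaluated only where p - 1 >= N + t p and \<psi> is Lipschitz with bounded
  oscillation, so that it converges absolutely.\<close>

definition nonlocal_op :: "real \<Rightarrow> real \<Rightarrow> ('a::euclidean_space \<Rightarrow> real) \<Rightarrow> 'a \<Rightarrow> real" where
  "nonlocal_op t p \<psi> x = (\<integral>y. signed_powr p (\<psi> x - \<psi> y) / norm (x - y) powr (real DIM('a) + t * p) \<partial>lborel)"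

lemma abs_nonlocal_kernel_le:
  fixes \<psi> :: "'a::euclidean_space \<Rightarrow> real"
  assumes "\<bar>\<psi> x - \<psi> y\<bar> \<le> L * norm (x - y)" "\<bar>\<psi> x - \<psi> y\<bar> \<le> M" "p \<ge> 1"
  shows "\<bar>signed_powr p (\<psi> x - \<psi> y) / norm (x - y) powr (real DIM('a) + t * p)\<bar> \<le> trunc_kernel L M (p - 1) (t * p) (x - y)"
proof -
  have "\<bar>\<psi> x - \<psi> y\<bar> powr (p - 1) \<le> min (L * norm (x - y)) M powr (p - 1)"
    using assms by (intro powr_mono2) auto
  then show ?thesis by (auto simp: trunc_kernel_def abs_signed_powr intro: divide_right_mono)
qed

text \<open>If f > 2 g held on the whole ball, testing with the positive part \<open>w\<close> of
  \<psi> - U would contradict the monotonicity of the form unless w = 0. The factor 2 arises because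
  the symmetric double integral counts each pair twice.\<close>

lemma weak_comparison:
  fixes U \<psi> f :: "'a::euclidean_space \<Rightarrow> real"
  assumes \<Omega>: "open \<Omega>" "bounded \<Omega>" and t: "0 < t" and p: "p > 1" "p - 1 \<ge> real DIM('a) + t * p"
    and U: "U \<in> W_tilde t p \<Omega>" "continuous_on UNIV U"
    and L: "\<And>x y. \<bar>\<psi> x - \<psi> y\<bar> \<le> L * norm (x - y)" "L \<ge> 0" and M: "\<And>x y. \<bar>\<psi> x - \<psi> y\<bar> \<le> M" "M \<ge> 0"
    and B: "ball x0 \<rho> \<subseteq> \<Omega>" and le: "\<And>x. x \<notin> ball x0 \<rho> \<Longrightarrow> \<psi> x \<le> U x" and x1: "\<psi> x1 > U x1"
    and f: "f \<in> borel_measurable borel" "\<And>x. x \<in> \<Omega> \<Longrightarrow> \<bar>f x\<bar> \<le> Kf"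
    and weak: "\<And>w. w \<in> W_tilde t p \<Omega> \<Longrightarrow> frac_form t p U w = (\<integral>x. f x * w x \<partial>lebesgue_on \<Omega>)"
  shows "\<exists>x\<in>ball x0 \<rho>. f x \<le> 2 * nonlocal_op t p \<psi> x"
proof (rule ccontr)
  define D where "D = real DIM('a) + t * p"
  define B where "B = ball x0 \<rho>"
  have Bb: "B \<in> sets borel" "bounded B" by (auto simp: B_def)
  define w where "w = (\<lambda>x. max 0 (\<psi> x - U x))"
  define g where "g = nonlocal_op t p \<psi>"
  assume "\<not> ?thesis"
  then have neg: "2 * g x < f x" if "x \<in> B" for x using that by (auto simp: g_def B_def not_le)
  have c\<psi>: "continuous_on UNIV \<psi>"
  proof (rule continuous_onI)
    fix x :: 'a and e :: real assume e: "e > 0"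
    show "\<exists>d>0. \<forall>x'\<in>UNIV. dist x' x < d \<longrightarrow> dist (\<psi> x') (\<psi> x) \<le> e"
    proof (intro exI[of _ "e / (L + 1)"] conjI ballI impI)
      fix x' assume "dist x' x < e / (L + 1)"
      then have "(L + 1) * norm (x' - x) \<le> e" using L(2) by (simp add: dist_norm field_simps)
      moreover have "L * norm (x' - x) \<le> (L + 1) * norm (x' - x)" by (simp add: algebra_simps)
      ultimately show "dist (\<psi> x') (\<psi> x) \<le> e" using L(1)[of x' x] by (simp add: dist_real_def)
    qed (use e L in auto)
  qed
  have cw: "continuous_on UNIV w" unfolding w_def by (intro continuous_on_max continuous_on_diff continuous_on_const c\<psi> U)
  have w0: "w x \<ge> 0" for x by (simp add: w_def)
  have wB: "w x = 0" if "x \<notin> B" for x using le[of x] that by (simp add: w_def B_def)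
  have w\<Omega>: "w x = 0" if "x \<notin> \<Omega>" for x using wB[of x] B that unfolding B_def by blast
  have [measurable]: "\<psi> \<in> borel_measurable borel" "w \<in> borel_measurable borel" "U \<in> borel_measurable borel" "f \<in> borel_measurable borel"
    using c\<psi> cw U f by (auto intro: borel_measurable_continuous_onI)
  have "bounded (w ` closure B)"
    using Bb cw by (intro compact_imp_bounded compact_continuous_image) (auto simp: compact_closure intro: continuous_on_subset)
  then obtain Kw where Kw': "\<And>x. x \<in> closure B \<Longrightarrow> \<bar>w x\<bar> \<le> Kw" by (auto simp: bounded_iff)
  have Kw: "\<bar>w x\<bar> \<le> Kw * indicator B x" for x
    using Kw'[of x] wB[of x] closure_subset[of B] by (auto simp: indicator_def)
  have ifU: "integrable lborel (frac_quotient t p U)" by (rule W_tilde_continuousD[OF U])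
  have p': "p \<ge> real DIM('a) + t * p" using p by linarith
  have tp: "t * p > 0" using t p by simp
  have k: "integrable lborel (trunc_kernel L M p (t * p) :: 'a \<Rightarrow> real)"
    using L M p' tp by (intro integrable_trunc_kernel) auto
  have ifw: "integrable lborel (frac_quotient t p w)"
  proof (rule Bochner_Integration.integrable_bound)
    \<comment> \<open>Differences of \<open>w\<close> are controlled by those of \<psi> and
      \<open>U\<close>. Those of \<psi> are integrable only near the ball, which suffices since
      \<open>w\<close> vanishes outside it.\<close>
    define b where "b = (\<lambda>q. 2 powr p * (2 powr p * ((case q of (x, y) \<Rightarrow> indicator B x * trunc_kernel L M p (t * p) (x - y)) +
      (case q of (x, y) \<Rightarrow> indicator B y * trunc_kernel L M p (t * p) (x - y))) + frac_quotient t p U q))"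
    show "integrable lborel b"
      unfolding b_def by (intro integrable_mult_right Bochner_Integration.integrable_add integrable_pair_indicator_diff k Bb ifU)
    have "frac_quotient t p w q \<le> b q" for q
    proof -
      obtain x y where q: "q = (x, y)" by fastforce
      let ?m = "(indicator B x + indicator B y) * min (L * norm (x - y)) M"
      have m0: "?m \<ge> 0" using L M by (intro mult_nonneg_nonneg) auto
      have "\<bar>w x - w y\<bar> \<le> ?m + \<bar>U x - U y\<bar>"
      proof (cases "x \<in> B \<or> y \<in> B")
        case True
        have "\<bar>w x - w y\<bar> \<le> \<bar>\<psi> x - \<psi> y\<bar> + \<bar>U x - U y\<bar>" unfolding w_def by linarith
        moreover have "\<bar>\<psi> x - \<psi> y\<bar> \<le> min (L * norm (x - y)) M" using L(1) M(1) by simp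
        moreover have "min (L * norm (x - y)) M \<le> ?m" using True L M by (auto simp: indicator_def)
        ultimately show ?thesis by linarith
      qed (use wB m0 in auto)
      then have "\<bar>w x - w y\<bar> powr p \<le> (?m + \<bar>U x - U y\<bar>) powr p" using p by (intro powr_mono2) auto
      also have "\<dots> \<le> 2 powr p * (?m powr p + \<bar>U x - U y\<bar> powr p)"
        using m0 p by (intro add_powr_le) auto
      finally have "frac_quotient t p w q \<le> 2 powr p * (?m powr p + \<bar>U x - U y\<bar> powr p) / norm (x - y) powr D"
        by (auto simp: q frac_quotient_def D_def intro!: divide_right_mono)
      also have "\<dots> = 2 powr p * (?m powr p / norm (x - y) powr D + frac_quotient t p U q)"
        by (simp only: q frac_quotient_def D_def prod.case add_divide_distrib[symmetric] times_divide_eq_right)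
      also have "\<dots> \<le> b q"
        unfolding b_def q prod.case D_def using local_kernel_bound[of p L M B x y t] L M p
        by (intro mult_left_mono add_right_mono) auto
      finally show ?thesis .
    qed
    then show "AE q in lborel. norm (frac_quotient t p w q) \<le> norm (b q)"
      by (intro AE_I2) (metis abs_ge_self abs_of_nonneg frac_quotient_nonneg order_trans real_norm_def)
  qed (use borel_measurable_frac_quotient[of w] in auto)
  have wW: "w \<in> W_tilde t p \<Omega>"
    using \<Omega> p cw ifw w\<Omega> by (intro W_tilde_continuousI) auto
  define G where "G = (\<lambda>x y. signed_powr p (\<psi> x - \<psi> y) / norm (x - y) powr D)"
  have Gle: "\<bar>G x y\<bar> \<le> trunc_kernel L M (p - 1) (t * p) (x - y)" for x y
    unfolding G_def D_def using L M p by (intro abs_nonlocal_kernel_le) auto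
  have Ganti: "G y x = - G x y" for x y
    using signed_powr_minus[of p "\<psi> x - \<psi> y"] by (simp add: G_def norm_minus_commute)
  have k': "integrable lborel (trunc_kernel L M (p - 1) (t * p) :: 'a \<Rightarrow> real)"
    using L M p tp by (intro integrable_trunc_kernel) auto
  have [measurable]: "(\<lambda>(x, y). G x y) \<in> borel_measurable (borel \<Otimes>\<^sub>M borel)"
    unfolding G_def by measurable
  \<comment> \<open>The form of \<psi> against \<open>w\<close> is split as G(x,y) w(x) - G(x,y)
    w(y). Each part is integrable by itself, and since \<open>G\<close> is antisymmetric the second
    is minus the reflection of the first.\<close>
  define h1 where "h1 = (\<lambda>(x, y). G x y * w x)"
  define h2 where "h2 = (\<lambda>(x, y). G x y * w y)"
  have hm: "h1 \<in> borel_measurable (borel \<Otimes>\<^sub>M borel)" unfolding h1_def by measurable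
  have h1i: "integrable lborel h1"
  proof (rule Bochner_Integration.integrable_bound)
    show "integrable lborel (\<lambda>q. Kw * (case q of (x, y) \<Rightarrow> indicator B x * trunc_kernel L M (p - 1) (t * p) (x - y)))"
      by (intro integrable_mult_right integrable_pair_indicator_diff k' Bb)
    have "\<bar>G x y * w x\<bar> \<le> trunc_kernel L M (p - 1) (t * p) (x - y) * (Kw * indicator B x)" for x y
      unfolding abs_mult using Gle Kw by (intro mult_mono) auto
    then show "AE q in lborel. norm (h1 q) \<le> norm (Kw * (case q of (x, y) \<Rightarrow> indicator B x * trunc_kernel L M (p - 1) (t * p) (x - y)))"
      by (intro AE_I2) (auto simp: h1_def mult_ac intro: order_trans[OF _ abs_ge_self])
  qed (use hm in \<open>simp add: borel_prod\<close>)
  have h1i': "integrable (lborel \<Otimes>\<^sub>M lborel) h1" using h1i by (simp add: lborel_prod)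
  have sw: "integrable (lborel \<Otimes>\<^sub>M lborel) (\<lambda>(x, y). h1 (y, x))" "(\<integral>(x, y). h1 (y, x) \<partial>(lborel \<Otimes>\<^sub>M lborel)) = integral\<^sup>L lborel h1"
    using lborel_pair.integrable_product_swap[OF h1i'] lborel_pair.integral_product_swap[of h1] hm
    by (auto simp: lborel_prod borel_prod)
  have "h2 q = - (case q of (x, y) \<Rightarrow> h1 (y, x))" for q
    using Ganti[of "fst q" "snd q"] by (cases q) (simp add: h1_def h2_def)
  then have h2m: "h2 = (\<lambda>q. - (case q of (x, y) \<Rightarrow> h1 (y, x)))" ..
  have h2i: "integrable lborel h2" and h2v: "integral\<^sup>L lborel h2 = - integral\<^sup>L lborel h1"
    using sw unfolding h2m by (simp_all add: lborel_prod)
  have "g x = (\<integral>y. G x y \<partial>lborel)" for x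
    by (simp add: g_def nonlocal_op_def G_def D_def)
  then have gx: "(\<integral>y. h1 (x, y) \<partial>lborel) = w x * g x" for x by (simp add: h1_def)
  have h1v: "integral\<^sup>L lborel h1 = (\<integral>x. w x * g x \<partial>lborel)"
    using lborel_pair.integral_fst'[OF h1i'] by (simp add: gx lborel_prod)
  have wgi: "integrable lborel (\<lambda>x. w x * g x)"
    using lborel_pair.integrable_fst'[OF h1i'] by (simp add: gx)
  have "frac_form t p U w = integral\<^sup>L lborel (form_density t p U w)"
    using borel_measurable_form_density[of U w t p] by (simp add: frac_form_eq integral_completion)
  also have "\<dots> \<le> integral\<^sup>L lborel (\<lambda>q. h1 q - h2 q)"
  proof (rule integral_mono)
    show "integrable lborel (form_density t p U w)"
      using p by (intro integrable_form_density ifU ifw) auto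
    show "integrable lborel (\<lambda>q. h1 q - h2 q)" by (intro Bochner_Integration.integrable_diff h1i h2i)
    fix q :: "'a \<times> 'a"
    obtain x y where q: "q = (x, y)" by fastforce
    \<comment> \<open>Where w x > w y, the point x lies in the set \<psi> > U, and the difference of
      \<psi> there exceeds that of \<open>U\<close>; the case w x < w y is symmetric.\<close>
    have "signed_powr p (U x - U y) * (w x - w y) \<le> signed_powr p (\<psi> x - \<psi> y) * (w x - w y)"
    proof -
      consider "w x = w y" | "w x > w y" | "w x < w y" by linarith
      then show ?thesis
      proof cases
        case 2
        then have "U x - U y \<le> \<psi> x - \<psi> y" unfolding w_def by linarith
        then show ?thesis using 2 p by (intro mult_right_mono signed_powr_mono) auto
      next
        case 3
        then have "\<psi> x - \<psi> y \<le> U x - U y" unfolding w_def by linarith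
        then show ?thesis using 3 p by (intro mult_right_mono_neg signed_powr_mono) auto
      qed simp
    qed
    then have "form_density t p U w q \<le> signed_powr p (\<psi> x - \<psi> y) * (w x - w y) / norm (x - y) powr D"
      unfolding q form_density_def D_def by (auto intro: divide_right_mono)
    also have "\<dots> = h1 q - h2 q" by (simp add: q h1_def h2_def G_def algebra_simps diff_divide_distrib)
    finally show "form_density t p U w q \<le> h1 q - h2 q" .
  qed
  also have "\<dots> = 2 * (\<integral>x. w x * g x \<partial>lborel)"
    using h1i h2i by (simp add: Bochner_Integration.integral_diff h2v h1v)
  finally have main: "(\<integral>x. indicator \<Omega> x * (f x * w x) \<partial>lborel) \<le> 2 * (\<integral>x. w x * g x \<partial>lborel)"
    unfolding weak[OF wW] by (subst (asm) integral_lebesgue_on_eq_lborel[OF \<Omega>(1)]) auto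
  have fwi: "integrable lborel (\<lambda>x. indicator \<Omega> x * (f x * w x))"
  proof (rule integrable_indicator_bounded[where K = "Kf * (Kw * 1)"])
    have "Kw \<ge> 0" using Kw[of x1] x1 by (cases "x1 \<in> B") (auto simp: w_def)
    then have "\<bar>w x\<bar> \<le> Kw * 1" for x using Kw[of x] by (cases "x \<in> B") auto
    then show "\<bar>f x * w x\<bar> \<le> Kf * (Kw * 1)" if "x \<in> \<Omega>" for x
      unfolding abs_mult using f(2)[OF that] by (intro mult_mono) auto
  qed (use \<Omega> in auto)
  \<comment> \<open>Nonnegative, because f > 2 g wherever \<open>w\<close> is positive, yet with
    nonpositive integral: hence zero almost everywhere.\<close>
  define q where "q = (\<lambda>x. indicator \<Omega> x * (f x * w x) - 2 * (w x * g x))"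
  have qi: "integrable lborel q" unfolding q_def using fwi wgi by auto
  have qeq: "q x = w x * (f x - 2 * g x)" for x
    using w\<Omega>[of x] by (auto simp: q_def indicator_def algebra_simps)
  have q0: "q x \<ge> 0" for x
    unfolding qeq using neg[of x] wB[of x] w0[of x] by (cases "x \<in> B") auto
  have "integral\<^sup>L lborel q \<le> 0"
    unfolding q_def using fwi wgi main by (simp add: Bochner_Integration.integral_diff)
  moreover have "integral\<^sup>L lborel q \<ge> 0" using q0 by (intro Bochner_Integration.integral_nonneg) auto
  ultimately have "AE x in lborel. q x = 0"
    using integral_nonneg_eq_0_iff_AE[OF qi] q0 by simp
  moreover have wq: "w x = 0" if "q x = 0" for x
    using that neg[of x] wB[of x] by (cases "x \<in> B") (auto simp: qeq)
  ultimately have "AE x in lborel. x \<notin> w -` {0<..}" by (auto elim!: eventually_mono dest: wq)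
  then have "AE x in lebesgue. x \<notin> w -` {0<..}" by (rule AE_completion)
  moreover have "open (w -` {0<..})" using cw by (intro open_vimage) auto
  ultimately have "w -` {0<..} = {}" using open_AE_notin_empty by blast
  moreover have "x1 \<in> w -` {0<..}" using x1 by (simp add: w_def)
  ultimately show False by blast
qed

text \<open>Positive differences are at most S |x - y|^t, which extracts S^(p - p0) from a kernel of
  fixed exponent \<open>p0\<close>. Negative differences help; they are kept only on
  \<open>E\<close>, where they give the rate \<sigma>^(p-1), and are discarded elsewhere.\<close>

lemma nonlocal_op_le:
  fixes \<psi> :: "'a::euclidean_space \<Rightarrow> real"
  assumes t: "0 < t" "t < 1" and p0: "p0 > 1" "p0 - 1 \<ge> real DIM('a) + t * p0" and p: "p0 \<le> p"
    and \<psi>: "\<psi> \<in> borel_measurable borel"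
    and L: "\<And>y. \<bar>\<psi> x - \<psi> y\<bar> \<le> L * norm (x - y)" "L \<ge> 0" and M: "\<And>y. \<bar>\<psi> x - \<psi> y\<bar> \<le> M" "M \<ge> 0"
    and S: "S \<ge> 0" "\<And>y. \<psi> x - \<psi> y \<le> S * norm (x - y) powr t"
    and E: "E \<in> sets borel" "bounded E" and \<sigma>: "\<sigma> > 0"
    and low: "\<And>y. y \<in> E \<Longrightarrow> \<psi> y - \<psi> x \<ge> \<sigma> * norm (x - y) powr t" "\<And>y. y \<in> E \<Longrightarrow> x \<noteq> y \<and> norm (x - y) \<le> D"
  shows "nonlocal_op t p \<psi> x \<le> S powr (p - p0) * integral\<^sup>L lborel (trunc_kernel L M (p0 - 1) (t * p0) :: 'a \<Rightarrow> real)
     - \<sigma> powr (p - 1) * D powr - (real DIM('a) + t) * measure lborel E"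
proof -
  let ?N = "real DIM('a)"
  define H where "H = (\<lambda>y. S powr (p - p0) * trunc_kernel L M (p0 - 1) (t * p0) (x - y)
     - \<sigma> powr (p - 1) * D powr - (?N + t) * indicator E y)"
  note [measurable] = \<psi>
  have "(1 - t) * p0 \<le> (1 - t) * p" using t p by (intro mult_left_mono) auto
  then have pp: "p - 1 \<ge> ?N + t * p" using p0 by (simp add: algebra_simps)
  have tp: "t * p > 0" "t * p0 > 0" using t p p0 by auto
  have k0: "integrable lborel (trunc_kernel L M (p0 - 1) (t * p0) :: 'a \<Rightarrow> real)"
    using L M p0 tp by (intro integrable_trunc_kernel) auto
  have k: "integrable lborel (trunc_kernel L M (p - 1) (t * p) :: 'a \<Rightarrow> real)"
    using L M pp tp by (intro integrable_trunc_kernel) auto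
  have Ei: "integrable lborel (\<lambda>y. indicator E y :: real)" using E emeasure_bounded_finite[OF E(2)] by auto
  have Hi: "integrable lborel H"
    unfolding H_def using integrable_lborel_reflect(1)[OF k0, of x] Ei
    by (intro Bochner_Integration.integrable_diff integrable_mult_right) auto
  have "nonlocal_op t p \<psi> x \<le> integral\<^sup>L lborel H"
    unfolding nonlocal_op_def
  proof (rule integral_mono)
    show "integrable lborel (\<lambda>y. signed_powr p (\<psi> x - \<psi> y) / norm (x - y) powr (?N + t * p))"
    proof (rule Bochner_Integration.integrable_bound[OF integrable_lborel_reflect(1)[OF k, of x]])
      show "AE y in lborel. norm (signed_powr p (\<psi> x - \<psi> y) / norm (x - y) powr (?N + t * p))
          \<le> norm (trunc_kernel L M (p - 1) (t * p) (x - y))"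
        using abs_nonlocal_kernel_le[where \<psi> = \<psi> and x = x, OF L(1) M(1), where p = p and t = t] p p0 by (intro AE_I2) auto
    qed measurable
    show "signed_powr p (\<psi> x - \<psi> y) / norm (x - y) powr (?N + t * p) \<le> H y" for y
    proof (cases "y \<in> E")
      case True
      let ?n = "norm (x - y)"
      have n: "?n > 0" "?n \<le> D" using low(2)[OF True] by auto
      have s: "0 \<le> \<sigma> * ?n powr t" using \<sigma> by simp
      have neg: "\<psi> x - \<psi> y \<le> 0" using low(1)[OF True] s by linarith
      have "\<sigma> powr (p - 1) * ?n powr (t * (p - 1)) = (\<sigma> * ?n powr t) powr (p - 1)"
        using \<sigma> by (simp add: powr_mult powr_powr)
      also have "\<dots> \<le> (- (\<psi> x - \<psi> y)) powr (p - 1)"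
        using low(1)[OF True] s p p0 by (intro powr_mono2) auto
      finally have "signed_powr p (\<psi> x - \<psi> y) \<le> - (\<sigma> powr (p - 1) * ?n powr (t * (p - 1)))"
        unfolding signed_powr_neg[OF neg] by simp
      then have "signed_powr p (\<psi> x - \<psi> y) / ?n powr (?N + t * p) \<le> - (\<sigma> powr (p - 1) * ?n powr (t * (p - 1))) / ?n powr (?N + t * p)"
        by (rule divide_right_mono) auto
      also have "\<dots> = - (\<sigma> powr (p - 1) * (?n powr (t * (p - 1)) / ?n powr (?N + t * p)))" by simp
      \<comment> \<open>The remaining power of the distance is independent of p, so its bound
        through \<open>D\<close> is uniform.\<close>
      also have "?n powr (t * (p - 1)) / ?n powr (?N + t * p) = ?n powr - (?N + t)"
        by (simp add: algebra_simps flip: powr_diff)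
      also have "- (\<sigma> powr (p - 1) * ?n powr - (?N + t)) \<le> - (\<sigma> powr (p - 1) * D powr - (?N + t))"
        using n t by (intro le_imp_neg_le mult_left_mono powr_mono2') auto
      also have "\<dots> \<le> H y" using True by (simp add: H_def)
      finally show ?thesis .
    next
      case False
      show ?thesis
      proof (cases "\<psi> x - \<psi> y \<le> 0")
        case True
        then have "signed_powr p (\<psi> x - \<psi> y) \<le> 0" by (simp add: signed_powr_neg)
        then have "signed_powr p (\<psi> x - \<psi> y) / norm (x - y) powr (?N + t * p) \<le> 0" by (simp add: divide_nonpos_nonneg)
        also have "0 \<le> H y" using False by (simp add: H_def)
        finally show ?thesis .
      next
        case pos: False
        then have n: "norm (x - y) > 0" by auto
        let ?n = "norm (x - y)" and ?d = "\<psi> x - \<psi> y"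
        \<comment> \<open>The factor with exponent p - p0 takes the Hoelder bound, the one with
          exponent p0 - 1 the Lipschitz and oscillation bounds.\<close>
        have "signed_powr p ?d = ?d powr (p - p0) * ?d powr (p0 - 1)"
          using pos by (simp add: signed_powr_pos flip: powr_add)
        also have "\<dots> \<le> (S * ?n powr t) powr (p - p0) * min (L * ?n) M powr (p0 - 1)"
          using pos S p p0 L(1)[of y] M(1)[of y] by (intro mult_mono powr_mono2) auto
        also have "\<dots> = S powr (p - p0) * ?n powr (t * (p - p0)) * min (L * ?n) M powr (p0 - 1)"
          using S by (simp add: powr_mult powr_powr)
        finally have "signed_powr p ?d / ?n powr (?N + t * p) \<le>
            S powr (p - p0) * ?n powr (t * (p - p0)) * min (L * ?n) M powr (p0 - 1) / ?n powr (?N + t * p)"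
          by (rule divide_right_mono) auto
        also have "\<dots> = H y"
        proof -
          have E: "?n powr (?N + t * p) = ?n powr (t * (p - p0)) * ?n powr (?N + t * p0)"
            by (simp add: algebra_simps flip: powr_add)
          show ?thesis unfolding E using False n by (simp add: H_def trunc_kernel_def)
        qed
        finally show ?thesis .
      qed
    qed
  qed (rule Hi)
  also have "integral\<^sup>L lborel H = S powr (p - p0) * integral\<^sup>L lborel (trunc_kernel L M (p0 - 1) (t * p0) :: 'a \<Rightarrow> real)
     - \<sigma> powr (p - 1) * D powr - (?N + t) * measure lborel E"
    unfolding H_def using integrable_lborel_reflect[OF k0, of x] Ei E
    by (subst Bochner_Integration.integral_diff) auto
  finally show ?thesis .
qed

section \<open>Strict touching and stability of difference quotients\<close>

lemma lipschitz_bounded_imp_holder: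
  fixes \<phi> :: "'a::real_normed_vector \<Rightarrow> real"
  assumes "0 < t" "t \<le> 1" "\<bar>\<phi> x - \<phi> y\<bar> \<le> L * norm (x - y)" "\<bar>\<phi> x - \<phi> y\<bar> \<le> M" "L \<ge> 0" "M \<ge> 0"
  shows "\<bar>\<phi> x - \<phi> y\<bar> \<le> max L M * norm (x - y) powr t"
proof (cases "norm (x - y) \<le> 1")
  case True
  have "L * norm (x - y) \<le> L * norm (x - y) powr t"
    using powr_mono'[of t 1 "norm (x - y)"] True assms by (intro mult_left_mono) auto
  also have "\<dots> \<le> max L M * norm (x - y) powr t" by (intro mult_right_mono) auto
  finally show ?thesis using assms by linarith
next
  case False
  have "M * 1 \<le> max L M * norm (x - y) powr t"
    using ge_one_powr_ge_zero[of "norm (x - y)" t] False assms by (intro mult_mono) auto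
  then show ?thesis using assms by linarith
qed

text \<open>The function \<open>min (|x - x0|\<^sup>2) 1\<close> makes a touching strict without changing the
  supremum of the difference quotients at \<open>x0\<close> by more than its coefficient.\<close>

definition bump :: "'a::euclidean_space \<Rightarrow> 'a \<Rightarrow> real" where
  "bump x0 x = min ((norm (x - x0))\<^sup>2) 1"

lemma bump_bounds: "0 \<le> bump x0 x" "bump x0 x \<le> 1"
  by (auto simp: bump_def)

lemma bump_center: "bump x0 x0 = 0"
  by (simp add: bump_def)

lemma bump_lipschitz: "\<bar>bump x0 x - bump x0 y\<bar> \<le> 2 * norm (x - y)"
proof -
  define a where "a = norm (x - x0)"
  define b where "b = norm (y - x0)"
  have d: "\<bar>a - b\<bar> \<le> norm (x - y)"
    using norm_triangle_ineq3[of "x - x0" "y - x0"] by (simp add: a_def b_def)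
  define a' where "a' = min a 1"
  define b' where "b' = min b 1"
  have nn: "0 \<le> a" "0 \<le> b" by (auto simp: a_def b_def)
  \<comment> \<open>Truncating before squaring turns the difference into a product of a difference
    and a sum of numbers in [0, 1].\<close>
  have e: "min (c\<^sup>2) 1 = (min c 1)\<^sup>2" if "0 \<le> c" for c :: real
  proof (cases "c \<le> 1")
    case True
    then show ?thesis using that power_le_one[of c 2] by (simp add: min_def)
  next
    case False
    then have "1 < c\<^sup>2" by (intro one_less_power) auto
    then have "min (c\<^sup>2) 1 = 1" "min c 1 = 1" using False by (simp_all add: min_absorb2)
    then show ?thesis by simp
  qed
  have "bump x0 x - bump x0 y = (a' - b') * (a' + b')"
    using e[OF nn(1)] e[OF nn(2)] by (simp add: bump_def a_def b_def a'_def b'_def power2_eq_square algebra_simps)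
  then have "\<bar>bump x0 x - bump x0 y\<bar> = \<bar>a' - b'\<bar> * \<bar>a' + b'\<bar>" by (simp add: abs_mult)
  also have "\<dots> \<le> norm (x - y) * 2"
    using d nn by (intro mult_mono) (auto simp: a'_def b'_def)
  finally show ?thesis by simp
qed

lemma bump_le_powr:
  assumes "0 < t" "t \<le> 1"
  shows "bump x0 x \<le> norm (x - x0) powr t"
proof (cases "norm (x - x0) \<le> 1")
  case True
  have "bump x0 x \<le> norm (x - x0) powr 2" by (simp add: bump_def)
  also have "\<dots> \<le> norm (x - x0) powr t" using True assms by (intro powr_mono') auto
  finally show ?thesis .
next
  case False
  then have "1 \<le> norm (x - x0) powr t" using assms by (intro ge_one_powr_ge_zero) auto
  then show ?thesis using bump_bounds(2)[of x0 x] by linarith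
qed

lemma add_powr_le_add:
  fixes a b t :: real
  assumes "a \<ge> 0" "b \<ge> 0" "0 < t" "t \<le> 1"
  shows "(a + b) powr t \<le> a powr t + b powr t"
  using powr_diff_le_powr[of b "a + b" t] assms by simp

text \<open>For near \<open>y\<close> the Lipschitz bound wins because t < 1. For \<open>y\<close>
  farther than \<tau>, moving the base point costs at most L \<rho> + S' \<rho>^t, which the slack
  (S - S') \<tau>^t pays for.\<close>

lemma holder_quotient_usc:
  fixes \<psi> :: "'a::euclidean_space \<Rightarrow> real"
  assumes t: "0 < t" "t < 1" and L: "\<And>x y. \<bar>\<psi> x - \<psi> y\<bar> \<le> L * norm (x - y)" "L \<ge> 0"
    and S': "0 \<le> S'" "S' < S" "\<And>y. \<psi> x0 - \<psi> y \<le> S' * norm (x0 - y) powr t"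
  shows "\<exists>\<rho>>0. \<forall>x\<in>ball x0 \<rho>. \<forall>y. \<psi> x - \<psi> y \<le> S * norm (x - y) powr t"
proof -
  have S: "S > 0" using S' by linarith
  have e0: "((\<lambda>e. e powr c) \<longlongrightarrow> 0) (at_right 0)" if "c > 0" for c :: real
    using that by (intro tendsto_zero_powrI[where b = c] tendsto_const tendsto_ident_at) (auto simp: eventually_at_filter)
  have "((\<lambda>e. L * e powr (1 - t)) \<longlongrightarrow> L * 0) (at_right 0)"
    using t by (intro tendsto_intros e0) auto
  then have "\<forall>\<^sub>F e in at_right 0. L * e powr (1 - t) < S" by (rule order_tendstoD) (use S in auto)
  then have "\<forall>\<^sub>F e in at_right 0. L * e powr (1 - t) < S \<and> e > 0"
    by (rule eventually_conj) (simp add: eventually_at_filter)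
  then obtain \<tau> where \<tau>: "L * \<tau> powr (1 - t) < S" "\<tau> > 0"
    using eventually_happens'[of "at_right (0::real)"] by auto
  have "((\<lambda>e. L * e + S' * e powr t) \<longlongrightarrow> L * 0 + S' * 0) (at_right 0)"
    using t by (intro tendsto_intros e0) auto
  then have "\<forall>\<^sub>F e in at_right 0. L * e + S' * e powr t < (S - S') * \<tau> powr t"
    by (rule order_tendstoD) (use S' \<tau> in auto)
  then have "\<forall>\<^sub>F e in at_right 0. L * e + S' * e powr t < (S - S') * \<tau> powr t \<and> e > 0"
    by (rule eventually_conj) (simp add: eventually_at_filter)
  then obtain \<rho> where \<rho>: "L * \<rho> + S' * \<rho> powr t < (S - S') * \<tau> powr t" "\<rho> > 0"
    using eventually_happens'[of "at_right (0::real)"] by auto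
  have "\<psi> x - \<psi> y \<le> S * norm (x - y) powr t" if x: "x \<in> ball x0 \<rho>" for x y
  proof (cases "norm (x - y) \<le> \<tau>")
    case True
    let ?n = "norm (x - y)"
    have "\<psi> x - \<psi> y \<le> L * ?n" using L(1)[of x y] by linarith
    also have "\<dots> = L * ?n powr (1 - t) * ?n powr t" by (cases "?n = 0") (auto simp flip: powr_add)
    also have "\<dots> \<le> S * ?n powr t"
    proof (rule mult_right_mono)
      have "L * ?n powr (1 - t) \<le> L * \<tau> powr (1 - t)" using True L t by (intro mult_left_mono powr_mono2) auto
      then show "L * ?n powr (1 - t) \<le> S" using \<tau> by linarith
    qed simp
    finally show ?thesis .
  next
    case False
    let ?n = "norm (x - y)" and ?m = "norm (x - x0)"
    have m: "?m \<le> \<rho>" using x by (simp add: dist_norm norm_minus_commute)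
    have "\<psi> x - \<psi> x0 \<le> L * ?m" using L(1)[of x x0] by linarith
    also have "\<dots> \<le> L * \<rho>" using m L by (intro mult_left_mono) auto
    finally have 1: "\<psi> x - \<psi> x0 \<le> L * \<rho>" .
    have "norm (x0 - y) \<le> ?n + ?m" using norm_triangle_ineq4[of "x - y" "x - x0"] by simp
    then have "norm (x0 - y) powr t \<le> (?n + ?m) powr t" using t by (intro powr_mono2) auto
    also have "\<dots> \<le> ?n powr t + ?m powr t" using t by (intro add_powr_le_add) auto
    also have "\<dots> \<le> ?n powr t + \<rho> powr t" using m t by (intro add_left_mono powr_mono2) auto
    finally have "S' * norm (x0 - y) powr t \<le> S' * (?n powr t + \<rho> powr t)" using S' by (intro mult_left_mono) auto
    then have 2: "\<psi> x0 - \<psi> y \<le> S' * ?n powr t + S' * \<rho> powr t"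
      using S'(3)[of y] by (simp add: algebra_simps)
    have "\<tau> powr t \<le> ?n powr t" using False \<tau> t by (intro powr_mono2) auto
    then have "(S - S') * \<tau> powr t \<le> (S - S') * ?n powr t" using S' by (intro mult_left_mono) auto
    then have "\<psi> x - \<psi> y \<le> S' * ?n powr t + (S - S') * ?n powr t" using 1 2 \<rho> by linarith
    then show ?thesis by (simp add: algebra_simps)
  qed
  then show ?thesis using \<rho> by blast
qed

lemma powr_growth:
  fixes Q :: "nat \<Rightarrow> real"
  assumes "filterlim Q at_top sequentially" "0 < S" "S < \<sigma>" "c > 0"
  shows "\<forall>\<^sub>F j in sequentially. C * S powr Q j < c * \<sigma> powr Q j"
proof -
  have "filterlim (\<lambda>p. (\<sigma> / S) powr p) at_top at_top" using assms by real_asymp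
  then have "filterlim (\<lambda>j. (\<sigma> / S) powr Q j) at_top sequentially" using assms(1) by (rule filterlim_compose)
  then have "\<forall>\<^sub>F j in sequentially. (\<sigma> / S) powr Q j > C / c" by (simp add: filterlim_at_top_dense)
  then show ?thesis
  proof eventually_elim
    case (elim j)
    have "C < c * (\<sigma> / S) powr Q j" using elim assms by (simp add: divide_less_eq mult.commute)
    then have "C * S powr Q j < c * (\<sigma> / S) powr Q j * S powr Q j" using assms by (intro mult_strict_right_mono) auto
    then show ?case using assms by (simp add: powr_divide)
  qed
qed

lemma pair_neighbourhood:
  fixes \<psi> :: "'a::euclidean_space \<Rightarrow> real"
  assumes c\<psi>: "continuous_on UNIV \<psi>" and t: "t > 0" and gt: "\<psi> y1 - \<psi> x0 > \<sigma> * norm (x0 - y1) powr t"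
  shows "\<exists>\<rho>>0. \<forall>x\<in>ball x0 \<rho>. \<forall>y\<in>ball y1 \<rho>. \<psi> y - \<psi> x \<ge> \<sigma> * norm (x - y) powr t \<and> x \<noteq> y \<and> norm (x - y) \<le> 2 * norm (x0 - y1)"
proof -
  have ne: "x0 \<noteq> y1" using gt by auto
  define h where "h = (\<lambda>z. \<psi> (snd z) - \<psi> (fst z) - \<sigma> * norm (fst z - snd z) powr t)"
  have cfs: "continuous_on UNIV (\<lambda>z. \<psi> (fst z))" "continuous_on UNIV (\<lambda>z. \<psi> (snd z))"
    by (rule continuous_on_compose2[OF c\<psi> continuous_on_fst[OF continuous_on_id]], simp)
      (rule continuous_on_compose2[OF c\<psi> continuous_on_snd[OF continuous_on_id]], simp)
  have cn: "continuous_on UNIV (\<lambda>z::'a \<times> 'a. norm (fst z - snd z) powr t :: real)"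
    using t by (intro continuous_on_powr' continuous_intros) auto
  have "continuous_on UNIV h"
    unfolding h_def by (intro continuous_on_diff cfs continuous_on_mult continuous_on_const cn)
  then have "open (h -` {0<..})" by (intro open_vimage) auto
  moreover have "(x0, y1) \<in> h -` {0<..}" using gt by (simp add: h_def)
  ultimately obtain A B where AB: "open A" "open B" "(x0, y1) \<in> A \<times> B" "A \<times> B \<subseteq> h -` {0<..}"
    by (rule open_prod_elim)
  have "x0 \<in> A" "y1 \<in> B" using AB(3) by auto
  obtain d1 where d1: "d1 > 0" "ball x0 d1 \<subseteq> A" by (rule openE[OF AB(1) \<open>x0 \<in> A\<close>])
  obtain d2 where d2: "d2 > 0" "ball y1 d2 \<subseteq> B" by (rule openE[OF AB(2) \<open>y1 \<in> B\<close>])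
  define d where "d = min (min d1 d2) (norm (x0 - y1) / 2)"
  have d: "d > 0" "ball x0 d \<subseteq> A" "ball y1 d \<subseteq> B" using d1 d2 ne by (auto simp: d_def)
  have "\<psi> y - \<psi> x \<ge> \<sigma> * norm (x - y) powr t \<and> x \<noteq> y \<and> norm (x - y) \<le> 2 * norm (x0 - y1)"
    if xy: "x \<in> ball x0 d" "y \<in> ball y1 d" for x y
  proof -
    have "(x, y) \<in> A \<times> B" using xy d by blast
    then have "(x, y) \<in> h -` {0<..}" using AB(4) by blast
    then have 1: "\<psi> y - \<psi> x \<ge> \<sigma> * norm (x - y) powr t" by (simp add: h_def)
    have "dist x0 x + dist y1 y < norm (x0 - y1)" using xy by (auto simp: d_def)
    moreover have "dist x y \<le> dist x0 x + dist x0 y1 + dist y1 y"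
      using dist_triangle[of x y x0] dist_triangle[of x0 y y1] by (simp add: dist_commute)
    moreover have "dist x0 y1 \<le> dist x0 x + dist x y + dist y1 y"
      using dist_triangle[of x0 y1 x] dist_triangle[of x y1 y] by (simp add: dist_commute)
    ultimately show ?thesis using 1 by (auto simp: dist_norm)
  qed
  then show ?thesis using d by blast
qed

lemma lipschitz_imp_continuous:
  fixes \<psi> :: "'a::real_normed_vector \<Rightarrow> real"
  assumes "\<And>x y. \<bar>\<psi> x - \<psi> y\<bar> \<le> L * norm (x - y)"
  shows "continuous_on UNIV \<psi>"
proof -
  have "(max L 0)-lipschitz_on UNIV \<psi>"
  proof (rule lipschitz_onI)
    fix x y :: 'a
    have "L * norm (x - y) \<le> max L 0 * norm (x - y)" by (intro mult_right_mono) auto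
    then show "dist (\<psi> x) (\<psi> y) \<le> max L 0 * dist x y"
      using assms[of x y] by (simp add: dist_norm)
  qed simp
  then show ?thesis by (rule lipschitz_on_continuous_on)
qed

text \<open>The estimate behind all the viscosity inequalities. The flag \<open>b\<close> lets one
  statement serve twice: with a point \<open>y1\<close> of steep increase it yields a genuine
  negative term of rate \<sigma>, without one it gives only the bound of rate S.\<close>

lemma viscosity_core:
  fixes U f :: "nat \<Rightarrow> 'a::euclidean_space \<Rightarrow> real"
  assumes \<Omega>: "open \<Omega>" "bounded \<Omega>" and t: "0 < t" "t < 1"
    and Q: "filterlim Q at_top sequentially"
    and U: "\<And>j. U j \<in> W_tilde t (Q j) \<Omega>" "\<And>j. continuous_on UNIV (U j)"
    and f: "\<And>j. f j \<in> borel_measurable borel" "\<And>j. \<exists>K. \<forall>x\<in>\<Omega>. \<bar>f j x\<bar> \<le> K"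
    and weak: "\<And>j. \<forall>w\<in>W_tilde t (Q j) \<Omega>. frac_form t (Q j) (U j) w = (\<integral>x. f j x * w x \<partial>lebesgue_on \<Omega>)"
    and lim: "uniform_limit UNIV U ui sequentially"
    and L: "\<And>x y. \<bar>\<phi> x - \<phi> y\<bar> \<le> L * norm (x - y)" "L \<ge> 0" and M: "\<And>x y. \<bar>\<phi> x - \<phi> y\<bar> \<le> M" "M \<ge> 0"
    and touch: "x0 \<in> \<Omega>" "\<phi> x0 = ui x0" "\<And>x. \<phi> x \<le> ui x"
    and S: "0 \<le> S'" "S' < S" "\<And>y. \<phi> x0 - \<phi> y \<le> S' * norm (x0 - y) powr t"
    and \<rho>0: "\<rho>0 > 0" and \<sigma>: "\<sigma> > 0" and y1: "b \<Longrightarrow> \<phi> y1 - \<phi> x0 > \<sigma> * norm (x0 - y1) powr t"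
  shows "\<exists>C c. c \<ge> 0 \<and> (b \<longrightarrow> c > 0) \<and>
     (\<forall>\<^sub>F j in sequentially. \<exists>x\<in>ball x0 \<rho>0 \<inter> \<Omega>. f j x \<le> C * S powr Q j - c * \<sigma> powr Q j)"
proof -
  let ?N = "real DIM('a)"
  \<comment> \<open>Half of each available gap: the perturbed quotient at \<open>x0\<close> stays
    below S, and the steep increase towards \<open>y1\<close> survives.\<close>
  define \<delta> where "\<delta> = min ((S - S') / 2) (if b then (\<phi> y1 - \<phi> x0 - \<sigma> * norm (x0 - y1) powr t) / 2 else 1)"
  have \<delta>: "\<delta> > 0" using S y1 by (auto simp: \<delta>_def)
  have \<delta>S: "S' + \<delta> < S"
  proof -
    have "\<delta> \<le> (S - S') / 2" unfolding \<delta>_def by (rule min.cobounded1)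
    then show ?thesis using S(2) by (simp add: field_simps)
  qed
  have \<delta>y: "\<phi> y1 - \<phi> x0 - \<delta> > \<sigma> * norm (x0 - y1) powr t" if b
  proof -
    have "\<delta> \<le> (\<phi> y1 - \<phi> x0 - \<sigma> * norm (x0 - y1) powr t) / 2"
      unfolding \<delta>_def if_P[OF that] by (rule min.cobounded2)
    then show ?thesis using y1[OF that] by (simp add: field_simps)
  qed
  define \<psi> where "\<psi> = (\<lambda>x. \<phi> x - \<delta> * bump x0 x)"
  define L' where "L' = L + 2 * \<delta>"
  define M' where "M' = M + \<delta>"
  have LM: "L' \<ge> 0" "M' \<ge> 0" using L M \<delta> by (auto simp: L'_def M'_def)
  have dd: "\<bar>\<psi> x - \<psi> y\<bar> \<le> \<bar>\<phi> x - \<phi> y\<bar> + \<delta> * \<bar>bump x0 x - bump x0 y\<bar>" for x y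
  proof -
    have "\<psi> x - \<psi> y = (\<phi> x - \<phi> y) - \<delta> * (bump x0 x - bump x0 y)" by (simp add: \<psi>_def algebra_simps)
    then have "\<bar>\<psi> x - \<psi> y\<bar> \<le> \<bar>\<phi> x - \<phi> y\<bar> + \<bar>\<delta> * (bump x0 x - bump x0 y)\<bar>" by linarith
    then show ?thesis using \<delta> by (simp add: abs_mult)
  qed
  have L': "\<bar>\<psi> x - \<psi> y\<bar> \<le> L' * norm (x - y)" for x y
  proof -
    have "\<delta> * \<bar>bump x0 x - bump x0 y\<bar> \<le> \<delta> * (2 * norm (x - y))"
      using \<delta> bump_lipschitz by (intro mult_left_mono) auto
    then show ?thesis using dd[of x y] L(1)[of x y] by (simp add: L'_def algebra_simps)
  qed
  have M': "\<bar>\<psi> x - \<psi> y\<bar> \<le> M'" for x y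
  proof -
    have "\<bar>bump x0 x - bump x0 y\<bar> \<le> 1" using bump_bounds[of x0 x] bump_bounds[of x0 y] by auto
    then have "\<delta> * \<bar>bump x0 x - bump x0 y\<bar> \<le> \<delta> * 1" using \<delta> by (intro mult_left_mono) auto
    then show ?thesis using dd[of x y] M(1)[of x y] by (simp add: M'_def)
  qed
  have c\<psi>: "continuous_on UNIV \<psi>" by (rule lipschitz_imp_continuous[OF L'])
  have q0: "\<psi> x0 - \<psi> y \<le> (S' + \<delta>) * norm (x0 - y) powr t" for y
  proof -
    have "\<delta> * bump x0 y \<le> \<delta> * norm (x0 - y) powr t"
      using bump_le_powr[of t x0 y] \<delta> t by (intro mult_left_mono) (auto simp: norm_minus_commute)
    then show ?thesis using S(3)[of y] bump_center[of x0] by (simp add: \<psi>_def algebra_simps)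
  qed
  obtain \<rho>1 where \<rho>1: "\<rho>1 > 0" "\<And>x y. x \<in> ball x0 \<rho>1 \<Longrightarrow> \<psi> x - \<psi> y \<le> S * norm (x - y) powr t"
    using holder_quotient_usc[OF t L' LM(1) _ \<delta>S q0] S \<delta> by auto
  have "\<exists>\<rho>2 E D. \<rho>2 > 0 \<and> E \<in> sets borel \<and> bounded E \<and> D \<ge> 0 \<and> (b \<longrightarrow> D > 0 \<and> measure lborel E > 0) \<and>
      (\<forall>x\<in>ball x0 \<rho>2. \<forall>y\<in>E. \<psi> y - \<psi> x \<ge> \<sigma> * norm (x - y) powr t \<and> x \<noteq> y \<and> norm (x - y) \<le> D)"
  proof (cases b)
    case True
    have "\<psi> y1 - \<psi> x0 > \<sigma> * norm (x0 - y1) powr t"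
    proof -
      have "\<delta> * bump x0 y1 \<le> \<delta> * 1" using \<delta> bump_bounds by (intro mult_left_mono) auto
      then show ?thesis using \<delta>y[OF True] bump_center[of x0] by (simp add: \<psi>_def)
    qed
    from pair_neighbourhood[OF c\<psi> t(1) this] obtain \<rho>2 where \<rho>2: "\<rho>2 > 0"
      "\<forall>x\<in>ball x0 \<rho>2. \<forall>y\<in>ball y1 \<rho>2. \<psi> y - \<psi> x \<ge> \<sigma> * norm (x - y) powr t \<and> x \<noteq> y \<and> norm (x - y) \<le> 2 * norm (x0 - y1)"
      by blast
    moreover have "x0 \<noteq> y1" using y1[OF True] by auto
    ultimately show ?thesis
      by (intro exI[of _ \<rho>2] exI[of _ "ball y1 \<rho>2"] exI[of _ "2 * norm (x0 - y1)"]) (simp add: content_ball)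
  next
    case False
    \<comment> \<open>With an empty set the negative term has coefficient 0.\<close>
    show ?thesis by (rule exI[of _ 1], rule exI[of _ "{}"], rule exI[of _ 0]) (use False in simp)
  qed
  then obtain \<rho>2 E D where \<rho>2: "\<rho>2 > 0" and E: "E \<in> sets borel" "bounded E" and D: "D \<ge> 0" "b \<Longrightarrow> D > 0" "b \<Longrightarrow> measure lborel E > 0"
    and low: "\<And>x y. x \<in> ball x0 \<rho>2 \<Longrightarrow> y \<in> E \<Longrightarrow> \<psi> y - \<psi> x \<ge> \<sigma> * norm (x - y) powr t \<and> x \<noteq> y \<and> norm (x - y) \<le> D"
    by blast
  obtain \<rho>3 where \<rho>3: "\<rho>3 > 0" "ball x0 \<rho>3 \<subseteq> \<Omega>" by (rule openE[OF \<Omega>(1) touch(1)])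
  define \<rho> where "\<rho> = min (min (min \<rho>0 \<rho>1) (min \<rho>2 \<rho>3)) 1"
  have \<rho>: "0 < \<rho>" "\<rho> \<le> \<rho>0" "\<rho> \<le> \<rho>1" "\<rho> \<le> \<rho>2" "\<rho> \<le> \<rho>3" "\<rho> \<le> 1"
    using \<rho>0 \<rho>1 \<rho>2 \<rho>3 by (auto simp: \<rho>_def)
  \<comment> \<open>At distance at least \<rho> from \<open>x0\<close>, \<psi> lies below the limit
    by at least \<eta>. Raising it by \<eta> / 2 while \<open>U j\<close> is within \<eta> / 4 of
    the limit puts it above \<open>U j\<close> at \<open>x0\<close> and below off the ball. The
    bound \<rho> <= 1 keeps \<rho>^2 under the cut-off in \<open>bump\<close>.\<close>
  define \<eta> where "\<eta> = \<delta> * \<rho>\<^sup>2"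
  have \<eta>: "\<eta> > 0" using \<delta> \<rho> by (simp add: \<eta>_def)
  \<comment> \<open>Chosen so that p0 - 1 = N + t p0 exactly, the smallest exponent at which the
    kernel converges.\<close>
  define p0 where "p0 = (?N + 1) / (1 - t)"
  have p0a: "p0 * (1 - t) = ?N + 1" using t by (simp add: p0_def)
  have N1: "?N \<ge> 1" by (rule real_DIM_ge_1)
  have p0b: "p0 > 1" using t N1 unfolding p0_def by (simp add: less_divide_eq)
  have p0c: "p0 - 1 \<ge> ?N + t * p0" using p0a by (simp add: algebra_simps)
  have pp: "p - 1 \<ge> ?N + t * p" if "p \<ge> p0" for p
  proof -
    have "p0 * (1 - t) \<le> p * (1 - t)" using that t by (intro mult_right_mono) auto
    then show ?thesis using p0a by (simp add: algebra_simps)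
  qed
  define C0 where "C0 = integral\<^sup>L lborel (trunc_kernel L' M' (p0 - 1) (t * p0) :: 'a \<Rightarrow> real)"
  define c0 where "c0 = D powr - (?N + t) * measure lborel E"
  have c0: "c0 \<ge> 0" "b \<Longrightarrow> c0 > 0" using D by (auto simp: c0_def)
  have "\<forall>\<^sub>F j in sequentially. \<forall>x\<in>UNIV. dist (U j x) (ui x) < \<eta> / 4"
    by (rule uniform_limitD[OF lim]) (use \<eta> in simp)
  moreover have "\<forall>\<^sub>F j in sequentially. Q j \<ge> p0" using Q by (simp add: filterlim_at_top)
  ultimately have "\<forall>\<^sub>F j in sequentially. \<exists>x\<in>ball x0 \<rho>0 \<inter> \<Omega>. f j x \<le> (2 * C0 * S powr - p0) * S powr Q j - (2 * c0 / \<sigma>) * \<sigma> powr Q j"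
  proof eventually_elim
    case (elim j)
    have cl: "\<bar>U j x - ui x\<bar> < \<eta> / 4" for x using elim(1) by (simp add: dist_real_def)
    obtain Kf where Kf: "\<And>x. x \<in> \<Omega> \<Longrightarrow> \<bar>f j x\<bar> \<le> Kf" using f(2)[of j] by blast
    define \<psi>' where "\<psi>' = (\<lambda>x. \<psi> x + \<eta> / 2)"
    have "\<exists>x\<in>ball x0 \<rho>. f j x \<le> 2 * nonlocal_op t (Q j) \<psi>' x"
    proof (rule weak_comparison[OF \<Omega> t(1) _ pp[OF elim(2)] U _ LM(1) _ LM(2) _ _ _ f(1) Kf weak[rule_format]])
      show "1 < Q j" using elim p0b by linarith
      show "\<bar>\<psi>' x - \<psi>' y\<bar> \<le> L' * norm (x - y)" "\<bar>\<psi>' x - \<psi>' y\<bar> \<le> M'" for x y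
        using L'[of x y] M'[of x y] by (auto simp: \<psi>'_def)
      show "ball x0 \<rho> \<subseteq> \<Omega>" using \<rho> \<rho>3 by auto
      show "\<psi>' x \<le> U j x" if "x \<notin> ball x0 \<rho>" for x
      proof -
        have "\<rho> \<le> norm (x - x0)" using that by (simp add: dist_norm norm_minus_commute)
        then have "\<rho>\<^sup>2 \<le> (norm (x - x0))\<^sup>2" using \<rho> by (intro power_mono) auto
        moreover have "\<rho>\<^sup>2 \<le> 1" using \<rho> by (simp add: power_le_one)
        ultimately have "\<rho>\<^sup>2 \<le> bump x0 x" by (simp add: bump_def)
        then have "\<eta> \<le> \<delta> * bump x0 x" unfolding \<eta>_def using \<delta> by (intro mult_left_mono) auto
        moreover have "\<psi>' x = \<phi> x - \<delta> * bump x0 x + \<eta> / 2" by (simp add: \<psi>'_def \<psi>_def)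
        ultimately show ?thesis using touch(3)[of x] cl[of x] \<eta> by linarith
      qed
      have "\<psi>' x0 = ui x0 + \<eta> / 2" using touch(2) by (simp add: \<psi>'_def \<psi>_def bump_center)
      then show "U j x0 < \<psi>' x0" using cl[of x0] \<eta> by linarith
    qed
    then obtain x where x: "x \<in> ball x0 \<rho>" "f j x \<le> 2 * nonlocal_op t (Q j) \<psi>' x" by blast
    \<comment> \<open>The operator sees only differences, so the raise by a constant
      disappears.\<close>
    have "nonlocal_op t (Q j) \<psi>' x = nonlocal_op t (Q j) \<psi> x" by (simp add: nonlocal_op_def \<psi>'_def)
    also have "\<dots> \<le> S powr (Q j - p0) * C0 - \<sigma> powr (Q j - 1) * D powr - (?N + t) * measure lborel E"
      unfolding C0_def
    proof (rule nonlocal_op_le[OF t p0b p0c elim(2) _ L' LM(1) M' LM(2)])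
      show "\<psi> \<in> borel_measurable borel" by (rule borel_measurable_continuous_onI[OF c\<psi>])
    qed (use S \<rho>1(2)[of x] low[of x] x \<rho> E \<sigma> in auto)
    also have "\<dots> = S powr (Q j - p0) * C0 - \<sigma> powr (Q j - 1) * c0" by (simp add: c0_def)
    also have "S powr (Q j - p0) = S powr - p0 * S powr Q j" by (simp flip: powr_add)
    also have "\<sigma> powr (Q j - 1) = \<sigma> powr Q j / \<sigma>" using \<sigma> by (simp add: powr_diff)
    finally have g: "nonlocal_op t (Q j) \<psi>' x \<le> S powr - p0 * S powr Q j * C0 - \<sigma> powr Q j / \<sigma> * c0" .
    have "f j x \<le> 2 * (S powr - p0 * S powr Q j * C0 - \<sigma> powr Q j / \<sigma> * c0)"
      by (rule order_trans[OF x(2) mult_left_mono[OF g]]) simp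
    also have "\<dots> = (2 * C0 * S powr - p0) * S powr Q j - (2 * c0 / \<sigma>) * \<sigma> powr Q j"
      by (simp add: algebra_simps)
    finally have "f j x \<le> (2 * C0 * S powr - p0) * S powr Q j - (2 * c0 / \<sigma>) * \<sigma> powr Q j" .
    moreover have "x \<in> ball x0 \<rho>0 \<inter> \<Omega>" using x(1) \<rho> \<rho>3 by auto
    ultimately show ?case by blast
  qed
  moreover have "2 * c0 / \<sigma> \<ge> 0" "b \<longrightarrow> 2 * c0 / \<sigma> > 0" using c0 \<sigma> by auto
  ultimately show ?thesis by blast
qed

text \<open>The quotients are bounded by max L M, so the real supremum and infimum in
  \<open>L_plus\<close> and \<open>L_minus\<close> are genuine; they become inequalities with nearly
  optimal points.\<close>

lemma difference_quotients_bounded: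
  fixes \<phi> :: "'a::euclidean_space \<Rightarrow> real"
  assumes t: "0 < t" "t < 1" and L: "\<And>x y. \<bar>\<phi> x - \<phi> y\<bar> \<le> L * norm (x - y)" "L \<ge> 0" and M: "\<And>x y. \<bar>\<phi> x - \<phi> y\<bar> \<le> M" "M \<ge> 0"
  shows "\<phi> x - \<phi> y \<le> L_plus t \<phi> x * norm (x - y) powr t"
    "\<phi> y - \<phi> x \<le> - L_minus t \<phi> x * norm (x - y) powr t"
    "a < L_plus t \<phi> x \<Longrightarrow> \<exists>y. y \<noteq> x \<and> \<phi> x - \<phi> y > a * norm (x - y) powr t"
    "a < - L_minus t \<phi> x \<Longrightarrow> \<exists>y. y \<noteq> x \<and> \<phi> y - \<phi> x > a * norm (x - y) powr t"
    "L_minus t \<phi> x \<le> L_plus t \<phi> x"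
proof -
  define q where "q = (\<lambda>y. (\<phi> x - \<phi> y) / norm (x - y) powr t)"
  have qb: "\<bar>q y\<bar> \<le> max L M" for y
    using lipschitz_bounded_imp_holder[of t \<phi> x y L M] L M t
    by (cases "x = y") (auto simp: q_def divide_le_eq abs_div)
  have bd: "bdd_above (q ` (- {x}))" "bdd_below (q ` (- {x}))"
    using qb by (auto intro!: bdd_aboveI[of _ "max L M"] bdd_belowI[of _ "- max L M"] simp: abs_le_iff minus_le_iff)
  have Lp: "L_plus t \<phi> x = (SUP y\<in>- {x}. q y)" and Lm: "L_minus t \<phi> x = (INF y\<in>- {x}. q y)"
    by (simp_all add: L_plus_def L_minus_def q_def)
  obtain bb :: 'a where "bb \<in> Basis" using nonempty_Basis by blast
  then have bb: "x + bb \<noteq> x" using nonzero_Basis[of bb] by simp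
  then have ne: "- {x} \<noteq> {}" by blast
  have up: "q y \<le> L_plus t \<phi> x" and lo: "L_minus t \<phi> x \<le> q y" if "y \<noteq> x" for y
    unfolding Lp Lm using that bd by (auto intro: cSUP_upper cINF_lower)
  show "L_minus t \<phi> x \<le> L_plus t \<phi> x" by (rule order_trans[OF lo[OF bb] up[OF bb]])
  have qe: "\<phi> x - \<phi> y = q y * norm (x - y) powr t" for y by (cases "x = y") (auto simp: q_def)
  show "\<phi> x - \<phi> y \<le> L_plus t \<phi> x * norm (x - y) powr t"
    using up[of y] unfolding qe by (cases "x = y") (auto intro: mult_right_mono)
  have "L_minus t \<phi> x * norm (x - y) powr t \<le> q y * norm (x - y) powr t"
    using lo[of y] by (cases "x = y") (auto intro: mult_right_mono)
  then show "\<phi> y - \<phi> x \<le> - L_minus t \<phi> x * norm (x - y) powr t" using qe[of y] by simp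
  show "\<exists>y. y \<noteq> x \<and> \<phi> x - \<phi> y > a * norm (x - y) powr t" if a: "a < L_plus t \<phi> x"
  proof -
    obtain y where "y \<in> - {x}" "a < q y" using a less_cSUP_iff[OF ne bd(1)] unfolding Lp by blast
    then show ?thesis by (intro exI[of _ y]) (simp add: q_def less_divide_eq)
  qed
  show "\<exists>y. y \<noteq> x \<and> \<phi> y - \<phi> x > a * norm (x - y) powr t" if a: "a < - L_minus t \<phi> x"
  proof -
    have "L_minus t \<phi> x < - a" using a by simp
    then obtain y where "y \<in> - {x}" "q y < - a" using cINF_less_iff[OF ne bd(2)] unfolding Lm by blast
    moreover from this have "\<phi> x - \<phi> y < - (a * norm (x - y) powr t)" by (simp add: q_def divide_less_eq)
    ultimately show ?thesis by (intro exI[of _ y]) auto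
  qed
qed

text \<open>The partial derivatives are continuous and vanish off the compact support, hence are
  bounded; summing their bounds controls the operator norm of the derivative.\<close>

lemma C2_compact_support_lipschitz:
  fixes \<phi> :: "'a::euclidean_space \<Rightarrow> real"
  assumes "\<phi> \<in> C2_compact_support"
  shows "\<exists>L\<ge>0. \<exists>M\<ge>0. \<forall>x y. \<bar>\<phi> x - \<phi> y\<bar> \<le> L * norm (x - y) \<and> \<bar>\<phi> x - \<phi> y\<bar> \<le> M"
proof -
  define K where "K = closure {x. \<phi> x \<noteq> 0}"
  have cK: "compact K" and C2: "Ck 2 \<phi>" using assms by (auto simp: C2_compact_support_def K_def)
  have C2': "(\<forall>x. \<phi> differentiable (at x)) \<and> (\<forall>b\<in>Basis. Ck 1 (\<lambda>x. frechet_derivative \<phi> (at x) b))"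
    using C2 by (simp add: numeral_2_eq_2)
  then have diff: "\<phi> differentiable (at x)" for x by blast
  define D where "D = (\<lambda>x. frechet_derivative \<phi> (at x))"
  have D: "(\<phi> has_derivative D x) (at x)" for x unfolding D_def using diff by (simp add: frechet_derivative_works)
  have cD: "continuous_on UNIV (\<lambda>x. D x b)" if b: "b \<in> Basis" for b
  proof -
    have "\<forall>x. (\<lambda>x. D x b) differentiable (at x)" using C2' b by (simp add: D_def)
    then show ?thesis by (intro differentiable_imp_continuous_on) (simp add: differentiable_on_def)
  qed
  have D0: "D x b = 0" if "x \<notin> K" for x b
  proof -
    have "open (- K)" "x \<in> - K" using that by (auto simp: K_def)
    then have "((\<lambda>_. 0) has_derivative D x) (at x)"
      using D[of x] closure_subset[of "{x. \<phi> x \<noteq> 0}"]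
      by (intro has_derivative_transform_within_open[OF D]) (auto simp: K_def)
    then have "D x = (\<lambda>_. 0)" by (intro has_derivative_unique[OF _ has_derivative_const])
    then show ?thesis by simp
  qed
  have "\<exists>B\<ge>0. \<forall>x. \<bar>D x b\<bar> \<le> B" if b: "b \<in> Basis" for b
  proof -
    have "bounded ((\<lambda>x. D x b) ` K)"
      using cK cD[OF b] by (intro compact_imp_bounded compact_continuous_image) (auto intro: continuous_on_subset)
    then obtain B where "\<And>x. x \<in> K \<Longrightarrow> \<bar>D x b\<bar> \<le> B" by (auto simp: bounded_iff)
    then have "\<bar>D x b\<bar> \<le> max B 0" for x using D0[of x b] by (cases "x \<in> K") (auto simp: le_max_iff_disj)
    then show ?thesis by (intro exI[of _ "max B 0"]) auto
  qed
  then obtain B where B: "\<And>b. b \<in> Basis \<Longrightarrow> B b \<ge> 0" "\<And>b x. b \<in> Basis \<Longrightarrow> \<bar>D x b\<bar> \<le> B b" by metis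
  define L where "L = (\<Sum>b\<in>Basis. B b)"
  have L0: "L \<ge> 0" unfolding L_def using B by (intro sum_nonneg) auto
  have on: "onorm (D x) \<le> L" for x
  proof (rule onorm_le)
    fix h :: 'a
    have lin: "linear (D x)" using D[of x] by (rule has_derivative_linear)
    have "D x h = D x (\<Sum>b\<in>Basis. (h \<bullet> b) *\<^sub>R b)" by (simp add: euclidean_representation)
    also have "\<dots> = (\<Sum>b\<in>Basis. (h \<bullet> b) * D x b)"
      using linear_sum[OF lin, of "\<lambda>b. (h \<bullet> b) *\<^sub>R b" Basis] linear_cmul[OF lin] by simp
    finally have "\<bar>D x h\<bar> \<le> (\<Sum>b\<in>Basis. \<bar>(h \<bullet> b) * D x b\<bar>)" by (metis sum_abs)
    also have "\<dots> \<le> (\<Sum>b\<in>Basis. norm h * B b)"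
      unfolding abs_mult using B Basis_le_norm[of _ h] by (intro sum_mono mult_mono) auto
    also have "\<dots> = L * norm h" by (simp add: L_def sum_distrib_left mult.commute)
    finally show "norm (D x h) \<le> L * norm h" by simp
  qed
  have lip: "\<bar>\<phi> x - \<phi> y\<bar> \<le> L * norm (x - y)" for x y
    using differentiable_bound[of UNIV \<phi> D L x y] D on by simp
  have "bounded (\<phi> ` K)"
    using cK lipschitz_imp_continuous[OF lip] by (intro compact_imp_bounded compact_continuous_image) (auto intro: continuous_on_subset)
  then obtain M where "\<And>x. x \<in> K \<Longrightarrow> \<bar>\<phi> x\<bar> \<le> M" by (auto simp: bounded_iff)
  then have M: "\<bar>\<phi> x\<bar> \<le> max M 0" for x
    using closure_subset[of "{x. \<phi> x \<noteq> 0}"] by (cases "x \<in> K") (auto simp: K_def le_max_iff_disj)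
  have "\<bar>\<phi> x - \<phi> y\<bar> \<le> 2 * max M 0" for x y using M[of x] M[of y] by linarith
  then show ?thesis using L0 lip by (intro exI[of _ L] conjI exI[of _ "2 * max M 0"]) auto
qed

text \<open>The system is decoupled: a touching condition concerns one unknown at a time, and the
  other component enters only through the right-hand side \<open>f\<close>.\<close>

locale weak_family =
  fixes \<Omega> :: "'a::euclidean_space set" and t :: real and Q :: "nat \<Rightarrow> real"
    and U f :: "nat \<Rightarrow> 'a \<Rightarrow> real" and ui :: "'a \<Rightarrow> real"
  assumes \<Omega>: "open \<Omega>" "bounded \<Omega>" and t: "0 < t" "t < 1"
    and Q: "filterlim Q at_top sequentially" "\<And>j. Q j > 0"
    and U: "\<And>j. U j \<in> W_tilde t (Q j) \<Omega>" "\<And>j. continuous_on UNIV (U j)"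
    and f: "\<And>j. f j \<in> borel_measurable borel" "\<And>j. \<exists>K. \<forall>x\<in>\<Omega>. \<bar>f j x\<bar> \<le> K"
    and weak: "\<And>j. \<forall>w\<in>W_tilde t (Q j) \<Omega>. frac_form t (Q j) (U j) w = (\<integral>x. f j x * w x \<partial>lebesgue_on \<Omega>)"
    and lim: "uniform_limit UNIV U ui sequentially"
begin

text \<open>The form is odd in its first argument, so touching from above becomes touching from
  below.\<close>

lemma negative: "weak_family \<Omega> t Q (\<lambda>j x. - U j x) (\<lambda>j x. - f j x) (\<lambda>x. - ui x)"
proof
  fix j
  show "(\<lambda>x. - U j x) \<in> W_tilde t (Q j) \<Omega>"
  proof (rule W_tilde_continuousI[OF \<Omega> Q(2)])
    have "frac_quotient t (Q j) (\<lambda>x. - U j x) = frac_quotient t (Q j) (U j)"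
      by (auto simp: frac_quotient_def abs_minus_commute)
    then show "integrable lborel (frac_quotient t (Q j) (\<lambda>x. - U j x))"
      using W_tilde_continuousD[OF U] by simp
    show "continuous_on UNIV (\<lambda>x. - U j x)" using U by (intro continuous_on_minus)
    show "x \<notin> \<Omega> \<Longrightarrow> - U j x = 0" for x using U(1)[of j] by (simp add: W_tilde_def)
  qed
  show "continuous_on UNIV (\<lambda>x. - U j x)" using U by (intro continuous_on_minus)
  show "(\<lambda>x. - f j x) \<in> borel_measurable borel" using f by simp
  show "\<exists>K. \<forall>x\<in>\<Omega>. \<bar>- f j x\<bar> \<le> K" using f(2) by simp
  show "\<forall>w\<in>W_tilde t (Q j) \<Omega>. frac_form t (Q j) (\<lambda>x. - U j x) w = (\<integral>x. - f j x * w x \<partial>lebesgue_on \<Omega>)"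
  proof
    fix w assume w: "w \<in> W_tilde t (Q j) \<Omega>"
    have "form_density t (Q j) (\<lambda>x. - U j x) w = (\<lambda>q. - form_density t (Q j) (U j) w q)"
    proof
      fix q :: "'a \<times> 'a"
      obtain x y where q: "q = (x, y)" by fastforce
      show "form_density t (Q j) (\<lambda>x. - U j x) w q = - form_density t (Q j) (U j) w q"
        using signed_powr_minus[of "Q j" "U j x - U j y"] by (simp add: q form_density_def)
    qed
    then have "frac_form t (Q j) (\<lambda>x. - U j x) w = - frac_form t (Q j) (U j) w" by (simp add: frac_form_eq)
    then show "frac_form t (Q j) (\<lambda>x. - U j x) w = (\<integral>x. - f j x * w x \<partial>lebesgue_on \<Omega>)"
      using weak[rule_format, OF w] by simp
  qed
next
  show "uniform_limit UNIV (\<lambda>j x. - U j x) (\<lambda>x. - ui x) sequentially"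
    using lim by (rule uniform_limit_uminus)
qed (use \<Omega> t Q in auto)

text \<open>Each failing inequality leaves room for a rate S above the positive quotients. If
  \<open>L_inf\<close> is negative, the decrease of rate \<sigma> > S makes some f j x negative; if
  \<open>L_plus\<close> < m, the growth of \<open>f\<close> at a rate m' > S is violated.\<close>

lemma supersolution:
  assumes \<phi>: "\<phi> \<in> C2_compact_support" and touch: "x0 \<in> \<Omega>" "ui x0 = \<phi> x0" "\<And>x. ui x \<ge> \<phi> x"
    and nn: "\<And>j x. x \<in> \<Omega> \<Longrightarrow> f j x \<ge> 0" and m: "m \<ge> 0"
    and grow: "\<And>m'. 0 < m' \<Longrightarrow> m' < m \<Longrightarrow> \<exists>c>0. \<exists>\<rho>>0. \<forall>\<^sub>F j in sequentially. \<forall>x\<in>ball x0 \<rho>. c * m' powr Q j \<le> f j x"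
  shows "min_operator t \<phi> m x0 \<ge> 0"
proof -
  obtain L M where L: "\<And>x y. \<bar>\<phi> x - \<phi> y\<bar> \<le> L * norm (x - y)" "L \<ge> 0" and M: "\<And>x y. \<bar>\<phi> x - \<phi> y\<bar> \<le> M" "M \<ge> 0"
    using C2_compact_support_lipschitz[OF \<phi>] by blast
  note dq = difference_quotients_bounded[OF t L M, where x = x0]
  note core = viscosity_core[OF \<Omega> t Q(1) U f weak lim L M touch(1) touch(2)[symmetric] touch(3)]
  define P where "P = L_plus t \<phi> x0"
  define N where "N = L_minus t \<phi> x0"
  have upP: "\<phi> x0 - \<phi> y \<le> max 0 P * norm (x0 - y) powr t" for y
  proof -
    have "P * norm (x0 - y) powr t \<le> max 0 P * norm (x0 - y) powr t" by (intro mult_right_mono) auto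
    then show ?thesis using dq(1)[of y] unfolding P_def by linarith
  qed
  have A: "P + N \<ge> 0"
  proof (rule ccontr)
    assume "\<not> P + N \<ge> 0"
    then have "max 0 P < - N" using dq(5) unfolding P_def N_def by linarith
    then obtain S where S: "max 0 P < S" "S < - N" using dense by blast
    obtain \<sigma> where \<sigma>: "S < \<sigma>" "\<sigma> < - N" using S(2) dense by blast
    obtain y1 where y1: "\<phi> y1 - \<phi> x0 > \<sigma> * norm (x0 - y1) powr t" using dq(4)[OF \<sigma>(2)[unfolded N_def]] by blast
    have S0: "S > 0" using S by linarith
    obtain C c where c: "c > 0" and ev: "\<forall>\<^sub>F j in sequentially. \<exists>x\<in>ball x0 1 \<inter> \<Omega>. f j x \<le> C * S powr Q j - c * \<sigma> powr Q j"
      using core[OF _ S(1) upP, of 1 \<sigma> True y1] S0 \<sigma> y1 by auto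
    have "\<forall>\<^sub>F j in sequentially. C * S powr Q j < c * \<sigma> powr Q j" by (rule powr_growth[OF Q(1) S0 \<sigma>(1) c])
    with ev have "\<forall>\<^sub>F j in sequentially. False"
    proof eventually_elim
      case (elim j)
      then obtain x where "x \<in> \<Omega>" "f j x \<le> C * S powr Q j - c * \<sigma> powr Q j" by blast
      then show False using nn[of x j] elim by linarith
    qed
    then show False by simp
  qed
  have B: "P \<ge> m"
  proof (rule ccontr)
    assume "\<not> P \<ge> m"
    moreover have "P \<ge> 0" using A dq(5) unfolding P_def N_def by linarith
    \<comment> \<open>Nonnegativity of \<open>P\<close> comes from the first half and lets S lie
      below m.\<close>
    ultimately have "max 0 P < m" by simp
    then obtain S where S: "max 0 P < S" "S < m" using dense by blast
    obtain m' where m': "S < m'" "m' < m" using S(2) dense by blast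
    have S0: "S > 0" using S by linarith
    obtain c \<rho> where c: "c > 0" and \<rho>: "\<rho> > 0" and lo: "\<forall>\<^sub>F j in sequentially. \<forall>x\<in>ball x0 \<rho>. c * m' powr Q j \<le> f j x"
      using grow[of m'] S0 m' by auto
    obtain C c' where c': "c' \<ge> 0" and ev: "\<forall>\<^sub>F j in sequentially. \<exists>x\<in>ball x0 \<rho> \<inter> \<Omega>. f j x \<le> C * S powr Q j - c' * 1 powr Q j"
      using core[OF _ S(1) upP \<rho>, of 1 False] by auto
    have "\<forall>\<^sub>F j in sequentially. C * S powr Q j < c * m' powr Q j" by (rule powr_growth[OF Q(1) S0 m'(1) c])
    with ev lo have "\<forall>\<^sub>F j in sequentially. False"
    proof eventually_elim
      case (elim j)
      then obtain x where "x \<in> ball x0 \<rho>" "f j x \<le> C * S powr Q j - c' * 1 powr Q j" by blast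
      moreover have "c' * 1 powr Q j \<ge> 0" using c' by simp
      ultimately show False using elim by force
    qed
    then show False by simp
  qed
  show ?thesis using A B by (simp add: min_operator_def L_inf_def P_def N_def)
qed

text \<open>If the minimum were positive, \<open>L_plus\<close> would exceed both m and minus
  \<open>L_minus\<close>. For the negated family its rate is the one that helps, so \<open>f\<close>
  would have to grow faster than \<open>grow\<close> permits.\<close>

lemma subsolution:
  assumes \<phi>: "\<phi> \<in> C2_compact_support" and touch: "x0 \<in> \<Omega>" "ui x0 = \<phi> x0" "\<And>x. ui x \<le> \<phi> x"
    and m: "m \<ge> 0"
    and grow: "\<And>m'. m' > m \<Longrightarrow> \<exists>c. \<exists>\<rho>>0. \<forall>\<^sub>F j in sequentially. \<forall>x\<in>ball x0 \<rho>. f j x \<le> c * m' powr Q j"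
  shows "min_operator t \<phi> m x0 \<le> 0"
proof (rule ccontr)
  assume neg: "\<not> ?thesis"
  obtain L M where L: "\<And>x y. \<bar>\<phi> x - \<phi> y\<bar> \<le> L * norm (x - y)" "L \<ge> 0" and M: "\<And>x y. \<bar>\<phi> x - \<phi> y\<bar> \<le> M" "M \<ge> 0"
    using C2_compact_support_lipschitz[OF \<phi>] by blast
  note dq = difference_quotients_bounded[OF t L M, where x = x0]
  interpret n: weak_family \<Omega> t Q "\<lambda>j x. - U j x" "\<lambda>j x. - f j x" "\<lambda>x. - ui x" by (rule negative)
  have L': "\<bar>- \<phi> x - - \<phi> y\<bar> \<le> L * norm (x - y)" and M': "\<bar>- \<phi> x - - \<phi> y\<bar> \<le> M" for x y
    using L(1)[of x y] M(1)[of x y] by linarith+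
  have touch': "- \<phi> x0 = - ui x0" "- \<phi> x \<le> - ui x" for x using touch by auto
  note core = viscosity_core[OF \<Omega> t Q(1) n.U n.f n.weak n.lim L' L(2) M' M(2) touch(1) touch']
  define P where "P = L_plus t \<phi> x0"
  define N where "N = L_minus t \<phi> x0"
  have PN: "- N < P" "m < P" using neg by (auto simp: min_operator_def L_inf_def P_def N_def not_le)
  then have "max m (- N) < P" by simp
  then obtain S where S: "max m (- N) < S" "S < P" using dense by blast
  obtain \<sigma> where \<sigma>: "S < \<sigma>" "\<sigma> < P" using S(2) dense by blast
  have S0: "S > 0" and mN: "0 \<le> max m (- N)" using S m by linarith+
  \<comment> \<open>For the negated test function the quotient to be bounded from above is minus
    \<open>L_minus\<close> of the original one.\<close>
  have up: "- \<phi> x0 - - \<phi> y \<le> max m (- N) * norm (x0 - y) powr t" for y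
  proof -
    have "- N * norm (x0 - y) powr t \<le> max m (- N) * norm (x0 - y) powr t" by (intro mult_right_mono) auto
    then show ?thesis using dq(2)[of y] unfolding N_def by linarith
  qed
  obtain y1 where y1: "\<phi> x0 - \<phi> y1 > \<sigma> * norm (x0 - y1) powr t" using dq(3)[OF \<sigma>(2)[unfolded P_def]] by blast
  obtain c \<rho> where \<rho>: "\<rho> > 0" and hi: "\<forall>\<^sub>F j in sequentially. \<forall>x\<in>ball x0 \<rho>. f j x \<le> c * S powr Q j"
    using grow[of S] S by auto
  obtain C c' where c': "c' > 0" and ev: "\<forall>\<^sub>F j in sequentially. \<exists>x\<in>ball x0 \<rho> \<inter> \<Omega>. - f j x \<le> C * S powr Q j - c' * \<sigma> powr Q j"
    using core[OF mN S(1) up \<rho>, of \<sigma> True y1] S0 \<sigma> y1 by auto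
  have "\<forall>\<^sub>F j in sequentially. (C + c) * S powr Q j < c' * \<sigma> powr Q j" by (rule powr_growth[OF Q(1) S0 \<sigma>(1) c'])
  with ev hi have "\<forall>\<^sub>F j in sequentially. False"
  proof eventually_elim
    case (elim j)
    then obtain x where x: "x \<in> ball x0 \<rho>" "- f j x \<le> C * S powr Q j - c' * \<sigma> powr Q j" by blast
    moreover have "f j x \<le> c * S powr Q j" using elim x by blast
    ultimately show False using elim(3) by (simp add: algebra_simps)
  qed
  then show False by simp
qed

end

section \<open>Growth of the right-hand sides\<close>

lemma uniform_limit_near:
  fixes U :: "nat \<Rightarrow> 'a::metric_space \<Rightarrow> real"
  assumes "uniform_limit UNIV U w sequentially" "continuous_on UNIV w" "e > 0"
  shows "\<exists>\<rho>>0. \<forall>\<^sub>F j in sequentially. \<forall>x\<in>ball x0 \<rho>. \<bar>U j x - w x0\<bar> < e"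
proof -
  obtain \<rho> where \<rho>: "\<rho> > 0" "\<And>x. dist x x0 < \<rho> \<Longrightarrow> dist (w x) (w x0) < e / 2"
    using assms(2,3) unfolding continuous_on_iff by (metis UNIV_I half_gt_zero)
  have "\<forall>\<^sub>F j in sequentially. \<forall>x\<in>UNIV. dist (U j x) (w x) < e / 2"
    by (rule uniform_limitD[OF assms(1)]) (use assms(3) in simp)
  then have "\<forall>\<^sub>F j in sequentially. \<forall>x\<in>ball x0 \<rho>. \<bar>U j x - w x0\<bar> < e"
  proof eventually_elim
    case (elim j)
    show ?case
    proof
      fix x assume "x \<in> ball x0 \<rho>"
      then have "dist (w x) (w x0) < e / 2" by (intro \<rho>(2)) (simp add: dist_commute)
      moreover have "dist (U j x) (w x) < e / 2" using elim by blast
      ultimately have "dist (U j x) (w x0) < e" using dist_triangle[of "U j x" "w x0" "w x"] by linarith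
      then show "\<bar>U j x - w x0\<bar> < e" by (simp add: dist_real_def)
    qed
  qed
  then show ?thesis using \<rho>(1) by blast
qed

text \<open>Stated with a neutral weight \<gamma> so that it can be used for both equations:
  \<gamma> is \<Gamma> in the first and 1 - \<Gamma>, with the components exchanged, in the
  second.\<close>

locale coupled_growth =
  fixes \<Lambda> \<gamma> :: real and Q l a b :: "nat \<Rightarrow> real" and U V :: "nat \<Rightarrow> 'a::metric_space \<Rightarrow> real" and ui vi :: "'a \<Rightarrow> real"
  assumes \<Lambda>: "\<Lambda> > 0" and \<gamma>: "0 < \<gamma>" "\<gamma> < 1"
    and Qpos: "\<And>j. Q j > 0" and l: "\<And>j. l j \<ge> 0" "(\<lambda>j. l j powr (1 / Q j)) \<longlonglongrightarrow> \<Lambda>"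
    and a: "\<And>j. a j \<ge> 1" "\<And>j. a j \<le> Q j" "(\<lambda>j. a j / Q j) \<longlonglongrightarrow> \<gamma>" and b: "\<And>j. b j \<ge> 0" "(\<lambda>j. b j / Q j) \<longlonglongrightarrow> 1 - \<gamma>"
    and nn: "\<And>j x. U j x \<ge> 0" "\<And>j x. V j x \<ge> 0" "\<And>x. ui x \<ge> 0" "\<And>x. vi x \<ge> 0"
    and lim: "uniform_limit UNIV U ui sequentially" "uniform_limit UNIV V vi sequentially"
    and cont: "continuous_on UNIV ui" "continuous_on UNIV vi"
begin

text \<open>The right-hand side of the weak equation for \<open>U\<close>, with the power lowered by
  one on that component. Its root of order Q tends to the nonlinearity of the limit system wherever
  both limits are positive.\<close>

definition rhs where
  "rhs j x = l j * (a j / Q j) * (U j x powr (a j - 1) * V j x powr b j)"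

lemma root_tendsto:
  assumes "A > 0" "B > 0"
  shows "(\<lambda>j. l j powr (1 / Q j) * A powr (a j / Q j) * B powr (b j / Q j)) \<longlonglongrightarrow> \<Lambda> * A powr \<gamma> * B powr (1 - \<gamma>)"
  using assms by (intro tendsto_intros l a b) auto

lemma root_powr:
  assumes "A > 0" "B > 0"
  shows "(l j powr (1 / Q j) * A powr (a j / Q j) * B powr (b j / Q j)) powr Q j = l j * A powr a j * B powr b j"
  using Qpos[of j] l(1)[of j] by (simp add: powr_mult powr_powr)

lemma rhs_lower:
  assumes m': "0 < m'" "m' < \<Lambda> * ui x0 powr \<gamma> * vi x0 powr (1 - \<gamma>)"
  shows "\<exists>c>0. \<exists>\<rho>>0. \<forall>\<^sub>F j in sequentially. \<forall>x\<in>ball x0 \<rho>. c * m' powr Q j \<le> rhs j x"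
proof -
  have "ui x0 \<noteq> 0" "vi x0 \<noteq> 0" using m' by auto
  then have pos: "ui x0 > 0" "vi x0 > 0" using nn(3,4)[of x0] by auto
  have "((\<lambda>e. \<Lambda> * (ui x0 - e) powr \<gamma> * (vi x0 - e) powr (1 - \<gamma>)) \<longlongrightarrow> \<Lambda> * (ui x0 - 0) powr \<gamma> * (vi x0 - 0) powr (1 - \<gamma>)) (at_right 0)"
    using pos by (intro tendsto_intros) auto
  then have "\<forall>\<^sub>F e in at_right 0. m' < \<Lambda> * (ui x0 - e) powr \<gamma> * (vi x0 - e) powr (1 - \<gamma>)"
    by (rule order_tendstoD) (use m' in simp)
  moreover have "\<forall>\<^sub>F e in at_right 0. e \<in> {0<..<min (ui x0) (vi x0)}"
    using pos by (intro eventually_at_right_real) auto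
  ultimately have "\<forall>\<^sub>F e in at_right 0. m' < \<Lambda> * (ui x0 - e) powr \<gamma> * (vi x0 - e) powr (1 - \<gamma>) \<and> e \<in> {0<..<min (ui x0) (vi x0)}"
    by (rule eventually_conj)
  then obtain e where e: "m' < \<Lambda> * (ui x0 - e) powr \<gamma> * (vi x0 - e) powr (1 - \<gamma>)" "0 < e" "e < ui x0" "e < vi x0"
    using eventually_happens'[of "at_right (0::real)"] by auto
  define A where "A = ui x0 - e"
  define B where "B = vi x0 - e"
  have AB: "A > 0" "B > 0" using e by (auto simp: A_def B_def)
  obtain \<rho>1 where \<rho>1: "\<rho>1 > 0" "\<forall>\<^sub>F j in sequentially. \<forall>x\<in>ball x0 \<rho>1. \<bar>U j x - ui x0\<bar> < e"
    using uniform_limit_near[OF lim(1) cont(1) e(2)] by blast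
  obtain \<rho>2 where \<rho>2: "\<rho>2 > 0" "\<forall>\<^sub>F j in sequentially. \<forall>x\<in>ball x0 \<rho>2. \<bar>V j x - vi x0\<bar> < e"
    using uniform_limit_near[OF lim(2) cont(2) e(2)] by blast
  have "\<forall>\<^sub>F j in sequentially. m' < l j powr (1 / Q j) * A powr (a j / Q j) * B powr (b j / Q j)"
    by (rule order_tendstoD[OF root_tendsto[OF AB]]) (use e in \<open>simp add: A_def B_def\<close>)
  moreover have "\<forall>\<^sub>F j in sequentially. \<gamma> / 2 < a j / Q j"
    by (rule order_tendstoD[OF a(3)]) (use \<gamma> in simp)
  \<comment> \<open>The factor \<gamma> / 2 bounds a / Q from below, and 1 / A makes up for the
    power lowered by one.\<close>
  ultimately have "\<forall>\<^sub>F j in sequentially. \<forall>x\<in>ball x0 (min \<rho>1 \<rho>2). \<gamma> / (2 * A) * m' powr Q j \<le> rhs j x"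
    using \<rho>1(2) \<rho>2(2)
  proof eventually_elim
    case (elim j)
    show ?case
    proof
      fix x assume x: "x \<in> ball x0 (min \<rho>1 \<rho>2)"
      have "\<bar>U j x - ui x0\<bar> < e" "\<bar>V j x - vi x0\<bar> < e" using elim(3,4) x by auto
      then have UV: "A \<le> U j x" "B \<le> V j x" unfolding A_def B_def by linarith+
      have "m' powr Q j \<le> (l j powr (1 / Q j) * A powr (a j / Q j) * B powr (b j / Q j)) powr Q j"
        using elim(1) m' Qpos[of j] by (intro powr_mono2) auto
      also have "\<dots> = l j * A powr a j * B powr b j" by (rule root_powr[OF AB])
      finally have 1: "m' powr Q j \<le> l j * A powr a j * B powr b j" .
      have "A powr a j = A * A powr (a j - 1)" using AB by (simp add: powr_mult_base)
      then have "\<gamma> / (2 * A) * m' powr Q j \<le> \<gamma> / (2 * A) * (l j * (A * A powr (a j - 1)) * B powr b j)"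
        using 1 \<gamma> AB by (intro mult_left_mono) auto
      also have "\<dots> = l j * (\<gamma> / 2) * (A powr (a j - 1) * B powr b j)" using AB by simp
      also have "\<dots> \<le> rhs j x"
        unfolding rhs_def using elim(2) UV AB a(1)[of j] b(1)[of j] l(1)[of j] \<gamma> Qpos[of j]
        by (intro mult_mono powr_mono2 mult_nonneg_nonneg) auto
      finally show "\<gamma> / (2 * A) * m' powr Q j \<le> rhs j x" .
    qed
  qed
  moreover have "\<gamma> / (2 * A) > 0" "min \<rho>1 \<rho>2 > 0" using \<gamma> AB \<rho>1 \<rho>2 by auto
  ultimately show ?thesis by blast
qed

lemma rhs_upper:
  assumes m': "m' > \<Lambda> * ui x0 powr \<gamma> * vi x0 powr (1 - \<gamma>)"
  shows "\<exists>c. \<exists>\<rho>>0. \<forall>\<^sub>F j in sequentially. \<forall>x\<in>ball x0 \<rho>. rhs j x \<le> c * m' powr Q j"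
proof -
  have "((\<lambda>e. \<Lambda> * (ui x0 + e) powr \<gamma> * (vi x0 + e) powr (1 - \<gamma>)) \<longlongrightarrow> \<Lambda> * (ui x0 + 0) powr \<gamma> * (vi x0 + 0) powr (1 - \<gamma>)) (at_right 0)"
    using nn(3,4)[of x0] \<gamma> by (intro tendsto_intros tendsto_powr') (auto simp: eventually_at_filter)
  then have "\<forall>\<^sub>F e in at_right 0. \<Lambda> * (ui x0 + e) powr \<gamma> * (vi x0 + e) powr (1 - \<gamma>) < m'"
    by (rule order_tendstoD) (use m' in simp)
  moreover have "\<forall>\<^sub>F e in at_right 0. e \<in> {0<..<1::real}" by (intro eventually_at_right_real) auto
  ultimately have "\<forall>\<^sub>F e in at_right 0. \<Lambda> * (ui x0 + e) powr \<gamma> * (vi x0 + e) powr (1 - \<gamma>) < m' \<and> e \<in> {0<..<1}"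
    by (rule eventually_conj)
  then obtain e where e: "\<Lambda> * (ui x0 + e) powr \<gamma> * (vi x0 + e) powr (1 - \<gamma>) < m'" "0 < e"
    using eventually_happens'[of "at_right (0::real)"] by auto
  \<comment> \<open>The raise by \<open>e\<close> keeps the bases positive even where a limit
    function vanishes, so that dividing by \<open>A\<close> is legitimate.\<close>
  define A where "A = ui x0 + e"
  define B where "B = vi x0 + e"
  have AB: "A > 0" "B > 0" using e nn(3,4)[of x0] by (auto simp: A_def B_def add_nonneg_pos)
  obtain \<rho>1 where \<rho>1: "\<rho>1 > 0" "\<forall>\<^sub>F j in sequentially. \<forall>x\<in>ball x0 \<rho>1. \<bar>U j x - ui x0\<bar> < e"
    using uniform_limit_near[OF lim(1) cont(1) e(2)] by blast
  obtain \<rho>2 where \<rho>2: "\<rho>2 > 0" "\<forall>\<^sub>F j in sequentially. \<forall>x\<in>ball x0 \<rho>2. \<bar>V j x - vi x0\<bar> < e"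
    using uniform_limit_near[OF lim(2) cont(2) e(2)] by blast
  have "\<forall>\<^sub>F j in sequentially. l j powr (1 / Q j) * A powr (a j / Q j) * B powr (b j / Q j) < m'"
    by (rule order_tendstoD[OF root_tendsto[OF AB]]) (use e in \<open>simp add: A_def B_def\<close>)
  then have "\<forall>\<^sub>F j in sequentially. \<forall>x\<in>ball x0 (min \<rho>1 \<rho>2). rhs j x \<le> 1 / A * m' powr Q j"
    using \<rho>1(2) \<rho>2(2)
  proof eventually_elim
    case (elim j)
    show ?case
    proof
      fix x assume x: "x \<in> ball x0 (min \<rho>1 \<rho>2)"
      have "\<bar>U j x - ui x0\<bar> < e" "\<bar>V j x - vi x0\<bar> < e" using elim(2,3) x by auto
      then have UV: "U j x \<le> A" "V j x \<le> B" unfolding A_def B_def by linarith+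
      have "rhs j x \<le> l j * 1 * (A powr (a j - 1) * B powr b j)"
        unfolding rhs_def using UV AB a(1,2)[of j] b(1)[of j] l(1)[of j] nn(1,2)[of j x] Qpos[of j]
        by (intro mult_mono powr_mono2 mult_nonneg_nonneg) auto
      also have "\<dots> = 1 / A * (l j * (A * A powr (a j - 1)) * B powr b j)" using AB by simp
      also have "A * A powr (a j - 1) = A powr a j" using AB by (simp add: powr_mult_base)
      also have "1 / A * (l j * A powr a j * B powr b j) \<le> 1 / A * m' powr Q j"
      proof (rule mult_left_mono)
        have "l j * A powr a j * B powr b j = (l j powr (1 / Q j) * A powr (a j / Q j) * B powr (b j / Q j)) powr Q j"
          by (rule root_powr[OF AB, symmetric])
        also have "\<dots> \<le> m' powr Q j" using elim(1) Qpos[of j] by (intro powr_mono2) auto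
        finally show "l j * A powr a j * B powr b j \<le> m' powr Q j" .
      qed (use AB in simp)
      finally show "rhs j x \<le> 1 / A * m' powr Q j" .
    qed
  qed
  moreover have "min \<rho>1 \<rho>2 > 0" using \<rho>1 \<rho>2 by auto
  ultimately show ?thesis by blast
qed

lemma rhs_nonneg: "rhs j x \<ge> 0"
  unfolding rhs_def using l(1)[of j] a(1)[of j] Qpos[of j] by (intro mult_nonneg_nonneg divide_nonneg_pos) auto

end

lemma continuous_bounded_on_bounded:
  fixes U :: "'a::euclidean_space \<Rightarrow> real"
  assumes "bounded \<Omega>" "continuous_on UNIV U"
  shows "\<exists>K\<ge>0. \<forall>x\<in>\<Omega>. \<bar>U x\<bar> \<le> K"
proof -
  have "bounded (U ` closure \<Omega>)"
    using assms by (intro compact_imp_bounded compact_continuous_image)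
      (auto simp: compact_closure intro: continuous_on_subset)
  then obtain K where "\<And>x. x \<in> closure \<Omega> \<Longrightarrow> \<bar>U x\<bar> \<le> K" by (auto simp: bounded_iff)
  then show ?thesis using closure_subset by (intro exI[of _ "max K 0"]) (force simp: le_max_iff_disj)
qed

context eigen_family
begin

text \<open>Both equations are instances of the same scalar results: the growth estimates supply
  \<open>grow\<close> with m the common nonlinearity at \<open>x0\<close>.\<close>

lemma limit_data_viscosity:
  assumes ld: "limit_data Q U V ui vi"
  shows "viscosity_solution \<Omega> r s \<Gamma> Lam ui vi"
proof -
  note ld' = limit_dataD[OF ld] and b = limit_data_basic[OF ld] and dm = domain_basic[OF dom]
  note rf = continuous_eigenpair[OF ld'(2,3,4)] and g = large_exponentD[OF ld'(2)]
  have Qpos: "Q j > 0" for j using g(1)[of j] by simp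
  have lroot: "(\<lambda>j. lam (Q j) powr (1 / Q j)) \<longlonglongrightarrow> Lam" by (rule filterlim_compose[OF lam_root_tendsto ld'(1)])
  interpret cu: coupled_growth Lam \<Gamma> Q "\<lambda>j. lam (Q j)" "\<lambda>j. \<alpha> (Q j)" "\<lambda>j. \<beta> (Q j)" U V ui vi
    using \<Gamma> Lam_pos Qpos lam_nonneg[OF ld'(2)] lroot g(3,4,7) limit_data_ratio[OF ld] rf(7,8) b ld'(5,6)
    by unfold_locales (auto intro: less_imp_le)
  interpret cv: coupled_growth Lam "1 - \<Gamma>" Q "\<lambda>j. lam (Q j)" "\<lambda>j. \<beta> (Q j)" "\<lambda>j. \<alpha> (Q j)" V U vi ui
    using \<Gamma> Lam_pos Qpos lam_nonneg[OF ld'(2)] lroot g(2,5,8) limit_data_ratio[OF ld] rf(7,8) b ld'(5,6)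
    by unfold_locales (auto intro: less_imp_le)
  have meas[measurable]: "U j \<in> borel_measurable borel" "V j \<in> borel_measurable borel" for j
    using rf(3,4) by (auto intro: borel_measurable_continuous_onI)
  have sp: "\<bar>c\<bar> powr (q - 2) * c = c powr (q - 1)" if "c \<ge> 0" for c q :: real
    using signed_powr_pos[OF that, of q] by (simp add: signed_powr_def)
  have bound: "\<exists>K. \<forall>x\<in>\<Omega>. \<bar>c * (X x powr p1 * Y x powr p2)\<bar> \<le> K"
    if h: "continuous_on UNIV X" "continuous_on UNIV Y" "\<And>x. X x \<ge> 0" "\<And>x. Y x \<ge> 0" "p1 \<ge> 0" "p2 \<ge> 0"
    for c p1 p2 and X Y :: "'a \<Rightarrow> real"
  proof -
    obtain K1 K2 where "\<forall>x\<in>\<Omega>. \<bar>X x\<bar> \<le> K1" "\<forall>x\<in>\<Omega>. \<bar>Y x\<bar> \<le> K2"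
      using continuous_bounded_on_bounded[OF dm(2)] h(1,2) by meson
    then have "\<forall>x\<in>\<Omega>. \<bar>c * (X x powr p1 * Y x powr p2)\<bar> \<le> \<bar>c\<bar> * (K1 powr p1 * K2 powr p2)"
      unfolding abs_mult using h(3-6) by (auto intro!: mult_left_mono mult_mono powr_mono2)
    then show ?thesis by blast
  qed
  have ep: "frac_form r (Q j) (U j) w = (\<integral>x. cu.rhs j x * w x \<partial>lebesgue_on \<Omega>)"
    "frac_form s (Q j) (V j) z = (\<integral>x. cv.rhs j x * z x \<partial>lebesgue_on \<Omega>)"
    if "w \<in> W_tilde r (Q j) \<Omega>" "z \<in> W_tilde s (Q j) \<Omega>" for j w z
  proof -
    have e: "frac_form r (Q j) (U j) w =
          lam (Q j) * (\<alpha> (Q j) / Q j) * (\<integral>x. \<bar>U j x\<bar> powr (\<alpha> (Q j) - 2) * U j x * \<bar>V j x\<bar> powr \<beta> (Q j) * w x \<partial>lebesgue_on \<Omega>)"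
        "frac_form s (Q j) (V j) z =
          lam (Q j) * (\<beta> (Q j) / Q j) * (\<integral>x. \<bar>U j x\<bar> powr \<alpha> (Q j) * \<bar>V j x\<bar> powr (\<beta> (Q j) - 2) * V j x * z x \<partial>lebesgue_on \<Omega>)"
      using rf(5)[of j] that unfolding eigenpair_def by blast+
    show "frac_form r (Q j) (U j) w = (\<integral>x. cu.rhs j x * w x \<partial>lebesgue_on \<Omega>)"
      unfolding e(1) cu.rhs_def sp[OF rf(7)] abs_of_nonneg[OF rf(8)]
      by (simp only: integral_mult_right_zero[symmetric] mult.assoc)
    have re: "\<bar>U j x\<bar> powr \<alpha> (Q j) * \<bar>V j x\<bar> powr (\<beta> (Q j) - 2) * V j x * z x = (V j x powr (\<beta> (Q j) - 1) * U j x powr \<alpha> (Q j)) * z x" for x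
      using sp[OF rf(8)[of j x], of "\<beta> (Q j)"] rf(7)[of j x] by (simp add: mult.assoc mult.left_commute)
    show "frac_form s (Q j) (V j) z = (\<integral>x. cv.rhs j x * z x \<partial>lebesgue_on \<Omega>)"
      unfolding e(2) cv.rhs_def re
      by (simp only: integral_mult_right_zero[symmetric] mult.assoc)
  qed
  \<comment> \<open>The definition of an eigenpair tests both equations jointly, so the zero
    function fills the slot of the other one.\<close>
  have zero: "(\<lambda>_. 0) \<in> W_tilde t (Q j) \<Omega>" for t j
    by (rule W_tilde_continuousI[OF dm(1,2) Qpos]) (auto simp: frac_quotient_def case_prod_unfold)
  interpret wu: weak_family \<Omega> r Q U cu.rhs ui
  proof
    show "\<exists>K. \<forall>x\<in>\<Omega>. \<bar>cu.rhs j x\<bar> \<le> K" for j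
      unfolding cu.rhs_def using rf(3,4,7,8) g(4,7)[of j] by (intro bound) auto
    show "cu.rhs j \<in> borel_measurable borel" for j unfolding cu.rhs_def by measurable
    show "\<forall>w\<in>W_tilde r (Q j) \<Omega>. frac_form r (Q j) (U j) w = (\<integral>x. cu.rhs j x * w x \<partial>lebesgue_on \<Omega>)" for j
      using ep(1)[OF _ zero] by blast
  qed (use dm r ld' Qpos rf in auto)
  interpret wv: weak_family \<Omega> s Q V cv.rhs vi
  proof
    show "\<exists>K. \<forall>x\<in>\<Omega>. \<bar>cv.rhs j x\<bar> \<le> K" for j
      unfolding cv.rhs_def using rf(3,4,7,8) g(2,8)[of j] by (intro bound) auto
    show "cv.rhs j \<in> borel_measurable borel" for j unfolding cv.rhs_def by measurable
    show "\<forall>w\<in>W_tilde s (Q j) \<Omega>. frac_form s (Q j) (V j) w = (\<integral>x. cv.rhs j x * w x \<partial>lebesgue_on \<Omega>)" for j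
      using ep(2)[OF zero] by blast
  qed (use dm s ld' Qpos rf in auto)
  have m0: "Lam * ui x powr \<Gamma> * vi x powr (1 - \<Gamma>) \<ge> 0" for x using Lam_pos by simp
  \<comment> \<open>Exchanging the components and replacing \<Gamma> by 1 - \<Gamma> leaves the
    nonlinearity unchanged.\<close>
  have sw: "Lam * vi x powr (1 - \<Gamma>) * ui x powr (1 - (1 - \<Gamma>)) = Lam * ui x powr \<Gamma> * vi x powr (1 - \<Gamma>)" for x
    by simp
  have "viscosity_subsolution_at r s \<Gamma> Lam ui vi x0" if x0: "x0 \<in> \<Omega>" for x0
    unfolding viscosity_subsolution_at_def
  proof (intro ballI impI conjI; elim conjE)
    fix \<phi> \<psi> :: "'a \<Rightarrow> real"
    assume \<phi>: "\<phi> \<in> C2_compact_support" and \<psi>: "\<psi> \<in> C2_compact_support"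
      and t: "ui x0 = \<phi> x0" "vi x0 = \<psi> x0" "\<forall>x. ui x \<le> \<phi> x" "\<forall>x. vi x \<le> \<psi> x"
    show "min_operator r \<phi> (Lam * ui x0 powr \<Gamma> * vi x0 powr (1 - \<Gamma>)) x0 \<le> 0"
      by (rule wu.subsolution[OF \<phi> x0 t(1) _ m0 cu.rhs_upper]) (use t in auto)
    show "min_operator s \<psi> (Lam * ui x0 powr \<Gamma> * vi x0 powr (1 - \<Gamma>)) x0 \<le> 0"
      by (rule wv.subsolution[OF \<psi> x0 t(2) _ m0 cv.rhs_upper[unfolded sw]]) (use t in auto)
  qed
  moreover have "viscosity_supersolution_at r s \<Gamma> Lam ui vi x0" if x0: "x0 \<in> \<Omega>" for x0
    unfolding viscosity_supersolution_at_def
  proof (intro ballI impI conjI; elim conjE)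
    fix \<phi> \<psi> :: "'a \<Rightarrow> real"
    assume \<phi>: "\<phi> \<in> C2_compact_support" and \<psi>: "\<psi> \<in> C2_compact_support"
      and t: "ui x0 = \<phi> x0" "vi x0 = \<psi> x0" "\<forall>x. \<phi> x \<le> ui x" "\<forall>x. \<psi> x \<le> vi x"
    show "0 \<le> min_operator r \<phi> (Lam * ui x0 powr \<Gamma> * vi x0 powr (1 - \<Gamma>)) x0"
      by (rule wu.supersolution[OF \<phi> x0 t(1) _ cu.rhs_nonneg m0 cu.rhs_lower]) (use t in auto)
    show "0 \<le> min_operator s \<psi> (Lam * ui x0 powr \<Gamma> * vi x0 powr (1 - \<Gamma>)) x0"
      by (rule wv.supersolution[OF \<psi> x0 t(2) _ cv.rhs_nonneg m0 cv.rhs_lower[unfolded sw]]) (use t in auto)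
  qed
  ultimately show ?thesis unfolding viscosity_solution_def using b by auto
qed

end

theorem theorem1p2:
  fixes \<Omega> :: "'a::euclidean_space set"
    and r s \<Gamma> :: real
    and \<alpha> \<beta> :: "real \<Rightarrow> real"
    and u v :: "real \<Rightarrow> 'a \<Rightarrow> real"
  assumes "bounded_smooth_domain \<Omega>"
    and "r \<in> {0<..<1}" and "s \<in> {0<..<1}"
    and "\<And>p. p \<ge> 2 \<Longrightarrow> p * min r s \<ge> real DIM('a) \<Longrightarrow>
           \<alpha> p \<in> {0<..<p} \<and> \<beta> p \<in> {0<..<p} \<and> \<alpha> p + \<beta> p = p \<and> min (\<alpha> p) (\<beta> p) \<ge> 1"
    and "((\<lambda>p. \<alpha> p / p) \<longlongrightarrow> \<Gamma>) at_top" and "0 < \<Gamma>" and "\<Gamma> < 1"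
    and "\<And>p. p \<ge> 2 \<Longrightarrow> p * min r s \<ge> real DIM('a) \<Longrightarrow>
           eigenpair \<Omega> r s p (\<alpha> p) (\<beta> p) (lambda1 \<Omega> r s p (\<alpha> p) (\<beta> p)) (u p) (v p) \<and>
           (AE x in lebesgue_on \<Omega>. u p x > 0 \<and> v p x > 0) \<and>
           coupling \<Omega> (\<alpha> p) (\<beta> p) (u p) (v p) = 1"
  shows "((\<lambda>p. lambda1 \<Omega> r s p (\<alpha> p) (\<beta> p) powr (1 / p)) \<longlongrightarrow> Lambda_inf \<Omega> r s \<Gamma>) at_top \<and>
    Lambda_inf \<Omega> r s \<Gamma> = (1 / inradius \<Omega>) powr ((1 - \<Gamma>) * s + \<Gamma> * r) \<and>
    (\<exists>(P :: nat \<Rightarrow> real) U V u_inf v_inf.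
        filterlim P at_top sequentially \<and>
        (\<forall>j. P j \<ge> 2 \<and> P j * min r s \<ge> real DIM('a)) \<and>
        (\<forall>j. continuous_representative (u (P j)) (U j) \<and>
             continuous_representative (v (P j)) (V j)) \<and>
        uniform_limit (closure \<Omega>) U u_inf sequentially \<and>
        uniform_limit (closure \<Omega>) V v_inf sequentially \<and>
        minimizer_inf \<Omega> r s \<Gamma> u_inf v_inf \<and>
        viscosity_solution \<Omega> r s \<Gamma> (Lambda_inf \<Omega> r s \<Gamma>)
          (zero_extension \<Omega> u_inf) (zero_extension \<Omega> v_inf))"
proof -
  interpret eigen_family \<Omega> r s \<Gamma> \<alpha> \<beta> u v
    by (rule eigen_family.intro) (use assms in auto)
  obtain k U V ui vi where ld: "limit_data (\<lambda>j. real (k j)) U V ui vi"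
    using compactness[OF filterlim_real_sequentially] by blast
  note l = limit_dataD[OF ld] and b = limit_data_basic[OF ld] and m = limit_data_minimizer[OF ld]
  \<comment> \<open>The limits were built on the whole space and already vanish outside
    \<Omega>.\<close>
  have z: "zero_extension \<Omega> ui = ui" "zero_extension \<Omega> vi = vi"
    using b(3,4) by (auto simp: zero_extension_def)
  have "((\<lambda>p. lambda1 \<Omega> r s p (\<alpha> p) (\<beta> p) powr (1 / p)) \<longlongrightarrow> Lambda_inf \<Omega> r s \<Gamma>) at_top"
    using lam_root_tendsto unfolding m(2) lam_def .
  moreover have "Lambda_inf \<Omega> r s \<Gamma> = (1 / inradius \<Omega>) powr ((1 - \<Gamma>) * s + \<Gamma> * r)"
    using m(2) by (simp add: Lam_def)
  moreover have "viscosity_solution \<Omega> r s \<Gamma> (Lambda_inf \<Omega> r s \<Gamma>) (zero_extension \<Omega> ui) (zero_extension \<Omega> vi)"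
    unfolding z m(2) by (rule limit_data_viscosity[OF ld])
  moreover have "\<forall>j. real (k j) \<ge> 2 \<and> real (k j) * min r s \<ge> real DIM('a)"
    using l(2) unfolding large_exponent_def by blast
  moreover have "uniform_limit (closure \<Omega>) U ui sequentially" "uniform_limit (closure \<Omega>) V vi sequentially"
    using l(5,6) by (auto intro: uniform_limit_on_subset)
  ultimately show ?thesis using l(1,3,4) m(1) by blast
qed

end
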